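(* Let $Q_n(x)$, $L_1$, $L_2$, the phases $R(1)$, $R(2)$ and the number $x^*$ be as in the context. (a) Let $X\subset R(1)\setminus[x^*,0]$ be compact. Then, as $n\to\infty$, uniformly for $x\in X$, \[ Q_n(x)=\sqrt[12]{1-x}\,\sqrt{\frac{L_1(x)}{6\pi n^{4/3}}}\,\exp\!\left(\tfrac32 n^{2/3}L_1(x)\right)\left(1+O_X\!\left(n^{-1/3}\right)\right). \] (b) Let $X\subset R(2)$ be compact. Then, as $n\to\infty$, uniformly for $x\in X$, \[ Q_n(x)=(-1)^n\sqrt[24]{1-x^2}\,\sqrt[8]{\frac{1-x}{1+x}}\,\sqrt{\frac{L_2(x)}{6\pi n^{4/3}}}\,\exp\!\left(\tfrac32 n^{2/3}L_2(x)\right)\left(1+O_X\!\left(n^{-1/3}\right)\right). \]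
   Context: A plane partition of a positive integer $n$ is an array $(\pi_{i,j})_{i,j\ge1}$ of nonnegative integers with $\sum\pi_{i,j}=n$; its trace is $\sum_i\pi_{i,i}$. Let $pp_k(n)$ be the number of plane partitions of $n$ with trace $k$, and let $Q_n(x)=\sum_{k=1}^n pp_k(n)x^k$. Equivalently, $\prod_{m\ge1}(1-xu^m)^{-m}=1+\sum_{n\ge1}Q_n(x)u^n$. Let $Li_3(x)=\sum_{n\ge1}x^n/n^3$ be the trilogarithm. For $k\ge1$ and $|x|<1$, set $L_k(x)=\frac1k\sqrt[3]{2\,Li_3(x^k)}$, with the principal branch of the cube root. All other fractional powers and square roots are principal branches. Let $D=\{x:0<|x|<1\}$. For $m\ge1$, the phase $R(m)$ is the union of all open sets $V\subset D$ such that $\Re L_m(x)>\Re L_k(x)$ for all $x\in V$ and all $k\ne m$. It is known that $D$ contains exactly two nonempty phases, $R(1)$ and $R(2)$, whose union is dense in $D$. Their common boundary is $\{x\in D:\Re L_1(x)=\Re L_2(x)\}$, and this set contains exactly one real point $x^*\approx-0.8250030529$. Moreover $R(2)\cap\mathbb R=(-1,x^* )$. The notation $O_X(\cdot)$ means the implied constant depends only on $X$. *)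

theory Defs
  imports "HOL-Analysis.Analysis"
begin

text \<open>Rows and columns are indexed from 0, so an array is a function on all pairs of naturals.\<close>

definition is_plane_partition :: "nat \<Rightarrow> (nat \<Rightarrow> nat \<Rightarrow> nat) \<Rightarrow> bool" where
  "is_plane_partition n \<pi> \<longleftrightarrow>
     (\<forall>i j. \<pi> (Suc i) j \<le> \<pi> i j \<and> \<pi> i (Suc j) \<le> \<pi> i j) \<and>
     finite {(i, j). \<pi> i j \<noteq> 0} \<and>
     (\<Sum>(i, j) \<in> {(i, j). \<pi> i j \<noteq> 0}. \<pi> i j) = n"

definition pp_trace :: "(nat \<Rightarrow> nat \<Rightarrow> nat) \<Rightarrow> nat" where
  "pp_trace \<pi> = (\<Sum>i \<in> {i. \<pi> i i \<noteq> 0}. \<pi> i i)"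

definition pp :: "nat \<Rightarrow> nat \<Rightarrow> nat" where
  "pp k n = card {\<pi>. is_plane_partition n \<pi> \<and> pp_trace \<pi> = k}"

definition Q :: "nat \<Rightarrow> complex \<Rightarrow> complex" where
  "Q n x = (\<Sum>k = 1..n. of_nat (pp k n) * x ^ k)"

definition Li3 :: "complex \<Rightarrow> complex" where
  "Li3 x = (\<Sum>n. x ^ Suc n / of_nat (Suc n) ^ 3)"

text \<open>On the complex numbers, \<open>powr\<close> is defined through the principal logarithm
  (imaginary part in the half-open interval from \<open>-\<pi>\<close>, excluded, to \<open>\<pi>\<close>, included),
  so it gives the principal branch of every root below.\<close>

definition L :: "nat \<Rightarrow> complex \<Rightarrow> complex" where
  "L k x = (2 * Li3 (x ^ k)) powr (1 / 3) / of_nat k"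

definition punctured_disk :: "complex set" where
  "punctured_disk = {x. 0 < norm x \<and> norm x < 1}"

definition phase :: "nat \<Rightarrow> complex set" where
  "phase m = \<Union> {V. open V \<and> V \<subseteq> punctured_disk \<and>
     (\<forall>x \<in> V. \<forall>k. k \<ge> 1 \<and> k \<noteq> m \<longrightarrow> Re (L m x) > Re (L k x))}"

text \<open>There is exactly one such point: for \<open>0 < r < 1\<close> one has \<open>Re (L 1 r) > Re (L 2 r)\<close>, while
  equality at \<open>-r\<close> means \<open>-Li3 (-r) / r = Li3 (r\<^sup>2) / r\<close>, whose left side decreases and whose
  right side increases in \<open>r\<close>. Its value is approximately \<open>-0.8250030529\<close>.\<close>

definition xstar :: real where
  "xstar = (THE r. complex_of_real r \<in> punctured_disk \<and>
     Re (L 1 (complex_of_real r)) = Re (L 2 (complex_of_real r)))"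

end

theory Submission
  imports Defs "HOL-Probability.Probability" "HOL-Complex_Analysis.Complex_Analysis"
begin

text \<open>The diagonals of a plane partition form two chains of interlacing partitions with a common
  start. Hence the trace generating function is a Cauchy sum of Schur functions, and the
  Cauchy identity (proved by commuting the operators that add and remove horizontal strips) gives
  \<open>1 + \<Sum>n. Q n x u^n = exp (\<Sum>k\<ge>1. x^k / k * u^k / (1 - u^k)\<^sup>2)\<close>.

  Since \<open>\<bar>x\<bar> < 1\<close>, the exponent converges geometrically, so the circle method needs no Farey
  dissection. Near a primitive \<open>q\<close>-th root of unity, with \<open>u\<close> replaced by the root times
  \<open>exp (- s)\<close>, the exponent is \<open>(L q x)\<^sup>3 / (2 s\<^sup>2)\<close> up to terms of smaller order, so on the
  circle \<open>Re s = Re (L m x) / n^(1/3)\<close> its real part is at most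
  \<open>n^(2/3) (Re (L q x))\<^sup>3 / (2 (Re (L m x))\<^sup>2)\<close>. In phase \<open>m\<close> this is smaller for every \<open>q \<noteq> m\<close>, so the
  saddle point \<open>s = L m x / n^(1/3)\<close> at the root \<open>1\<close> (for \<open>m = 1\<close>) or \<open>-1\<close> (for \<open>m = 2\<close>)
  dominates, and a Gaussian integral there gives the asymptotics.\<close>

section \<open>Interlacing partitions and the Cauchy identity\<close>

text \<open>The segment excluded in (a) lies where \<open>2 * Li3 x\<close> meets the branch cut.
  There the principal cube root has argument \<pi>/3, and on the vertical line through the saddle
  the conjugate point reaches the same height. At the other points of phase 1, and throughout phase
  2, the argument is strictly below \<pi>/3 in absolute value, so the maximum on that line is
  unique; proving this takes explicit estimates of the trilogarithm.

  The second obstacle is uniformity in \<open>x\<close> and over all roots of unity at once. No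
  estimate uniform in the order of the root is made: a violating sequence of parameters and angles
  is passed to a limit by compactness, which also settles angles that are not rational multiples of
  \<pi>.

  On the combinatorial side all sums are taken in \<open>ennreal\<close>, where every rearrangement
  is allowed. Finiteness of the counts is read off from the finite value of the sum, and complex
  arguments are reached by analytic continuation from positive real ones.\<close>

definition fin_supp :: "(nat \<Rightarrow> nat) \<Rightarrow> bool" where
  "fin_supp f \<longleftrightarrow> (\<exists>M. \<forall>i\<ge>M. f i = 0)"

definition psize :: "(nat \<Rightarrow> nat) \<Rightarrow> nat" where
  "psize f = sum f {i. f i \<noteq> 0}"

text \<open>The relation says that \<open>l\<close> arises from \<open>m\<close> by adding a
  horizontal strip. It forces \<open>l\<close> and \<open>m\<close> to be weakly decreasing, so
  partitions need no type of their own; finite support of \<open>m\<close> follows from that of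
  \<open>l\<close>.\<close>

definition interlaces :: "(nat \<Rightarrow> nat) \<Rightarrow> (nat \<Rightarrow> nat) \<Rightarrow> bool" (infix "\<rhd>" 50) where
  "l \<rhd> m \<longleftrightarrow> fin_supp l \<and> (\<forall>i. m i \<le> l i \<and> l (Suc i) \<le> m i)"

lemma psize_eq: "(\<And>i. i \<ge> M \<Longrightarrow> f i = 0) \<Longrightarrow> psize f = sum f {..<M}"
  unfolding psize_def by (rule sum.mono_neutral_left) (auto, metis neq0_conv not_less)

lemma psize_zero [simp]: "psize (\<lambda>_. 0) = 0"
  by (simp add: psize_def)

lemma interlaces_fin_supp: "l \<rhd> m \<Longrightarrow> fin_supp l \<and> fin_supp m"
  unfolding interlaces_def fin_supp_def by (metis le_zero_eq)

lemma interlaces_psize: assumes "l \<rhd> m" shows "psize m \<le> psize l"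
proof -
  obtain M where M: "\<And>i. i \<ge> M \<Longrightarrow> l i = 0"
    using assms by (auto simp: interlaces_def fin_supp_def)
  have "\<And>i. i \<ge> M \<Longrightarrow> m i = 0"
    using assms M by (metis interlaces_def le_zero_eq)
  thus ?thesis
    using assms by (simp add: psize_eq[of M l] psize_eq[of M m] M interlaces_def sum_mono)
qed

text \<open>The toggle: the entries \<open>l (Suc i)\<close> and \<open>k i\<close> range over the same interval
  from \<open>max (m (Suc i)) (n (Suc i))\<close> to \<open>min (m i) (n i)\<close>, and are exchanged by reflecting it.
  The entry \<open>l 0\<close> is only bounded below, which accounts for the factor \<open>nat\<close>.\<close>

definition toggle :: "(nat \<Rightarrow> nat) \<Rightarrow> (nat \<Rightarrow> nat) \<Rightarrow> (nat \<Rightarrow> nat) \<times> nat \<Rightarrow> nat \<Rightarrow> nat" where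
  "toggle m n = (\<lambda>(k, a) i. case i of 0 \<Rightarrow> max (m 0) (n 0) + a
      | Suc j \<Rightarrow> min (m j) (n j) + max (m (Suc j)) (n (Suc j)) - k j)"

definition untoggle :: "(nat \<Rightarrow> nat) \<Rightarrow> (nat \<Rightarrow> nat) \<Rightarrow> (nat \<Rightarrow> nat) \<Rightarrow> (nat \<Rightarrow> nat) \<times> nat" where
  "untoggle m n l = (\<lambda>i. min (m i) (n i) + max (m (Suc i)) (n (Suc i)) - l (Suc i),
     l 0 - max (m 0) (n 0))"

lemma interlaces_bounds:
  assumes "l \<rhd> m"
  shows "m i \<le> l i" "l (Suc i) \<le> m i"
  using assms by (auto simp: interlaces_def)

lemma toggle_interlaces:
  assumes "m \<rhd> k" "n \<rhd> k"
  shows "toggle m n (k, a) \<rhd> m"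
proof -
  have b: "k i \<le> m i" "m (Suc i) \<le> k i" "k i \<le> n i" "n (Suc i) \<le> k i" for i
    using assms interlaces_bounds by blast+
  obtain M1 M2 where M: "\<And>i. i \<ge> M1 \<Longrightarrow> m i = 0" "\<And>i. i \<ge> M2 \<Longrightarrow> n i = 0"
    using assms by (auto simp: interlaces_def fin_supp_def)
  have "toggle m n (k, a) i = 0" if "i \<ge> Suc (max M1 M2)" for i
    using that M by (cases i) (auto simp: toggle_def)
  hence "fin_supp (toggle m n (k, a))"
    unfolding fin_supp_def by blast
  moreover have "m i \<le> toggle m n (k, a) i \<and> toggle m n (k, a) (Suc i) \<le> m i" for i
    using b[of i] b[of "i - 1"] by (cases i) (auto simp: toggle_def)
  ultimately show ?thesis
    by (simp add: interlaces_def)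
qed

text \<open>By this symmetry, interlacing of the toggled partition has to be checked against one of
  \<open>m\<close> and \<open>n\<close> only.\<close>

lemma toggle_commute: "toggle m n = toggle n m"
  by (simp add: toggle_def max.commute min.commute fun_eq_iff split: nat.split)

lemma untoggle_interlaces:
  assumes "l \<rhd> m" "l \<rhd> n"
  shows "m \<rhd> fst (untoggle m n l)"
proof -
  have b: "m i \<le> l i" "l (Suc i) \<le> m i" "n i \<le> l i" "l (Suc i) \<le> n i" for i
    using assms interlaces_bounds by blast+
  have "fst (untoggle m n l) i \<le> m i \<and> m (Suc i) \<le> fst (untoggle m n l) i" for i
    using b[of i] b[of "Suc i"] by (auto simp: untoggle_def)
  thus ?thesis
    using interlaces_fin_supp[OF assms(1)] by (simp add: interlaces_def)
qed

lemma untoggle_commute: "untoggle m n = untoggle n m"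
  by (simp add: untoggle_def max.commute min.commute fun_eq_iff)

lemma bij_betw_toggle:
  "bij_betw (toggle m n) ({k. m \<rhd> k \<and> n \<rhd> k} \<times> UNIV) {l. l \<rhd> m \<and> l \<rhd> n}"
proof (rule bij_betw_byWitness[where f' = "untoggle m n"])
  show "\<forall>p\<in>{k. m \<rhd> k \<and> n \<rhd> k} \<times> UNIV. untoggle m n (toggle m n p) = p"
  proof clarify
    fix k a assume "m \<rhd> k" "n \<rhd> k"
    hence b: "k i \<le> m i" "m (Suc i) \<le> k i" "k i \<le> n i" "n (Suc i) \<le> k i" for i
      using interlaces_bounds by blast+
    have "min (m i) (n i) + max (m (Suc i)) (n (Suc i))
            - (min (m i) (n i) + max (m (Suc i)) (n (Suc i)) - k i) = k i" for i
      using b[of i] by linarith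
    thus "untoggle m n (toggle m n (k, a)) = (k, a)"
      by (simp add: untoggle_def toggle_def)
  qed
  show "\<forall>l\<in>{l. l \<rhd> m \<and> l \<rhd> n}. toggle m n (untoggle m n l) = l"
  proof clarify
    fix l assume "l \<rhd> m" "l \<rhd> n"
    hence b: "m i \<le> l i" "l (Suc i) \<le> m i" "n i \<le> l i" "l (Suc i) \<le> n i" for i
      using interlaces_bounds by blast+
    show "toggle m n (untoggle m n l) = l"
    proof
      fix i show "toggle m n (untoggle m n l) i = l i"
      proof (cases i)
        case 0
        thus ?thesis using b[of 0] by (simp add: toggle_def untoggle_def)
      next
        case (Suc j)
        have "min (m j) (n j) + max (m (Suc j)) (n (Suc j))
            - (min (m j) (n j) + max (m (Suc j)) (n (Suc j)) - l (Suc j)) = l (Suc j)"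
          using b[of j] b[of "Suc j"] by linarith
        thus ?thesis using Suc by (simp add: toggle_def untoggle_def)
      qed
    qed
  qed
  show "toggle m n ` ({k. m \<rhd> k \<and> n \<rhd> k} \<times> UNIV) \<subseteq> {l. l \<rhd> m \<and> l \<rhd> n}"
    using toggle_interlaces[of m _ n] toggle_interlaces[of n _ m]
    by (auto simp: toggle_commute[of n m])
  show "untoggle m n ` {l. l \<rhd> m \<and> l \<rhd> n} \<subseteq> {k. m \<rhd> k \<and> n \<rhd> k} \<times> UNIV"
  proof clarify
    fix l k a assume "(k, a) = untoggle m n l" "l \<rhd> m" "l \<rhd> n"
    thus "k \<in> {k. m \<rhd> k \<and> n \<rhd> k} \<and> a \<in> UNIV"
      using untoggle_interlaces[of l m n] untoggle_interlaces[of l n m]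
      by (metis (mono_tags) UNIV_I fst_conv mem_Collect_eq untoggle_commute)
  qed
qed

text \<open>Each pair \<open>l (Suc i) + k i\<close> equals the minimum at \<open>i\<close> plus the
  maximum at \<open>Suc i\<close>. Shifting the maxima back by one index pairs them with the minima
  at the same index, and the sum of minimum and maximum is \<open>m i + n i\<close>.\<close>

lemma toggle_psize:
  assumes "m \<rhd> k" "n \<rhd> k"
  shows "psize (toggle m n (k, a)) + psize k = psize m + psize n + a"
proof -
  have b: "k i \<le> m i" "m (Suc i) \<le> k i" "k i \<le> n i" "n (Suc i) \<le> k i" for i
    using assms interlaces_bounds by blast+
  obtain M1 M2 where M12: "\<And>i. i \<ge> M1 \<Longrightarrow> m i = 0" "\<And>i. i \<ge> M2 \<Longrightarrow> n i = 0"
    using assms by (auto simp: interlaces_def fin_supp_def)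
  define M where "M = max M1 M2"
  have M: "m i = 0" "n i = 0" "k i = 0" if "i \<ge> M" for i
    using that M12 b[of i] by (auto simp: M_def)
  have t: "toggle m n (k, a) i = 0" if "i \<ge> Suc M" for i
    using that M by (cases i) (auto simp: toggle_def)
  have "psize (toggle m n (k, a)) + psize k
        = toggle m n (k, a) 0 + (\<Sum>i<M. toggle m n (k, a) (Suc i) + k i)"
    using psize_eq[of "Suc M", OF t] psize_eq[of M k] M
    by (simp add: sum.lessThan_Suc_shift sum.distrib del: sum.lessThan_Suc)
  also have "(\<Sum>i<M. toggle m n (k, a) (Suc i) + k i)
        = (\<Sum>i<M. min (m i) (n i) + max (m (Suc i)) (n (Suc i)))"
  proof (rule sum.cong)
    fix i
    have "min (m i) (n i) + max (m (Suc i)) (n (Suc i)) \<ge> k i"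
      using b[of i] by linarith
    thus "toggle m n (k, a) (Suc i) + k i = min (m i) (n i) + max (m (Suc i)) (n (Suc i))"
      by (simp add: toggle_def)
  qed simp
  \<comment> \<open>The entry at 0 supplies the maximum that the shifted sum lacks; the maximum at
    index \<open>M\<close> that is now included vanishes.\<close>
  also have "toggle m n (k, a) 0 + \<dots> = a + (\<Sum>i<M. min (m i) (n i)) + (\<Sum>i<Suc M. max (m i) (n i))"
    by (simp add: sum.lessThan_Suc_shift sum.distrib toggle_def del: sum.lessThan_Suc)
  also have "\<dots> = a + (\<Sum>i<M. min (m i) (n i) + max (m i) (n i))"
    using M by (simp add: sum.distrib)
  also have "(\<Sum>i<M. min (m i) (n i) + max (m i) (n i)) = (\<Sum>i<M. m i + n i)"
    by (intro sum.cong) (auto simp: min_def max_def)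
  finally show ?thesis
    using psize_eq[of M m] psize_eq[of M n] M by (simp add: sum.distrib)
qed

section \<open>Sums over arbitrary index types with values in the extended nonnegative reals\<close>

abbreviation nsum :: "('a \<Rightarrow> ennreal) \<Rightarrow> ennreal" where
  "nsum f \<equiv> integral\<^sup>N (count_space UNIV) f"

text \<open>Tonelli for counting measures. The type of all functions on the naturals is uncountable,
  but no countability is required here.\<close>

lemma nsum_swap: "nsum (\<lambda>x. nsum (\<lambda>y. f x y)) = nsum (\<lambda>y. nsum (\<lambda>x. f x y))"
  using nn_integral_fst_count_space[of "\<lambda>(x, y). f x y"] nn_integral_snd_count_space[of "\<lambda>(x, y). f x y"]
  by simp

lemma nsum_prod: "nsum (\<lambda>p. f p) = nsum (\<lambda>x. nsum (\<lambda>y. f (x, y)))"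
  by (rule nn_integral_fst_count_space[symmetric])

lemma nsum_cmult: "nsum (\<lambda>x. c * f x) = c * nsum f"
  by (rule nn_integral_cmult) simp

lemma nsum_multc: "nsum (\<lambda>x. f x * c) = nsum f * c"
  by (rule nn_integral_multc) simp

lemma nsum_if_cmult: "(if P then c * nsum f else 0) = nsum (\<lambda>x. if P then c * f x else 0)"
  by (simp add: nsum_cmult)

lemma nsum_restrict: "nsum (\<lambda>x. if x \<in> A then f x else 0) = integral\<^sup>N (count_space A) f"
  by (subst nn_integral_count_space_indicator)
     (auto intro!: nn_integral_cong split: split_indicator)

lemma nsum_reindex:
  assumes "bij_betw g A B"
  shows "nsum (\<lambda>x. if x \<in> B then f x else 0) = nsum (\<lambda>x. if x \<in> A then f (g x) else 0)"
  using nn_integral_bij_count_space[OF assms, of f] by (simp add: nsum_restrict)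

lemma nsum_delta: "nsum (\<lambda>x. if x = a then f x else 0) = f a"
proof -
  have "nsum (\<lambda>x. if x \<in> {a} then f x else 0) = f a"
    unfolding nsum_restrict by (subst nn_integral_count_space_finite) auto
  thus ?thesis by simp
qed

section \<open>Strip operators, Schur functions and the Cauchy identity\<close>

text \<open>This and \<open>rem_strip\<close> are the two half vertex operators in one variable,
  acting on functions of partitions; their kernels are transposes of each other.\<close>

definition add_strip :: "ennreal \<Rightarrow> ((nat \<Rightarrow> nat) \<Rightarrow> ennreal) \<Rightarrow> (nat \<Rightarrow> nat) \<Rightarrow> ennreal" where
  "add_strip y f l = nsum (\<lambda>m. if l \<rhd> m then y ^ (psize l - psize m) * f m else 0)"

definition rem_strip :: "ennreal \<Rightarrow> ((nat \<Rightarrow> nat) \<Rightarrow> ennreal) \<Rightarrow> (nat \<Rightarrow> nat) \<Rightarrow> ennreal" where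
  "rem_strip z f m = nsum (\<lambda>l. if l \<rhd> m then z ^ (psize l - psize m) * f l else 0)"

definition geo :: "ennreal \<Rightarrow> ennreal" where
  "geo w = nsum (\<lambda>a::nat. w ^ a)"

text \<open>The toggle turns a common upper neighbour \<open>l\<close> into a common lower neighbour
  \<open>k\<close> and a free number \<open>a\<close>. By the size formula the two strip sizes are
  swapped and both grow by \<open>a\<close>, so \<open>a\<close> contributes a geometric series in
  \<open>y * z\<close>.\<close>

lemma strip_exchange:
  "nsum (\<lambda>l. if l \<rhd> m \<and> l \<rhd> n then z ^ (psize l - psize m) * y ^ (psize l - psize n) else 0)
   = geo (y * z) * nsum (\<lambda>k. if m \<rhd> k \<and> n \<rhd> k then y ^ (psize m - psize k) * z ^ (psize n - psize k) else 0)"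
proof -
  let ?g = "toggle m n"
  have "nsum (\<lambda>l. if l \<rhd> m \<and> l \<rhd> n then z ^ (psize l - psize m) * y ^ (psize l - psize n) else 0)
     = nsum (\<lambda>p. if p \<in> {k. m \<rhd> k \<and> n \<rhd> k} \<times> UNIV then
          z ^ (psize (?g p) - psize m) * y ^ (psize (?g p) - psize n) else 0)"
    using nsum_reindex[OF bij_betw_toggle[of m n]] by simp
  also have "\<dots> = nsum (\<lambda>p. (if m \<rhd> fst p \<and> n \<rhd> fst p then
       y ^ (psize m - psize (fst p)) * z ^ (psize n - psize (fst p)) else 0) * (y * z) ^ snd p)"
  proof (intro nn_integral_cong)
    fix p :: "(nat \<Rightarrow> nat) \<times> nat"
    obtain k a where p: "p = (k, a)" by (cases p)
    have "z ^ (psize (?g (k, a)) - psize m) * y ^ (psize (?g (k, a)) - psize n)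
       = y ^ (psize m - psize k) * z ^ (psize n - psize k) * (y * z) ^ a" if "m \<rhd> k" "n \<rhd> k"
    proof -
      have "psize (?g (k, a)) - psize m = psize n - psize k + a"
           "psize (?g (k, a)) - psize n = psize m - psize k + a"
        using toggle_psize[OF that, of a] interlaces_psize[OF that(1)] interlaces_psize[OF that(2)]
        by auto
      thus ?thesis by (simp add: power_add power_mult_distrib mult_ac)
    qed
    thus "(if p \<in> {k. m \<rhd> k \<and> n \<rhd> k} \<times> UNIV then
          z ^ (psize (?g p) - psize m) * y ^ (psize (?g p) - psize n) else 0)
       = (if m \<rhd> fst p \<and> n \<rhd> fst p then
       y ^ (psize m - psize (fst p)) * z ^ (psize n - psize (fst p)) else 0) * (y * z) ^ snd p"
      by (auto simp: p)
  qed
  also have "\<dots> = nsum (\<lambda>k. (if m \<rhd> k \<and> n \<rhd> k then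
       y ^ (psize m - psize k) * z ^ (psize n - psize k) else 0) * geo (y * z))"
    by (subst nsum_prod) (simp only: fst_conv snd_conv nsum_cmult geo_def)
  finally show ?thesis
    by (simp only: mult.commute[of _ "geo _"] nsum_cmult)
qed

text \<open>Both sides move from \<open>m\<close> to some \<open>n\<close>, once through a larger
  and once through a smaller partition; \<open>strip_exchange\<close> compares the two kernels entry
  by entry.\<close>

lemma strip_commute: "rem_strip z (add_strip y f) m = geo (y * z) * add_strip y (rem_strip z f) m"
proof -
  have "rem_strip z (add_strip y f) m = nsum (\<lambda>l. nsum (\<lambda>n.
      if l \<rhd> m \<and> l \<rhd> n then z ^ (psize l - psize m) * y ^ (psize l - psize n) * f n else 0))"
    unfolding rem_strip_def add_strip_def nsum_if_cmult
    by (intro nn_integral_cong) (auto simp: mult_ac)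
  also have "\<dots> = nsum (\<lambda>n. nsum (\<lambda>l. if l \<rhd> m \<and> l \<rhd> n
      then z ^ (psize l - psize m) * y ^ (psize l - psize n) * f n else 0))"
    by (rule nsum_swap)
  also have "\<dots> = nsum (\<lambda>n. nsum (\<lambda>l. if l \<rhd> m \<and> l \<rhd> n
      then z ^ (psize l - psize m) * y ^ (psize l - psize n) else 0) * f n)"
    by (subst nsum_multc[symmetric]) (intro nn_integral_cong, auto)
  also have "\<dots> = geo (y * z) * nsum (\<lambda>n. nsum (\<lambda>k. if m \<rhd> k \<and> n \<rhd> k
      then y ^ (psize m - psize k) * z ^ (psize n - psize k) * f n else 0))"
    by (subst strip_exchange, subst nsum_cmult[symmetric], intro nn_integral_cong,
        subst mult.assoc, subst nsum_multc[symmetric], intro arg_cong2[of _ _ _ _ "(*)"] refl nn_integral_cong)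
       auto
  also have "\<dots> = geo (y * z) * nsum (\<lambda>k. nsum (\<lambda>n. if m \<rhd> k \<and> n \<rhd> k
      then y ^ (psize m - psize k) * z ^ (psize n - psize k) * f n else 0))"
    by (subst nsum_swap) simp
  also have "\<dots> = geo (y * z) * add_strip y (rem_strip z f) m"
    unfolding rem_strip_def add_strip_def nsum_if_cmult
    by (intro arg_cong2[of _ _ _ _ "(*)"] refl nn_integral_cong) (auto simp: mult_ac)
  finally show ?thesis .
qed

lemma strip_adjoint: "nsum (\<lambda>l. add_strip z f l * g l) = nsum (\<lambda>m. f m * rem_strip z g m)"
proof -
  have "nsum (\<lambda>l. add_strip z f l * g l)
      = nsum (\<lambda>l. nsum (\<lambda>m. if l \<rhd> m then z ^ (psize l - psize m) * f m * g l else 0))"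
    unfolding add_strip_def by (subst nsum_multc[symmetric]) (intro nn_integral_cong, auto)
  also have "\<dots> = nsum (\<lambda>m. nsum (\<lambda>l. if l \<rhd> m then z ^ (psize l - psize m) * f m * g l else 0))"
    by (rule nsum_swap)
  also have "\<dots> = nsum (\<lambda>m. f m * rem_strip z g m)"
    unfolding rem_strip_def by (subst nsum_cmult[symmetric]) (intro nn_integral_cong, auto simp: mult_ac)
  finally show ?thesis .
qed

text \<open>The branching rule: peeling off one variable removes one horizontal strip, and only the
  empty partition remains when no variables are left.\<close>

primrec schur :: "ennreal list \<Rightarrow> (nat \<Rightarrow> nat) \<Rightarrow> ennreal" where
  "schur [] = (\<lambda>l. if l = (\<lambda>_. 0) then 1 else 0)"
| "schur (y # ys) = add_strip y (schur ys)"

lemma interlaces_zero_left: "(\<lambda>_. 0) \<rhd> m \<longleftrightarrow> m = (\<lambda>_. 0)"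
  by (auto simp: interlaces_def fin_supp_def fun_eq_iff)

text \<open>\<open>rem_strip\<close> is commuted past one \<open>add_strip\<close> after the other,
  collecting a factor each time, until it meets the empty partition, which it fixes because nothing
  larger interlaces into a sum over the vacuum.\<close>

lemma rem_strip_schur: "rem_strip z (schur ys) = (\<lambda>m. (\<Prod>y\<leftarrow>ys. geo (y * z)) * schur ys m)"
proof (induction ys)
  case Nil
  have "rem_strip z (schur []) m = schur [] m" for m
  proof -
    have "rem_strip z (schur []) m
        = nsum (\<lambda>l::nat \<Rightarrow> nat. if l = (\<lambda>_. 0) then (if m = (\<lambda>_. 0) then 1 else 0) else 0)"
      unfolding rem_strip_def by (intro nn_integral_cong) (auto simp: interlaces_zero_left)
    also have "\<dots> = schur [] m"
      by (subst nsum_delta) simp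
    finally show ?thesis .
  qed
  thus ?case by (simp add: fun_eq_iff)
next
  case (Cons y ys)
  have "add_strip y (\<lambda>m. c * f m) m = c * add_strip y f m" for c f m
    unfolding add_strip_def by (subst nsum_cmult[symmetric]) (intro nn_integral_cong, auto simp: mult_ac)
  thus ?case
    by (simp add: fun_eq_iff strip_commute Cons mult.assoc)
qed

lemma schur_zero: "schur ys (\<lambda>_. 0) = 1"
proof (induction ys)
  case (Cons y ys)
  have "add_strip y (schur ys) (\<lambda>_. 0) = nsum (\<lambda>m::nat \<Rightarrow> nat. if m = (\<lambda>_. 0) then 1 else 0)"
    unfolding add_strip_def by (intro nn_integral_cong) (auto simp: interlaces_zero_left Cons)
  thus ?case by (simp add: nsum_delta)
qed simp

text \<open>The outermost \<open>add_strip\<close> of one factor passes to the other factor as its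
  adjoint, and there the Schur function is an eigenvector by \<open>rem_strip_schur\<close>.\<close>

theorem cauchy_identity:
  "nsum (\<lambda>l. schur zs l * schur ys l) = (\<Prod>z\<leftarrow>zs. \<Prod>y\<leftarrow>ys. geo (y * z))"
proof (induction zs)
  case Nil
  have "nsum (\<lambda>l. schur [] l * schur ys l) = nsum (\<lambda>l. if l = (\<lambda>_. 0) then schur ys l else 0)"
    by (intro nn_integral_cong) auto
  thus ?case by (simp add: nsum_delta schur_zero)
next
  case (Cons z zs)
  have "nsum (\<lambda>l. schur (z # zs) l * schur ys l)
      = nsum (\<lambda>m. (\<Prod>y\<leftarrow>ys. geo (y * z)) * (schur zs m * schur ys m))"
    unfolding schur.simps strip_adjoint rem_strip_schur by (simp only: mult_ac)
  thus ?case
    by (simp only: nsum_cmult Cons list.map prod_list.Cons)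
qed

text \<open>Homogeneity: along a sequence of strips from the empty partition to \<open>l\<close> the
  strip sizes telescope to \<open>psize l\<close>.\<close>

lemma schur_scale: "schur (map ((*) t) ys) l = t ^ psize l * schur ys l"
proof (induction ys arbitrary: l)
  case (Cons y ys)
  have "add_strip (t * y) (schur (map ((*) t) ys)) l
      = nsum (\<lambda>m. t ^ psize l * (if l \<rhd> m then y ^ (psize l - psize m) * schur ys m else 0))"
    unfolding add_strip_def
  proof (intro nn_integral_cong)
    fix m
    have "t ^ psize l = t ^ (psize l - psize m) * t ^ psize m" if "l \<rhd> m"
      using interlaces_psize[OF that] by (simp add: power_add[symmetric])
    thus "(if l \<rhd> m then (t * y) ^ (psize l - psize m) * schur (map ((*) t) ys) m else 0)
       = t ^ psize l * (if l \<rhd> m then y ^ (psize l - psize m) * schur ys m else 0)"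
      by (auto simp: Cons power_mult_distrib mult_ac)
  qed
  thus ?case by (simp add: nsum_cmult add_strip_def)
qed simp

section \<open>Plane partitions as pairs of chains\<close>

text \<open>Here \<open>c d\<close> stands for the diagonal at distance \<open>d\<close> from the
  main one, on one side of it; the bound \<open>N\<close> keeps the number of Schur variables
  finite.\<close>

definition chain :: "nat \<Rightarrow> (nat \<Rightarrow> nat \<Rightarrow> nat) \<Rightarrow> bool" where
  "chain N c \<longleftrightarrow> (\<forall>d. c d \<rhd> c (Suc d)) \<and> (\<forall>d\<ge>N. c d = (\<lambda>_. 0))"

text \<open>The main diagonal \<open>c 0\<close> is left out because both chains share it and it
  must be counted once.\<close>

definition tail_size :: "nat \<Rightarrow> (nat \<Rightarrow> nat \<Rightarrow> nat) \<Rightarrow> nat" where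
  "tail_size N c = (\<Sum>d<N. psize (c (Suc d)))"

lemma chain_Suc_case_nat: "chain (Suc N) (case_nat l c) \<longleftrightarrow> chain N c \<and> l \<rhd> c 0"
proof -
  have "(\<forall>d. (case_nat l c :: nat \<Rightarrow> nat \<Rightarrow> nat) d \<rhd> c d) \<longleftrightarrow> l \<rhd> c 0 \<and> (\<forall>d. c d \<rhd> c (Suc d))"
    by (auto split: nat.split)
  moreover have "(\<forall>d\<ge>Suc N. (case_nat l c :: nat \<Rightarrow> nat \<Rightarrow> nat) d = (\<lambda>_. 0)) \<longleftrightarrow> (\<forall>d\<ge>N. c d = (\<lambda>_. 0))"
    by (metis Suc_le_D Suc_le_mono nat.case(2))
  ultimately show ?thesis by (auto simp: chain_def)
qed

text \<open>Prepending a partition moves every diagonal one place outwards, which multiplies all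
  Schur variables by \<open>u\<close>, and the new strip carries weight 1. Iterating this gives the
  variables 1, \<open>u\<close>, \<open>u ^ 2\<close> and so on.\<close>

lemma chain_sum:
  "nsum (\<lambda>c. if chain N c \<and> c 0 = l then u ^ tail_size N c else 0) = schur (map ((^) u) [0..<N]) l"
proof (induction N arbitrary: l)
  case 0
  have "chain 0 c \<longleftrightarrow> c = (\<lambda>_ _. 0)" for c
    by (auto simp: chain_def fun_eq_iff interlaces_def fin_supp_def)
  hence "nsum (\<lambda>c. if chain 0 c \<and> c 0 = l then u ^ tail_size 0 c else 0)
     = nsum (\<lambda>c::nat \<Rightarrow> nat \<Rightarrow> nat. if c = (\<lambda>_ _. 0) then (if l = (\<lambda>_. 0) then 1 else 0) else 0)"
    by (intro nn_integral_cong) (auto simp: tail_size_def)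
  thus ?case by (simp add: nsum_delta)
next
  case (Suc N)
  have "bij_betw (case_nat l) {c. chain N c \<and> l \<rhd> c 0} {c. chain (Suc N) c \<and> c 0 = l}"
  proof (rule bij_betw_byWitness[where f' = "\<lambda>c d. c (Suc d)"])
    show "\<forall>c\<in>{c. chain (Suc N) c \<and> c 0 = l}. case_nat l (\<lambda>d. c (Suc d)) = c"
      by (auto simp: fun_eq_iff split: nat.split)
    thus "(\<lambda>c d. c (Suc d)) ` {c. chain (Suc N) c \<and> c 0 = l} \<subseteq> {c. chain N c \<and> l \<rhd> c 0}"
      using chain_Suc_case_nat[of N l] by (auto simp: chain_def)
  qed (auto simp: chain_Suc_case_nat)
  hence "nsum (\<lambda>c. if chain (Suc N) c \<and> c 0 = l then u ^ tail_size (Suc N) c else 0)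
     = nsum (\<lambda>c. if chain N c \<and> l \<rhd> c 0 then u ^ tail_size (Suc N) (case_nat l c) else 0)"
    using nsum_reindex[of "case_nat l" "{c. chain N c \<and> l \<rhd> c 0}" "{c. chain (Suc N) c \<and> c 0 = l}"
        "\<lambda>c. u ^ tail_size (Suc N) c"] by simp
  \<comment> \<open>A dummy sum over the value \<open>m\<close> of \<open>c 0\<close> is inserted so
    that chains with a prescribed start can be summed first.\<close>
  also have "\<dots> = nsum (\<lambda>c. nsum (\<lambda>m. if m = c 0 then
      (if l \<rhd> m then u ^ psize m * (if chain N c \<and> c 0 = m then u ^ tail_size N c else 0) else 0) else 0))"
    by (subst nsum_delta, intro nn_integral_cong)
       (auto simp: tail_size_def sum.lessThan_Suc_shift power_add simp del: sum.lessThan_Suc)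
  also have "\<dots> = nsum (\<lambda>m. nsum (\<lambda>c. (if l \<rhd> m then u ^ psize m else 0) *
      (if chain N c \<and> c 0 = m then u ^ tail_size N c else 0)))"
    by (subst nsum_swap, intro nn_integral_cong) auto
  also have "\<dots> = nsum (\<lambda>m. (if l \<rhd> m then u ^ psize m else 0) * schur (map ((^) u) [0..<N]) m)"
    by (simp only: nsum_cmult Suc)
  \<comment> \<open>Homogeneity absorbs \<open>u ^ psize m\<close> into the variables.\<close>
  also have "\<dots> = add_strip 1 (schur (map ((*) u) (map ((^) u) [0..<N]))) l"
    unfolding add_strip_def schur_scale by (intro nn_integral_cong) auto
  also have "\<dots> = schur (map ((^) u) [0..<Suc N]) l"
  proof -
    have "map ((^) u) [0..<Suc N] = 1 # map ((*) u) (map ((^) u) [0..<N])"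
      by (subst map_upt_Suc) (auto simp: map_map o_def)
    thus ?thesis by (simp only: schur.simps)
  qed
  finally show ?case .
qed

definition plane_part :: "(nat \<Rightarrow> nat \<Rightarrow> nat) \<Rightarrow> bool" where
  "plane_part p \<longleftrightarrow> (\<forall>i j. p (Suc i) j \<le> p i j \<and> p i (Suc j) \<le> p i j) \<and> finite {(i, j). p i j \<noteq> 0}"

definition pp_size :: "(nat \<Rightarrow> nat \<Rightarrow> nat) \<Rightarrow> nat" where
  "pp_size p = (\<Sum>(i, j) \<in> {(i, j). p i j \<noteq> 0}. p i j)"

lemma is_plane_partition_iff: "is_plane_partition n p \<longleftrightarrow> plane_part p \<and> pp_size p = n"
  by (auto simp: is_plane_partition_def plane_part_def pp_size_def)

definition band :: "nat \<Rightarrow> (nat \<Rightarrow> nat \<Rightarrow> nat) \<Rightarrow> bool" where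
  "band N p \<longleftrightarrow> (\<forall>i j. p i j \<noteq> 0 \<longrightarrow> i < j + N \<and> j < i + N)"

lemma sum_diagonals:
  fixes f :: "nat \<Rightarrow> nat \<Rightarrow> nat"
  assumes z: "\<And>i j. i \<ge> M \<or> j \<ge> M \<Longrightarrow> f i j = 0"
  shows "(\<Sum>i<M. \<Sum>j<M. f i j) = (\<Sum>i<M. f i i) + (\<Sum>d<M. \<Sum>i<M. f i (i + Suc d)) + (\<Sum>d<M. \<Sum>i<M. f (i + Suc d) i)"
proof -
  have row: "(\<Sum>j\<in>{i<..<M}. g j) = (\<Sum>d<M. g (i + Suc d))" if "\<And>j. j \<ge> M \<Longrightarrow> g j = 0"
    for g :: "nat \<Rightarrow> nat" and i
  proof -
    have "(\<Sum>d<M. g (i + Suc d)) = (\<Sum>d\<in>{d. i + Suc d < M}. g (i + Suc d))"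
      by (rule sum.mono_neutral_right) (auto simp: that)
    also have "\<dots> = (\<Sum>j\<in>{i<..<M}. g j)"
      by (rule sum.reindex_bij_witness[of _ "\<lambda>j. j - i - 1" "\<lambda>d. i + Suc d"]) auto
    finally show ?thesis ..
  qed
  have "(\<Sum>j<M. f i j) = f i i + (\<Sum>j\<in>{i<..<M}. f i j) + (\<Sum>j\<in>{..<i}. f i j)" if "i < M" for i
  proof -
    have "{..<M} = {..<i} \<union> insert i {i<..<M}" using that by auto
    hence "(\<Sum>j<M. f i j) = sum (f i) ({..<i} \<union> insert i {i<..<M})" by simp
    also have "\<dots> = sum (f i) {..<i} + sum (f i) (insert i {i<..<M})"
      by (rule sum.union_disjoint) auto
    finally show ?thesis by simp
  qed
  hence "(\<Sum>i<M. \<Sum>j<M. f i j) = (\<Sum>i<M. f i i + (\<Sum>j\<in>{i<..<M}. f i j) + (\<Sum>j\<in>{..<i}. f i j))"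
    by (intro sum.cong) auto
  also have "\<dots> = (\<Sum>i<M. f i i) + (\<Sum>i<M. \<Sum>j\<in>{i<..<M}. f i j) + (\<Sum>i<M. \<Sum>j\<in>{..<i}. f i j)"
    by (simp add: sum.distrib)
  also have "(\<Sum>i<M. \<Sum>j\<in>{..<i}. f i j) = (\<Sum>j<M. \<Sum>i\<in>{j<..<M}. f i j)"
    unfolding sum.Sigma[OF finite_lessThan ballI[OF finite_lessThan]]
      sum.Sigma[OF finite_lessThan ballI[OF finite_greaterThanLessThan]]
    by (rule sum.reindex_bij_witness[of _ "\<lambda>(i, j). (j, i)" "\<lambda>(i, j). (j, i)"]) auto
  also have "\<dots> = (\<Sum>j<M. \<Sum>d<M. f (j + Suc d) j)"
    by (intro sum.cong refl row) (auto simp: z)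
  also have "\<dots> = (\<Sum>d<M. \<Sum>j<M. f (j + Suc d) j)"
    by (rule sum.swap)
  also have "(\<Sum>i<M. \<Sum>j\<in>{i<..<M}. f i j) = (\<Sum>i<M. \<Sum>d<M. f i (i + Suc d))"
    by (intro sum.cong refl row) (auto simp: z)
  also have "\<dots> = (\<Sum>d<M. \<Sum>i<M. f i (i + Suc d))"
    by (rule sum.swap)
  finally show ?thesis .
qed

lemma plane_part_bounded:
  assumes "plane_part p"
  obtains M where "\<And>i j. p i j \<noteq> 0 \<Longrightarrow> i < M \<and> j < M"
proof -
  have "finite (fst ` {(i, j). p i j \<noteq> 0} \<union> snd ` {(i, j). p i j \<noteq> 0})"
    using assms by (simp add: plane_part_def)
  then obtain m where "\<forall>i\<in>fst ` {(i, j). p i j \<noteq> 0} \<union> snd ` {(i, j). p i j \<noteq> 0}. i < m"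
    using finite_nat_set_iff_bounded by blast
  hence "\<And>i j. p i j \<noteq> 0 \<Longrightarrow> i < m \<and> j < m" by force
  thus ?thesis using that by blast
qed

lemma pp_size_diagonals:
  assumes "plane_part p" "band N p"
  shows "pp_size p = pp_trace p + tail_size N (\<lambda>d i. p i (i + d)) + tail_size N (\<lambda>d i. p (i + d) i)"
proof -
  obtain M1 where M1: "\<And>i j. p i j \<noteq> 0 \<Longrightarrow> i < M1 \<and> j < M1"
    using plane_part_bounded[OF assms(1)] by blast
  \<comment> \<open>With \<open>M\<close> at least \<open>N\<close>, the diagonal sums over
    \<open>d < M\<close> shrink to \<open>d < N\<close>, because the band condition empties the
    rest.\<close>
  define M where "M = max M1 N"
  have z: "p i j = 0" if "i \<ge> M \<or> j \<ge> M" for i j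
    using M1[of i j] that by (force simp: M_def)
  have "pp_size p = (\<Sum>(i, j)\<in>{..<M} \<times> {..<M}. p i j)"
    unfolding pp_size_def by (rule sum.mono_neutral_left) (auto, (metis z neq0_conv not_le)+)
  also have "\<dots> = (\<Sum>i<M. \<Sum>j<M. p i j)"
    by (simp add: sum.cartesian_product)
  also have "\<dots> = (\<Sum>i<M. p i i) + (\<Sum>d<M. \<Sum>i<M. p i (i + Suc d)) + (\<Sum>d<M. \<Sum>i<M. p (i + Suc d) i)"
    by (rule sum_diagonals) (use z in auto)
  also have "(\<Sum>i<M. p i i) = pp_trace p"
    using psize_eq[of M "\<lambda>i. p i i"] z by (simp add: psize_def pp_trace_def)
  also have "(\<Sum>d<M. \<Sum>i<M. p i (i + Suc d)) = (\<Sum>d<M. psize (\<lambda>i. p i (i + Suc d)))"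
    by (intro sum.cong refl psize_eq[symmetric]) (use z in auto)
  also have "\<dots> = tail_size N (\<lambda>d i. p i (i + d))"
    unfolding tail_size_def
  proof (rule sum.mono_neutral_right)
    show "\<forall>d\<in>{..<M} - {..<N}. psize (\<lambda>i. p i (i + Suc d)) = 0"
    proof
      fix d assume "d \<in> {..<M} - {..<N}"
      hence "(\<lambda>i. p i (i + Suc d)) = (\<lambda>_. 0)"
        using assms(2) by (force simp: band_def)
      thus "psize (\<lambda>i. p i (i + Suc d)) = 0" by (simp only: psize_zero)
    qed
  qed (auto simp: M_def)
  also have "(\<Sum>d<M. \<Sum>i<M. p (i + Suc d) i) = (\<Sum>d<M. psize (\<lambda>i. p (i + Suc d) i))"
    by (intro sum.cong refl psize_eq[symmetric]) (use z in auto)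
  also have "\<dots> = tail_size N (\<lambda>d i. p (i + d) i)"
    unfolding tail_size_def
  proof (rule sum.mono_neutral_right)
    show "\<forall>d\<in>{..<M} - {..<N}. psize (\<lambda>i. p (i + Suc d) i) = 0"
    proof
      fix d assume "d \<in> {..<M} - {..<N}"
      hence "(\<lambda>i. p (i + Suc d) i) = (\<lambda>_. 0)"
        using assms(2) by (force simp: band_def)
      thus "psize (\<lambda>i. p (i + Suc d) i) = 0" by (simp only: psize_zero)
    qed
  qed (auto simp: M_def)
  finally show ?thesis .
qed

definition glue :: "(nat \<Rightarrow> nat \<Rightarrow> nat) \<times> (nat \<Rightarrow> nat \<Rightarrow> nat) \<Rightarrow> nat \<Rightarrow> nat \<Rightarrow> nat" where
  "glue = (\<lambda>(c, c') i j. if i \<le> j then c (j - i) i else c' (i - j) j)"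

lemma glue_diagonals:
  assumes "c 0 = c' 0"
  shows "(\<lambda>d i. glue (c, c') i (i + d)) = c" "(\<lambda>d i. glue (c, c') (i + d) i) = c'"
  using assms by (auto simp: glue_def fun_eq_iff)

lemma chain_zero:
  assumes "chain N c" "d \<ge> N"
  shows "c d i = 0"
  using assms by (simp add: chain_def)

text \<open>Read along diagonals, monotonicity in rows and in columns is exactly interlacing of
  neighbouring diagonals.\<close>

lemma glue_plane_part:
  assumes "chain N c" "chain N c'" "c 0 = c' 0"
  shows "plane_part (glue (c, c'))" "band N (glue (c, c'))"
proof -
  have b: "c (Suc d) i \<le> c d i" "c d (Suc i) \<le> c (Suc d) i"
          "c' (Suc d) i \<le> c' d i" "c' d (Suc i) \<le> c' (Suc d) i" for d i
    using assms by (auto simp: chain_def interlaces_def)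
  show band: "band N (glue (c, c'))"
    unfolding band_def
  proof (intro allI impI)
    fix i j assume nz: "glue (c, c') i j \<noteq> 0"
    have "j - i < N" "i - j < N"
      using chain_zero[OF assms(1), of "j - i" i] chain_zero[OF assms(2), of "i - j" j] nz
        chain_zero[OF assms(1), of 0 i]
      by (cases "i \<le> j"; force simp: glue_def not_le)+
    thus "i < j + N \<and> j < i + N" by linarith
  qed
  have mono: "glue (c, c') (Suc i) j \<le> glue (c, c') i j \<and> glue (c, c') i (Suc j) \<le> glue (c, c') i j" for i j
  proof -
    \<comment> \<open>The cell is above, on or below the main diagonal; on it, one neighbour belongs
      to each chain, and \<open>c 0 = c' 0\<close> links the two.\<close>
    consider d where "j = i + Suc d" | "j = i" | d where "i = j + Suc d"
      by (metis add_Suc_right less_imp_Suc_add linorder_neqE_nat)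
    thus ?thesis
    proof cases
      case (1 d)
      thus ?thesis using b(2)[of d i] b(1)[of "Suc d" i] by (auto simp: glue_def Suc_diff_le)
    next
      case 2
      thus ?thesis using b(3)[of 0 j] b(1)[of 0 i] assms(3) by (auto simp: glue_def)
    next
      case (3 d)
      thus ?thesis using b(4)[of d j] b(3)[of "Suc d" j] assms(3)
        by (auto simp: glue_def Suc_diff_le) 
    qed
  qed
  have "\<exists>M. \<forall>i\<ge>M. c 0 i = 0"
    using assms(1) by (auto simp: chain_def interlaces_def fin_supp_def)
  then obtain M where M: "\<And>i. i \<ge> M \<Longrightarrow> c 0 i = 0" by blast
  have c0: "c d i \<le> c 0 i" for d i
    by (induction d) (use b(1) order_trans in blast)+
  have c0': "c' d i \<le> c 0 i" for d i
    by (induction d) (use assms(3) in simp, use b(3) order_trans in blast)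
  have "{(i, j). glue (c, c') i j \<noteq> 0} \<subseteq> {..<M + N} \<times> {..<M + N}"
  proof
    fix q assume "q \<in> {(i, j). glue (c, c') i j \<noteq> 0}"
    then obtain i j where q: "q = (i, j)" and nz: "glue (c, c') i j \<noteq> 0" by auto
    have "i < j + N \<and> j < i + N" using band nz by (simp add: band_def)
    moreover have "min i j < M"
    proof (cases "i \<le> j")
      case True
      thus ?thesis using nz M[of i] c0[of "j - i" i] by (cases "M \<le> i") (auto simp: glue_def)
    next
      case False
      thus ?thesis using nz M[of j] c0'[of "i - j" j] by (cases "M \<le> j") (auto simp: glue_def)
    qed
    ultimately show "q \<in> {..<M + N} \<times> {..<M + N}" by (auto simp: q min_def split: if_splits)
  qed
  hence "finite {(i, j). glue (c, c') i j \<noteq> 0}"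
    by (rule finite_subset) auto
  thus "plane_part (glue (c, c'))"
    using mono by (simp add: plane_part_def)
qed

lemma diagonals_chain:
  assumes "plane_part p" "band N p"
  shows "chain N (\<lambda>d i. p i (i + d))" "chain N (\<lambda>d i. p (i + d) i)"
proof -
  have m: "p (Suc i) j \<le> p i j" "p i (Suc j) \<le> p i j" for i j
    using assms by (auto simp: plane_part_def)
  obtain M where M: "\<And>i j. p i j \<noteq> 0 \<Longrightarrow> i < M \<and> j < M"
    using plane_part_bounded[OF assms(1)] by blast
  have "fin_supp (\<lambda>i. p i (i + d))" "fin_supp (\<lambda>i. p (i + d) i)" for d
    using M unfolding fin_supp_def by (metis not_le)+
  thus "chain N (\<lambda>d i. p i (i + d))" "chain N (\<lambda>d i. p (i + d) i)"
    using assms(2) m by (force simp: chain_def interlaces_def band_def fun_eq_iff)+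
qed

lemma bij_betw_glue:
  "bij_betw glue {cc. chain N (fst cc) \<and> chain N (snd cc) \<and> fst cc 0 = snd cc 0} {p. plane_part p \<and> band N p}"
proof (rule bij_betw_byWitness[where f' = "\<lambda>p. (\<lambda>d i. p i (i + d), \<lambda>d i. p (i + d) i)"])
  show "\<forall>cc\<in>{cc. chain N (fst cc) \<and> chain N (snd cc) \<and> fst cc 0 = snd cc 0}.
       (\<lambda>d i. glue cc i (i + d), \<lambda>d i. glue cc (i + d) i) = cc"
    using glue_diagonals by auto
  show "\<forall>p\<in>{p. plane_part p \<and> band N p}. glue (\<lambda>d i. p i (i + d), \<lambda>d i. p (i + d) i) = p"
    by (auto simp: glue_def fun_eq_iff)
  show "glue ` {cc. chain N (fst cc) \<and> chain N (snd cc) \<and> fst cc 0 = snd cc 0} \<subseteq> {p. plane_part p \<and> band N p}"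
    using glue_plane_part by auto
  show "(\<lambda>p. (\<lambda>d i. p i (i + d), \<lambda>d i. p (i + d) i)) ` {p. plane_part p \<and> band N p}
      \<subseteq> {cc. chain N (fst cc) \<and> chain N (snd cc) \<and> fst cc 0 = snd cc 0}"
    using diagonals_chain by auto
qed

text \<open>For a fixed main diagonal \<open>l\<close> the two chains are independent and contribute
  the same Schur function. The remaining weight \<open>(x * u) ^ psize l\<close> is absorbed by
  homogeneity into one of the two, and the Cauchy identity sums over \<open>l\<close>.\<close>

lemma band_sum:
  "nsum (\<lambda>p. if plane_part p \<and> band N p then x ^ pp_trace p * u ^ pp_size p else 0)
   = (\<Prod>i<N. \<Prod>j<N. geo (x * u ^ Suc (i + j)))"
proof -
  let ?s = "schur (map ((^) u) [0..<N])"
  have "nsum (\<lambda>p. if plane_part p \<and> band N p then x ^ pp_trace p * u ^ pp_size p else 0)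
     = nsum (\<lambda>cc. if chain N (fst cc) \<and> chain N (snd cc) \<and> fst cc 0 = snd cc 0 then
         x ^ pp_trace (glue cc) * u ^ pp_size (glue cc) else 0)"
    using nsum_reindex[OF bij_betw_glue[of N], of "\<lambda>p. x ^ pp_trace p * u ^ pp_size p"] by simp
  \<comment> \<open>Naming the common start \<open>l\<close> by a dummy sum decouples the two
    chains.\<close>
  also have "\<dots> = nsum (\<lambda>cc. nsum (\<lambda>l. if l = fst cc 0 then (x * u) ^ psize l *
        (if chain N (fst cc) \<and> fst cc 0 = l then u ^ tail_size N (fst cc) else 0) *
        (if chain N (snd cc) \<and> snd cc 0 = l then u ^ tail_size N (snd cc) else 0) else 0))"
  proof (subst nsum_delta, intro nn_integral_cong)
    fix cc :: "(nat \<Rightarrow> nat \<Rightarrow> nat) \<times> (nat \<Rightarrow> nat \<Rightarrow> nat)"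
    obtain c c' where cc: "cc = (c, c')" by (cases cc)
    have "x ^ pp_trace (glue cc) * u ^ pp_size (glue cc)
       = (x * u) ^ psize (c 0) * u ^ tail_size N c * u ^ tail_size N c'"
      if "chain N c" "chain N c'" "c 0 = c' 0"
    proof -
      have "pp_trace (glue cc) = psize (c 0)"
        by (simp add: cc pp_trace_def psize_def glue_def)
      thus ?thesis
        using pp_size_diagonals[OF glue_plane_part[OF that]]
        by (simp add: cc glue_diagonals[of c c', OF that(3)] power_add power_mult_distrib mult_ac)
    qed
    thus "(if chain N (fst cc) \<and> chain N (snd cc) \<and> fst cc 0 = snd cc 0 then
         x ^ pp_trace (glue cc) * u ^ pp_size (glue cc) else 0)
      = (x * u) ^ psize (fst cc 0) *
        (if chain N (fst cc) \<and> fst cc 0 = fst cc 0 then u ^ tail_size N (fst cc) else 0) *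
        (if chain N (snd cc) \<and> snd cc 0 = fst cc 0 then u ^ tail_size N (snd cc) else 0)"
      by (auto simp: cc)
  qed
  also have "\<dots> = nsum (\<lambda>l. nsum (\<lambda>cc. (x * u) ^ psize l *
        (if chain N (fst cc) \<and> fst cc 0 = l then u ^ tail_size N (fst cc) else 0) *
        (if chain N (snd cc) \<and> snd cc 0 = l then u ^ tail_size N (snd cc) else 0)))"
    by (subst nsum_swap, intro nn_integral_cong) auto
  also have "\<dots> = nsum (\<lambda>l. (x * u) ^ psize l * ?s l * ?s l)"
    by (subst nsum_prod) (simp only: fst_conv snd_conv nsum_cmult nsum_multc chain_sum)
  also have "\<dots> = nsum (\<lambda>l. ?s l * schur (map ((*) (x * u)) (map ((^) u) [0..<N])) l)"
    by (simp only: schur_scale mult_ac)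
  also have "\<dots> = (\<Prod>z\<leftarrow>map ((^) u) [0..<N]. \<Prod>y\<leftarrow>map ((*) (x * u)) (map ((^) u) [0..<N]). geo (y * z))"
    by (rule cauchy_identity)
  also have "\<dots> = (\<Prod>i<N. \<Prod>j<N. geo (x * u ^ Suc (i + j)))"
    by (simp add: prod.distinct_set_conv_list[symmetric] o_def atLeast0LessThan power_add mult_ac)
  finally show ?thesis .
qed

section \<open>The trace generating function\<close>

lemma sums_of_ennreal_suminf:
  fixes f :: "nat \<Rightarrow> real"
  assumes "\<And>n. f n \<ge> 0" "(\<Sum>n. ennreal (f n)) = ennreal r" "r \<ge> 0"
  shows "f sums r"
proof -
  have s: "summable f"
    using assms by (intro summable_suminf_not_top) auto
  hence "ennreal (suminf f) = ennreal r"
    using assms by (simp add: suminf_ennreal2)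
  hence "suminf f = r"
    using ennreal_inj[OF suminf_nonneg[OF s assms(1)] assms(3)] by blast
  thus ?thesis using s by (simp add: sums_iff)
qed

lemma geo_ennreal:
  assumes "0 \<le> w" "w < 1"
  shows "geo (ennreal w) = ennreal (1 / (1 - w))"
proof -
  have "(\<lambda>n. w ^ n) sums (1 / (1 - w))"
    using assms by (intro geometric_sums) auto
  thus ?thesis
    using assms unfolding geo_def
    by (simp add: nn_integral_count_space_nat ennreal_power suminf_ennreal2 sums_iff)
qed

text \<open>The logarithm of the product of \<open>(1 - x * u ^ m)\<close> to the power
  \<open>-m\<close>: the logarithms are expanded in powers of \<open>x\<close>, and the sum of
  \<open>m * u ^ (m * k)\<close> over \<open>m\<close> is \<open>u ^ k / (1 - u ^ k) ^ 2\<close>.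
  One definition serves real and complex arguments.\<close>

definition log_gf :: "'a :: {real_normed_field, banach} \<Rightarrow> 'a \<Rightarrow> 'a" where
  "log_gf x u = (\<Sum>k. x ^ Suc k / of_nat (Suc k) * (u ^ Suc k / (1 - u ^ Suc k) ^ 2))"

lemma norm_log_gf_factor:
  fixes u :: "'a :: real_normed_field"
  assumes "norm u \<le> r" "r < 1"
  shows "norm (u ^ Suc k / (1 - u ^ Suc k) ^ 2) \<le> 1 / (1 - r) ^ 2"
proof -
  have "norm (u ^ Suc k) \<le> norm u * 1"
    using assms unfolding power_Suc norm_mult norm_power
    by (intro mult_left_mono power_le_one) auto
  hence a: "norm (u ^ Suc k) \<le> r" using assms by simp
  have "1 - r \<le> norm (1 - u ^ Suc k)"
    using a norm_triangle_ineq2[of 1 "u ^ Suc k"] by simp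
  hence "(1 - r) ^ 2 \<le> norm (1 - u ^ Suc k) ^ 2"
    using assms by (intro power_mono) auto
  moreover have "norm (u ^ Suc k) \<le> 1" using a assms by linarith
  ultimately show ?thesis
    unfolding norm_divide norm_power using assms by (intro frac_le) auto
qed

lemma norm_log_gf_term:
  fixes x u :: "'a :: {real_normed_field, banach}"
  assumes "norm x \<le> s" "norm u \<le> r" "r < 1"
  shows "norm (x ^ Suc k / of_nat (Suc k) * (u ^ Suc k / (1 - u ^ Suc k) ^ 2)) \<le> s ^ Suc k / (1 - r) ^ 2"
proof -
  have "norm (x ^ Suc k / of_nat (Suc k)) \<le> s ^ Suc k / 1"
    unfolding norm_divide norm_power norm_of_nat
    using assms order_trans[OF norm_ge_zero assms(1)] by (intro frac_le power_mono) auto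
  hence "norm (x ^ Suc k / of_nat (Suc k)) * norm (u ^ Suc k / (1 - u ^ Suc k) ^ 2)
      \<le> s ^ Suc k / 1 * (1 / (1 - r) ^ 2)"
    using norm_log_gf_factor[OF assms(2,3), of k] order_trans[OF norm_ge_zero assms(1)]
    by (intro mult_mono) auto
  thus ?thesis unfolding norm_mult by simp
qed

lemma summable_log_gf_bound:
  fixes s r :: real
  assumes "0 \<le> s" "s < 1"
  shows "summable (\<lambda>k. s ^ Suc k / (1 - r) ^ 2)"
  using assms by (intro summable_divide summable_Suc_iff[THEN iffD2] summable_geometric) auto

lemma minus_ln_sums:
  fixes w :: real
  assumes "0 \<le> w" "w < 1"
  shows "(\<lambda>k. w ^ Suc k / real (Suc k)) sums (- ln (1 - w))"
proof -
  have "(\<lambda>n. - ((- (- w)) ^ n) / of_nat n) sums ln (1 + (- w))"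
    by (rule ln_series') (use assms in auto)
  hence "(\<lambda>n. w ^ n / real n) sums (- ln (1 - w))"
    using sums_minus by fastforce
  thus ?thesis by (subst sums_Suc_iff) auto
qed

lemma mult_power_Suc_less_one:
  fixes x u :: real
  assumes "0 < x" "x < 1" "0 < u" "u < 1"
  shows "x * u ^ Suc n < 1"
proof -
  have "u ^ Suc n < 1" using assms by (intro power_Suc_less_one) auto
  thus ?thesis using assms mult_strict_mono[of x 1 "u ^ Suc n" 1] by simp
qed

text \<open>The logarithm of the finite product is the same series with both geometric sums
  truncated at \<open>N\<close>. Tannery's theorem with majorant
  \<open>x ^ Suc k / (1 - u) ^ 2\<close> passes to the limit.\<close>

lemma product_tendsto_exp_log_gf:
  fixes x u :: real
  assumes x: "0 < x" "x < 1" and u: "0 < u" "u < 1"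
  shows "(\<lambda>N. \<Prod>i<N. \<Prod>j<N. 1 / (1 - x * u ^ Suc (i + j))) \<longlonglongrightarrow> exp (log_gf x u)"
proof -
  define a where "a = (\<lambda>k N. x ^ Suc k / real (Suc k) * (u ^ Suc k * (\<Sum>i<N. (u ^ Suc k) ^ i) ^ 2))"
  note less1 = mult_power_Suc_less_one[OF x u]
  have uk: "0 < u ^ Suc k" "u ^ Suc k < 1" for k
    using u power_Suc_less_one[of u k] by auto
  have "(\<lambda>k. a k N) sums ln (\<Prod>i<N. \<Prod>j<N. 1 / (1 - x * u ^ Suc (i + j)))" for N
  proof -
    have "(\<lambda>k. \<Sum>i<N. \<Sum>j<N. (x * u ^ Suc (i + j)) ^ Suc k / real (Suc k)) sums
          (\<Sum>i<N. \<Sum>j<N. - ln (1 - x * u ^ Suc (i + j)))"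
      by (intro sums_sum minus_ln_sums) (use x u less1 in auto)
    also have "(\<Sum>i<N. \<Sum>j<N. - ln (1 - x * u ^ Suc (i + j))) = ln (\<Prod>i<N. \<Prod>j<N. 1 / (1 - x * u ^ Suc (i + j)))"
    proof -
      have pos: "0 < 1 / (1 - x * u ^ Suc (i + j))" for i j
        using less1[of "i + j"] by (simp del: power_Suc)
      have "ln (\<Prod>i<N. \<Prod>j<N. 1 / (1 - x * u ^ Suc (i + j))) = (\<Sum>i<N. ln (\<Prod>j<N. 1 / (1 - x * u ^ Suc (i + j))))"
        by (rule ln_prod) (use pos in \<open>auto simp: less_imp_neq[symmetric] simp del: power_Suc\<close>)
      also have "\<dots> = (\<Sum>i<N. \<Sum>j<N. ln (1 / (1 - x * u ^ Suc (i + j))))"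
        by (intro sum.cong refl ln_prod) (use pos in \<open>auto simp: less_imp_neq[symmetric] simp del: power_Suc\<close>)
      also have "\<dots> = (\<Sum>i<N. \<Sum>j<N. - ln (1 - x * u ^ Suc (i + j)))"
        by (intro sum.cong refl) (use less1 in \<open>simp add: ln_div del: power_Suc\<close>)
      finally show ?thesis ..
    qed
    also have "(\<lambda>k. \<Sum>i<N. \<Sum>j<N. (x * u ^ Suc (i + j)) ^ Suc k / real (Suc k)) = (\<lambda>k. a k N)"
    proof
      fix k
      have "(x * u ^ Suc (i + j)) ^ Suc k / real (Suc k)
          = x ^ Suc k / real (Suc k) * (u ^ Suc k * ((u ^ Suc k) ^ i * (u ^ Suc k) ^ j))" for i j
      proof -
        have "(u ^ Suc (i + j)) ^ Suc k = (u ^ Suc k) ^ Suc (i + j)"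
          by (simp only: power_mult[symmetric] mult.commute)
        also have "\<dots> = u ^ Suc k * ((u ^ Suc k) ^ i * (u ^ Suc k) ^ j)"
          by (simp only: power_Suc[of "u ^ Suc k"] power_add)
        finally show ?thesis by (simp only: power_mult_distrib times_divide_eq_left)
      qed
      thus "(\<Sum>i<N. \<Sum>j<N. (x * u ^ Suc (i + j)) ^ Suc k / real (Suc k)) = a k N"
        by (simp only: a_def sum_distrib_left[symmetric] sum_distrib_right[symmetric] power2_eq_square)
    qed
    finally show ?thesis .
  qed
  note a_sums = this
  have "((\<lambda>N. a k N) \<longlongrightarrow> x ^ Suc k / real (Suc k) * (u ^ Suc k / (1 - u ^ Suc k) ^ 2)) sequentially" for k
  proof -
    have "(\<lambda>i. (u ^ Suc k) ^ i) sums (1 / (1 - u ^ Suc k))"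
      using uk[of k] by (intro geometric_sums) auto
    hence "(\<lambda>N. \<Sum>i<N. (u ^ Suc k) ^ i) \<longlonglongrightarrow> 1 / (1 - u ^ Suc k)"
      by (simp add: sums_def)
    hence "(\<lambda>N. a k N) \<longlonglongrightarrow> x ^ Suc k / real (Suc k) * (u ^ Suc k * (1 / (1 - u ^ Suc k)) ^ 2)"
      unfolding a_def by (intro tendsto_intros)
    thus ?thesis by (simp add: power_divide)
  qed
  moreover have "norm (a k N) \<le> x ^ Suc k / (1 - u) ^ 2" for k N
  proof -
    have "(\<Sum>i<N. (u ^ Suc k) ^ i) \<le> 1 / (1 - u ^ Suc k)"
    proof -
      have "(\<Sum>i<N. (u ^ Suc k) ^ i) \<le> (\<Sum>i. (u ^ Suc k) ^ i)"
        using uk[of k] by (intro sum_le_suminf summable_geometric) (auto simp del: power_Suc)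
      thus ?thesis using uk[of k] suminf_geometric[of "u ^ Suc k"] by simp
    qed
    hence "(\<Sum>i<N. (u ^ Suc k) ^ i) ^ 2 \<le> (1 / (1 - u ^ Suc k)) ^ 2"
      using uk[of k] by (intro power_mono sum_nonneg) (auto simp del: power_Suc)
    hence "a k N \<le> x ^ Suc k / real (Suc k) * (u ^ Suc k * (1 / (1 - u ^ Suc k)) ^ 2)"
      unfolding a_def using x uk[of k] by (intro mult_left_mono) (auto simp del: power_Suc)
    also have "\<dots> = norm (x ^ Suc k / of_nat (Suc k) * (u ^ Suc k / (1 - u ^ Suc k) ^ 2))"
      using x uk[of k] by (simp add: power_divide abs_mult del: power_Suc)
    also have "\<dots> \<le> x ^ Suc k / (1 - u) ^ 2"
      using x u by (intro norm_log_gf_term) auto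
    finally have "a k N \<le> x ^ Suc k / (1 - u) ^ 2" .
    moreover have "a k N \<ge> 0"
      unfolding a_def using x uk[of k] by (simp del: power_Suc)
    ultimately show ?thesis by simp
  qed
  hence "\<forall>\<^sub>F (k, N) in sequentially \<times>\<^sub>F sequentially. norm (a k N) \<le> x ^ Suc k / (1 - u) ^ 2"
    by (intro always_eventually) auto
  moreover have "summable (\<lambda>k. x ^ Suc k / (1 - u) ^ 2)"
    using x by (intro summable_log_gf_bound) auto
  ultimately have "((\<lambda>N. \<Sum>k. a k N) \<longlongrightarrow> log_gf x u) sequentially"
    unfolding log_gf_def by (intro tannerys_theorem[THEN conjunct2, THEN conjunct2]) auto
  hence "(\<lambda>N. ln (\<Prod>i<N. \<Prod>j<N. 1 / (1 - x * u ^ Suc (i + j)))) \<longlonglongrightarrow> log_gf x u"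
    using a_sums by (simp add: sums_iff)
  hence "(\<lambda>N. exp (ln (\<Prod>i<N. \<Prod>j<N. 1 / (1 - x * u ^ Suc (i + j))))) \<longlonglongrightarrow> exp (log_gf x u)"
    by (rule tendsto_exp)
  moreover have "exp (ln (\<Prod>i<N. \<Prod>j<N. 1 / (1 - x * u ^ Suc (i + j)))) = (\<Prod>i<N. \<Prod>j<N. 1 / (1 - x * u ^ Suc (i + j)))" for N
    by (intro exp_ln prod_pos) (use less1 in \<open>simp del: power_Suc\<close>)
  ultimately show ?thesis by simp
qed

text \<open>Every plane partition lies in some band, so monotone convergence in the band width turns
  the finite products into the infinite one.\<close>

lemma plane_part_sum:
  assumes x: "0 < x" "x < 1" and u: "0 < u" "u < 1"
  shows "nsum (\<lambda>p. if plane_part p then ennreal (x ^ pp_trace p * u ^ pp_size p) else 0) = ennreal (exp (log_gf x u))"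
proof -
  define f where "f = (\<lambda>N p. if plane_part p \<and> band N p then ennreal (x ^ pp_trace p * u ^ pp_size p) else 0)"
  have inc: "incseq f"
    by (auto simp: incseq_def le_fun_def f_def band_def) (meson add_left_mono order_less_le_trans)+
  have "(SUP N. f N p) = (if plane_part p then ennreal (x ^ pp_trace p * u ^ pp_size p) else 0)" for p
  proof (cases "plane_part p")
    case True
    hence "finite ((\<lambda>(i, j). i + j) ` {(i, j). p i j \<noteq> 0})"
      by (simp add: plane_part_def)
    then obtain N where "\<forall>k\<in>(\<lambda>(i, j). i + j) ` {(i, j). p i j \<noteq> 0}. k < N"
      using finite_nat_set_iff_bounded by blast
    hence "\<And>i j. p i j \<noteq> 0 \<Longrightarrow> i + j < N" by force
    hence "band N p" unfolding band_def by (meson add_lessD1 add_leD2 le_add2 order_le_less_trans trans_less_add2 add.commute add_strict_increasing2 le0 not_add_less1 le_add1 less_le_trans)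
    hence N: "f N p = ennreal (x ^ pp_trace p * u ^ pp_size p)"
      using True by (simp add: f_def)
    show ?thesis
    proof (rule antisym)
      show "(SUP N. f N p) \<le> (if plane_part p then ennreal (x ^ pp_trace p * u ^ pp_size p) else 0)"
        by (rule SUP_least) (auto simp: f_def)
      show "(if plane_part p then ennreal (x ^ pp_trace p * u ^ pp_size p) else 0) \<le> (SUP N. f N p)"
        using True N by (intro SUP_upper2[of N]) auto
    qed
  qed (simp add: f_def)
  hence "nsum (\<lambda>p. if plane_part p then ennreal (x ^ pp_trace p * u ^ pp_size p) else 0) = nsum (\<lambda>p. SUP N. f N p)"
    by simp
  also have "\<dots> = (SUP N. nsum (f N))"
    using inc by (intro nn_integral_monotone_convergence_SUP) auto
  also have "(\<lambda>N. nsum (f N)) = (\<lambda>N. ennreal (\<Prod>i<N. \<Prod>j<N. 1 / (1 - x * u ^ Suc (i + j))))"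
  proof
    fix N
    note less1 = mult_power_Suc_less_one[OF x u]
    have "nsum (f N) = nsum (\<lambda>p. if plane_part p \<and> band N p then ennreal x ^ pp_trace p * ennreal u ^ pp_size p else 0)"
      using x u by (intro nn_integral_cong) (auto simp: f_def ennreal_power ennreal_mult)
    also have "\<dots> = (\<Prod>i<N. \<Prod>j<N. geo (ennreal x * ennreal u ^ Suc (i + j)))"
      by (rule band_sum)
    also have "\<dots> = (\<Prod>i<N. \<Prod>j<N. ennreal (1 / (1 - x * u ^ Suc (i + j))))"
      using x u less1
      by (intro prod.cong refl) (simp add: ennreal_power ennreal_mult[symmetric] geo_ennreal del: power_Suc)
    also have "\<dots> = ennreal (\<Prod>i<N. \<Prod>j<N. 1 / (1 - x * u ^ Suc (i + j)))"
      using less1 by (simp add: prod_ennreal prod_nonneg less_imp_le del: power_Suc)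
    finally show "nsum (f N) = ennreal (\<Prod>i<N. \<Prod>j<N. 1 / (1 - x * u ^ Suc (i + j)))" .
  qed
  also have "(SUP N. ennreal (\<Prod>i<N. \<Prod>j<N. 1 / (1 - x * u ^ Suc (i + j)))) = ennreal (exp (log_gf x u))"
  proof -
    have "incseq (\<lambda>N. nsum (f N))"
      using inc by (auto simp: incseq_def le_fun_def intro!: nn_integral_mono)
    hence "incseq (\<lambda>N. ennreal (\<Prod>i<N. \<Prod>j<N. 1 / (1 - x * u ^ Suc (i + j))))"
      using \<open>(\<lambda>N. nsum (f N)) = _\<close> by simp
    from LIMSEQ_SUP[OF this] tendsto_ennrealI[OF product_tendsto_exp_log_gf[OF x u]]
    show ?thesis by (rule LIMSEQ_unique)
  qed
  finally show ?thesis .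
qed

section \<open>From the sum over plane partitions to coefficients\<close>

text \<open>Infinitely many summands of equal positive weight would make the sum at
  \<open>x = u = 1/2\<close> infinite, but it is \<open>exp (log_gf x u)\<close>. Without finiteness
  the \<open>card\<close> in \<open>pp\<close> would not be a count.\<close>

lemma finite_plane_partitions: "finite {p. is_plane_partition n p \<and> pp_trace p = k}" (is "finite ?A")
proof (rule ccontr)
  assume inf: "infinite ?A"
  have "ennreal ((1/2) ^ k * (1/2) ^ n) * emeasure (count_space UNIV) ?A
      = nsum (\<lambda>p. ennreal ((1/2) ^ k * (1/2) ^ n) * indicator ?A p)"
    by (rule nn_integral_cmult_indicator[symmetric]) simp
  also have "\<dots> \<le> nsum (\<lambda>p. if plane_part p then ennreal ((1/2) ^ pp_trace p * (1/2) ^ pp_size p) else 0)"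
    by (intro nn_integral_mono) (auto simp: is_plane_partition_iff split: split_indicator)
  also have "\<dots> < \<top>"
    by (subst plane_part_sum) auto
  finally show False using inf by (simp add: ennreal_mult_eq_top_iff emeasure_count_space_infinite)
qed

lemma pp_trace_le_size:
  assumes "plane_part p"
  shows "pp_trace p \<le> pp_size p"
proof -
  have fin: "finite {(i, j). p i j \<noteq> 0}" using assms by (simp add: plane_part_def)
  have "pp_trace p = (\<Sum>(i, j)\<in>(\<lambda>i. (i, i)) ` {i. p i i \<noteq> 0}. p i j)"
    by (subst sum.reindex) (auto simp: inj_on_def pp_trace_def)
  also have "\<dots> \<le> pp_size p"
    unfolding pp_size_def by (rule sum_mono2) (use fin in auto)
  finally show ?thesis .
qed

lemma pp_trace_eq_0:
  assumes "plane_part p" "pp_trace p = 0"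
  shows "p = (\<lambda>_ _. 0)"
proof -
  have m: "p (Suc i) j \<le> p i j" "p i (Suc j) \<le> p i j" for i j
    using assms by (auto simp: plane_part_def)
  have "finite {i. p i i \<noteq> 0}"
  proof -
    have "finite (fst ` {(i, j). p i j \<noteq> 0})" using assms by (simp add: plane_part_def)
    moreover have "{i. p i i \<noteq> 0} \<subseteq> fst ` {(i, j). p i j \<noteq> 0}" by force
    ultimately show ?thesis by (rule rev_finite_subset)
  qed
  hence "p 0 0 = 0" using assms(2) by (auto simp: pp_trace_def)
  moreover have "p i j \<le> p i 0" for i j
    by (induction j) (use m(2) order_trans in blast)+
  moreover have "p i 0 \<le> p 0 0" for i
    by (induction i) (use m(1) order_trans in blast)+
  ultimately show ?thesis by (metis le_zero_eq)
qed

lemma pp_eq_0: "k > n \<Longrightarrow> pp k n = 0"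
proof -
  assume "k > n"
  hence "{p. is_plane_partition n p \<and> pp_trace p = k} = {}"
    using pp_trace_le_size leD by (auto simp: is_plane_partition_iff)
  thus ?thesis unfolding pp_def by (simp only: card.empty)
qed

lemma pp_0: "pp 0 n = (if n = 0 then 1 else 0)"
proof -
  have z: "plane_part (\<lambda>_ _. 0)" "pp_size (\<lambda>_ _. 0) = 0" "pp_trace (\<lambda>_ _. 0) = 0"
    by (auto simp: plane_part_def pp_size_def pp_trace_def)
  have "{p. is_plane_partition n p \<and> pp_trace p = 0} = (if n = 0 then {\<lambda>_ _. 0} else {})"
    using pp_trace_eq_0 by (cases "n = 0") (force simp: is_plane_partition_iff z)+
  thus ?thesis by (simp add: pp_def)
qed

text \<open>In contrast to \<open>Q\<close> this includes \<open>k = 0\<close>, so that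
  \<open>n = 0\<close> yields the constant term 1 of the generating function; for positive
  \<open>n\<close> the two agree.\<close>

definition trace_poly :: "nat \<Rightarrow> 'a :: real_normed_field \<Rightarrow> 'a" where
  "trace_poly n x = (\<Sum>k\<le>n. of_nat (pp k n) * x ^ k)"

lemma trace_poly_eq_Q: "n > 0 \<Longrightarrow> trace_poly n x = Q n x"
  unfolding trace_poly_def Q_def
  by (rule sum.mono_neutral_right) (auto simp: pp_0 not_less_eq_eq)

lemma trace_poly_sums_real:
  fixes x u :: real
  assumes x: "0 < x" "x < 1" and u: "0 < u" "u < 1"
  shows "(\<lambda>n. trace_poly n x * u ^ n) sums exp (log_gf x u)"
proof (rule sums_of_ennreal_suminf)
  \<comment> \<open>Dummy sums over size and trace sort the plane partitions before the order of
    summation is changed.\<close>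
  have "ennreal (exp (log_gf x u)) = nsum (\<lambda>p. nsum (\<lambda>n. if n = pp_size p then (nsum (\<lambda>k. if k = pp_trace p then
       (if plane_part p then ennreal (x ^ k * u ^ n) else 0) else 0)) else 0))"
    by (subst plane_part_sum[OF x u, symmetric], intro nn_integral_cong) (simp add: nsum_delta)
  also have "\<dots> = nsum (\<lambda>n. nsum (\<lambda>p. nsum (\<lambda>k. if n = pp_size p \<and> k = pp_trace p \<and> plane_part p then
       ennreal (x ^ k * u ^ n) else 0)))"
    by (subst nsum_swap, intro nn_integral_cong) (auto intro!: nn_integral_cong)
  also have "\<dots> = nsum (\<lambda>n. nsum (\<lambda>k. nsum (\<lambda>p. if n = pp_size p \<and> k = pp_trace p \<and> plane_part p then
       ennreal (x ^ k * u ^ n) else 0)))"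
    by (rule nn_integral_cong, rule nsum_swap)
  also have "\<dots> = nsum (\<lambda>n. nsum (\<lambda>k. ennreal (pp k n * x ^ k * u ^ n)))"
  proof (intro nn_integral_cong)
    fix n k
    have "nsum (\<lambda>p. if n = pp_size p \<and> k = pp_trace p \<and> plane_part p then ennreal (x ^ k * u ^ n) else 0)
        = nsum (\<lambda>p. ennreal (x ^ k * u ^ n) * indicator {p. is_plane_partition n p \<and> pp_trace p = k} p)"
      by (intro nn_integral_cong) (auto simp: is_plane_partition_iff split: split_indicator)
    also have "\<dots> = ennreal (x ^ k * u ^ n) * emeasure (count_space UNIV) {p. is_plane_partition n p \<and> pp_trace p = k}"
      by (rule nn_integral_cmult_indicator) simp
    also have "\<dots> = ennreal (x ^ k * u ^ n) * ennreal (pp k n)"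
      using finite_plane_partitions[of n k] by (simp add: pp_def ennreal_of_nat_eq_real_of_nat)
    also have "\<dots> = ennreal (pp k n * x ^ k * u ^ n)"
      using x u by (simp add: ennreal_mult[symmetric] mult_ac)
    finally show "nsum (\<lambda>p. if n = pp_size p \<and> k = pp_trace p \<and> plane_part p then ennreal (x ^ k * u ^ n) else 0)
        = ennreal (pp k n * x ^ k * u ^ n)" .
  qed
  also have "\<dots> = (\<Sum>n. ennreal (trace_poly n x * u ^ n))"
  proof (subst nn_integral_count_space_nat, intro suminf_cong)
    fix n
    have "nsum (\<lambda>k. ennreal (pp k n * x ^ k * u ^ n)) = (\<Sum>k\<le>n. ennreal (pp k n * x ^ k * u ^ n))"
      unfolding nn_integral_count_space_nat by (rule suminf_finite) (auto simp: pp_eq_0)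
    also have "\<dots> = ennreal (trace_poly n x * u ^ n)"
      using x u by (simp add: trace_poly_def sum_distrib_right sum_ennreal)
    finally show "nsum (\<lambda>k. ennreal (pp k n * x ^ k * u ^ n)) = ennreal (trace_poly n x * u ^ n)" .
  qed
  finally show "(\<Sum>n. ennreal (trace_poly n x * u ^ n)) = ennreal (exp (log_gf x u))" ..
  show "trace_poly n x * u ^ n \<ge> 0" for n
    using x u by (auto simp: trace_poly_def intro!: mult_nonneg_nonneg sum_nonneg)
qed simp

section \<open>Analytic continuation to complex arguments\<close>

lemma holomorphic_on_suminf:
  fixes f :: "nat \<Rightarrow> complex \<Rightarrow> complex"
  assumes hol: "\<And>k. f k holomorphic_on ball 0 1"
  assumes bnd: "\<And>r. 0 < r \<Longrightarrow> r < 1 \<Longrightarrow> \<exists>M. summable M \<and> (\<forall>k z. norm z \<le> r \<longrightarrow> norm (f k z) \<le> M k)"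
  shows "(\<lambda>z. \<Sum>k. f k z) holomorphic_on ball 0 1"
proof (rule holomorphic_uniform_sequence[where f = "\<lambda>n z. \<Sum>k<n. f k z"])
  show "\<exists>d>0. cball z d \<subseteq> ball 0 1 \<and> uniform_limit (cball z d) (\<lambda>n z. \<Sum>k<n. f k z) (\<lambda>z. \<Sum>k. f k z) sequentially"
    if "z \<in> ball 0 1" for z
  proof -
    define d where "d = (1 - norm z) / 2"
    define r where "r = (1 + norm z) / 2"
    have r: "0 < r" "r < 1" "0 < d" using that by (auto simp: r_def d_def add_pos_nonneg)
    have sub: "norm w \<le> r" if "w \<in> cball z d" for w
      using that norm_triangle_ineq2[of w z] by (simp add: r_def d_def dist_norm norm_minus_commute field_simps)
    from bnd[OF r(1,2)] obtain M where M: "summable M" "\<And>k z. norm z \<le> r \<Longrightarrow> norm (f k z) \<le> M k"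
      by blast
    have "uniform_limit (cball z d) (\<lambda>n z. \<Sum>k<n. f k z) (\<lambda>z. \<Sum>k. f k z) sequentially"
      by (rule Weierstrass_m_test[of _ _ M]) (use M sub in auto)
    moreover have "cball z d \<subseteq> ball 0 1" using sub r by force
    ultimately show ?thesis using r by blast
  qed
qed (auto intro!: holomorphic_intros hol)

lemma holomorphic_eq_of_real_interval:
  assumes "f holomorphic_on ball 0 1" "g holomorphic_on ball 0 1"
    and "\<And>t. 0 < t \<Longrightarrow> t < 1 \<Longrightarrow> f (complex_of_real t) = g (complex_of_real t)" and "norm z < 1"
  shows "f z = g z"
proof -
  have lim: "complex_of_real (1/2) islimpt complex_of_real ` {0<..<1}"
  proof -
    have "(1/2::real) islimpt {0<..<1}" by (simp add: islimpt_greaterThanLessThan1 interior_limit_point)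
    hence "\<exists>X. (\<forall>n. X n \<in> {0<..<1} - {1/2}) \<and> X \<longlonglongrightarrow> (1/2::real)"
      by (simp add: islimpt_sequential)
    then obtain X where X: "\<And>n. X n \<in> {0<..<1} - {1/2}" "X \<longlonglongrightarrow> (1/2::real)" by blast
    show ?thesis
      unfolding islimpt_sequential
      by (rule exI[of _ "\<lambda>n. complex_of_real (X n)"]) (use X in \<open>auto intro!: tendsto_of_real simp del: of_real_divide\<close>)
  qed
  have "f z - g z = 0"
    by (rule analytic_continuation[of "\<lambda>z. f z - g z" "ball 0 1" "complex_of_real ` {0<..<1}" "complex_of_real (1/2)"])
       (use assms lim in \<open>auto intro!: holomorphic_intros\<close>)
  thus ?thesis by simp
qed

lemma norm_trace_poly_le:
  fixes x :: complex
  assumes "norm x \<le> s"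
  shows "norm (trace_poly n x) \<le> trace_poly n s"
  unfolding trace_poly_def
  by (rule order_trans[OF norm_sum], intro sum_mono)
     (use assms in \<open>auto simp: norm_mult norm_power intro!: mult_left_mono power_mono\<close>)

lemma trace_poly_of_real: "trace_poly n (complex_of_real x) = of_real (trace_poly n x)"
  by (simp add: trace_poly_def)

text \<open>The coefficients are nonnegative, so the convergent real series dominates the complex
  one.\<close>

lemma trace_poly_bound:
  fixes x u :: complex
  assumes "0 < s" "s < 1" "0 < r" "r < 1" "norm x \<le> s" "norm u \<le> r"
  shows "norm (trace_poly n x * u ^ n) \<le> trace_poly n s * r ^ n"
proof -
  have "0 \<le> trace_poly n s"
    using norm_trace_poly_le[OF assms(5), of n] norm_ge_zero order_trans by blast
  thus ?thesis
    unfolding norm_mult norm_power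
    using assms norm_trace_poly_le[OF assms(5), of n] by (intro mult_mono power_mono) auto
qed

lemma log_gf_holomorphic:
  assumes "norm x < 1"
  shows "log_gf x holomorphic_on ball 0 1" "(\<lambda>u. log_gf u x) holomorphic_on ball 0 1"
proof -
  have nz: "1 - u ^ Suc k \<noteq> 0" if "norm u < 1" for u :: complex and k
  proof
    assume "1 - u ^ Suc k = 0"
    hence "u ^ Suc k = 1" by simp
    hence "norm (u ^ Suc k) = 1" by (simp only: norm_one)
    moreover have "norm u ^ Suc k < 1" using that power_Suc_less_one[of "norm u" k] by (cases "u = 0") auto
    ultimately show False by (simp only: norm_power less_irrefl)
  qed
  have "(\<lambda>u. \<Sum>k. x ^ Suc k / of_nat (Suc k) * (u ^ Suc k / (1 - u ^ Suc k) ^ 2)) holomorphic_on ball 0 1"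
  proof (rule holomorphic_on_suminf)
    fix r :: real assume "0 < r" "r < 1"
    thus "\<exists>M. summable M \<and> (\<forall>k u. norm u \<le> r \<longrightarrow> norm (x ^ Suc k / of_nat (Suc k) * (u ^ Suc k / (1 - u ^ Suc k) ^ 2)) \<le> M k)"
      using assms by (intro exI[of _ "\<lambda>k. norm x ^ Suc k / (1 - r) ^ 2"] conjI summable_log_gf_bound allI impI norm_log_gf_term) auto
  qed (use nz in \<open>auto intro!: holomorphic_intros simp del: power_Suc\<close>)
  thus "log_gf x holomorphic_on ball 0 1" by (simp add: log_gf_def[abs_def])
  have "(\<lambda>u. \<Sum>k. u ^ Suc k / of_nat (Suc k) * (x ^ Suc k / (1 - x ^ Suc k) ^ 2)) holomorphic_on ball 0 1"
  proof (rule holomorphic_on_suminf)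
    fix r :: real assume "0 < r" "r < 1"
    thus "\<exists>M. summable M \<and> (\<forall>k u. norm u \<le> r \<longrightarrow> norm (u ^ Suc k / of_nat (Suc k) * (x ^ Suc k / (1 - x ^ Suc k) ^ 2)) \<le> M k)"
      using assms by (intro exI[of _ "\<lambda>k. r ^ Suc k / (1 - norm x) ^ 2"] conjI summable_log_gf_bound allI impI norm_log_gf_term) auto
  qed (use nz[OF assms] in \<open>auto intro!: holomorphic_intros simp del: power_Suc\<close>)
  thus "(\<lambda>u. log_gf u x) holomorphic_on ball 0 1" by (simp add: log_gf_def[abs_def])
qed

lemma log_gf_of_real: "0 < x \<Longrightarrow> x < 1 \<Longrightarrow> 0 < u \<Longrightarrow> u < 1 \<Longrightarrow> log_gf (complex_of_real x) (of_real u) = of_real (log_gf x u)"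
proof -
  assume a: "0 < x" "x < 1" "0 < u" "u < 1"
  have "summable (\<lambda>k. x ^ Suc k / of_nat (Suc k) * (u ^ Suc k / (1 - u ^ Suc k) ^ 2))"
    by (rule summable_comparison_test'[OF summable_log_gf_bound[of x u]], use a in simp, use a in simp)
       (rule norm_log_gf_term, use a in auto)
  thus ?thesis
    unfolding log_gf_def by (subst suminf_of_real) auto
qed

lemma holomorphic_trace_gf:
  assumes "norm x < 1"
  shows "(\<lambda>u. \<Sum>n. trace_poly n x * u ^ n) holomorphic_on ball 0 1"
    and "(\<lambda>u. \<Sum>n. trace_poly n u * x ^ n) holomorphic_on ball 0 1"
proof -
  define s where "s = (1 + norm x) / 2"
  have s: "0 < s" "s < 1" "norm x \<le> s" using assms by (auto simp: s_def add_pos_nonneg)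
  show "(\<lambda>u. \<Sum>n. trace_poly n x * u ^ n) holomorphic_on ball 0 1"
  proof (rule holomorphic_on_suminf)
    fix r :: real assume r: "0 < r" "r < 1"
    show "\<exists>M. summable M \<and> (\<forall>k u. norm u \<le> r \<longrightarrow> norm (trace_poly k x * u ^ k) \<le> M k)"
      using trace_poly_bound[OF s(1,2) r s(3)] trace_poly_sums_real[OF s(1,2) r]
      by (intro exI[of _ "\<lambda>n. trace_poly n s * r ^ n"]) (auto simp: sums_iff)
  qed (auto intro!: holomorphic_intros)
  show "(\<lambda>u. \<Sum>n. trace_poly n u * x ^ n) holomorphic_on ball 0 1"
  proof (rule holomorphic_on_suminf)
    fix r :: real assume r: "0 < r" "r < 1"
    show "\<exists>M. summable M \<and> (\<forall>k u. norm u \<le> r \<longrightarrow> norm (trace_poly k u * x ^ k) \<le> M k)"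
      using trace_poly_bound[OF r s(1,2) _ s(3)] trace_poly_sums_real[OF r s(1,2)]
      by (intro exI[of _ "\<lambda>n. trace_poly n r * s ^ n"]) (auto simp: sums_iff)
  qed (auto intro!: holomorphic_intros simp: trace_poly_def)
qed

lemma summable_norm_trace_gf:
  fixes x u :: complex
  assumes "norm x < 1" "norm u < 1"
  shows "summable (\<lambda>n. norm (trace_poly n x * u ^ n))"
proof -
  define s where "s = (1 + norm x) / 2"
  define r where "r = (1 + norm u) / 2"
  have s: "0 < s" "s < 1" "norm x \<le> s" using assms by (auto simp: s_def add_pos_nonneg)
  have r: "0 < r" "r < 1" "norm u \<le> r" using assms by (auto simp: r_def add_pos_nonneg)
  show ?thesis
    by (rule summable_comparison_test'[OF sums_summable[OF trace_poly_sums_real[OF s(1,2) r(1,2)]]])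
       (use trace_poly_bound[OF s(1,2) r(1,2) s(3) r(3)] in auto)
qed

text \<open>Two continuations in one variable each: in \<open>u\<close> for fixed real
  \<open>x\<close>, then in \<open>x\<close> for fixed complex \<open>u\<close>.\<close>

theorem trace_gf:
  fixes x u :: complex
  assumes x: "norm x < 1" and u: "norm u < 1"
  shows "(\<lambda>n. trace_poly n x * u ^ n) sums exp (log_gf x u)"
proof -
  have 1: "(\<Sum>n. trace_poly n (complex_of_real t) * v ^ n) = exp (log_gf (complex_of_real t) v)"
    if t: "0 < t" "t < 1" and v: "norm v < 1" for t v
  proof (rule holomorphic_eq_of_real_interval[OF _ _ _ v])
    show "(\<lambda>v. \<Sum>n. trace_poly n (complex_of_real t) * v ^ n) holomorphic_on ball 0 1"
      using t by (intro holomorphic_trace_gf) auto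
    show "(\<lambda>v. exp (log_gf (complex_of_real t) v)) holomorphic_on ball 0 1"
      using t by (intro holomorphic_intros log_gf_holomorphic) auto
    fix w :: real assume w: "0 < w" "w < 1"
    have "(\<lambda>n. complex_of_real (trace_poly n t * w ^ n)) sums complex_of_real (exp (log_gf t w))"
      using trace_poly_sums_real[OF t w] by (simp only: sums_of_real_iff)
    thus "(\<Sum>n. trace_poly n (complex_of_real t) * complex_of_real w ^ n) = exp (log_gf (complex_of_real t) (complex_of_real w))"
      by (simp add: log_gf_of_real[OF t w] trace_poly_of_real sums_iff exp_of_real)
  qed
  have "(\<Sum>n. trace_poly n x * u ^ n) = exp (log_gf x u)"
  proof (rule holomorphic_eq_of_real_interval[OF _ _ _ x])
    show "(\<lambda>x. \<Sum>n. trace_poly n x * u ^ n) holomorphic_on ball 0 1"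
      using u by (rule holomorphic_trace_gf)
    show "(\<lambda>x. exp (log_gf x u)) holomorphic_on ball 0 1"
      using u by (intro holomorphic_intros log_gf_holomorphic) auto
  qed (use 1 u in auto)
  thus ?thesis
    using summable_norm_cancel[OF summable_norm_trace_gf[OF x u]] by (simp add: sums_iff)
qed

section \<open>The trilogarithm and the phases\<close>

text \<open>The constant \<open>2 / 3\<close> comes from \<open>1 / m\<^sup>2 \<le> 1 / (m - 1 / 2) - 1 / (m + 1 / 2)\<close>, summed over \<open>m \<ge> 2\<close>.\<close>

lemma suminf_minus_head:
  fixes f :: "nat \<Rightarrow> 'a :: banach"
  assumes "\<And>n. norm (f (Suc n)) \<le> D / real (Suc (Suc n)) ^ 2"
  shows "summable f" "norm (suminf f - f 0) \<le> 2 / 3 * D"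
proof -
  define g where "g = (\<lambda>n. D * (1 / (real n + 3 / 2) - 1 / (real (Suc n) + 3 / 2)))"
  have "(\<lambda>n. 1 / (real n + 3 / 2) - 1 / (real (Suc n) + 3 / 2)) sums (1 / (real 0 + 3 / 2) - 0)"
    by (rule telescope_sums') real_asymp
  hence g: "g sums (2 / 3 * D)"
    unfolding g_def mult.commute[of "2 / 3" D] by (intro sums_mult) simp
  have D: "D \<ge> 0"
    using order_trans[OF norm_ge_zero assms[of 0]] by (simp add: zero_le_divide_iff)
  have le: "norm (f (Suc n)) \<le> g n" for n
  proof -
    have "1 / real (Suc (Suc n)) ^ 2 \<le> 1 / (real n + 3 / 2) - 1 / (real (Suc n) + 3 / 2)"
    proof -
      have "1 / (real n + 3 / 2) - 1 / (real (Suc n) + 3 / 2) = 1 / (real (Suc (Suc n)) ^ 2 - 1 / 4)"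
      proof -
        have "1 / a - 1 / (a + 1) = 1 / (a * (a + 1))" if "a > 0" for a :: real
          using that by (simp add: field_simps)
        from this[of "real n + 3 / 2"] show ?thesis
          by (simp add: power2_eq_square algebra_simps)
      qed
      moreover have "1 / real (Suc (Suc n)) ^ 2 \<le> 1 / (real (Suc (Suc n)) ^ 2 - 1 / 4)"
      proof (intro divide_left_mono mult_pos_pos)
        have "(1::real) \<le> real (Suc (Suc n)) ^ 2" by simp
        thus "0 < real (Suc (Suc n)) ^ 2 - 1 / 4" by linarith
      qed auto
      ultimately show ?thesis by simp
    qed
    hence "D * (1 / real (Suc (Suc n)) ^ 2) \<le> g n"
      unfolding g_def using D by (rule mult_left_mono)
    thus ?thesis using assms[of n] by simp
  qed
  have sm: "summable (\<lambda>n. norm (f (Suc n)))"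
    by (rule summable_comparison_test'[OF sums_summable[OF g], of 0]) (use le in simp)
  hence "summable (\<lambda>n. f (Suc n))" by (rule summable_norm_cancel)
  thus s: "summable f" by (subst (asm) summable_Suc_iff)
  have "norm (suminf f - f 0) = norm (\<Sum>n. f (Suc n))"
    using suminf_split_head[OF s] by simp
  also have "\<dots> \<le> (\<Sum>n. norm (f (Suc n)))" by (rule summable_norm[OF sm])
  also have "\<dots> \<le> suminf g" by (rule suminf_le[OF le sm sums_summable[OF g]])
  finally show "norm (suminf f - f 0) \<le> 2 / 3 * D" using g by (simp add: sums_iff)
qed

section \<open>Elementary estimates for the trilogarithm\<close>

text \<open>For \<open>m\<close> at least 2, \<open>1 / m ^ 3\<close> is at most half of
  \<open>1 / m ^ 2\<close>. Hence \<open>D\<close> is \<open>norm y / 2\<close>, and everything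
  after the first term of \<open>Li3 y\<close> has norm at most \<open>norm y / 3\<close>.\<close>

lemma Li3_term_bound:
  fixes y :: "'a :: {real_normed_field, banach}"
  assumes "norm y \<le> 1"
  shows "norm (y ^ Suc (Suc n) / of_nat (Suc (Suc n)) ^ 3) \<le> norm y / 2 / real (Suc (Suc n)) ^ 2"
proof -
  have "norm y ^ Suc (Suc n) \<le> norm y"
    using power_decreasing[of 1 "Suc (Suc n)" "norm y"] assms by simp
  hence "norm (y ^ Suc (Suc n) / of_nat (Suc (Suc n)) ^ 3) \<le> norm y / real (Suc (Suc n)) ^ 3"
    unfolding norm_divide norm_power norm_of_nat by (rule divide_right_mono) simp
  also have "\<dots> \<le> norm y / (2 * real (Suc (Suc n)) ^ 2)"
    by (intro divide_left_mono mult_pos_pos) (auto simp: power3_eq_cube power2_eq_square intro!: mult_right_mono simp del: of_nat_Suc)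
  finally show ?thesis by simp
qed

lemma Li3_minus_id: "norm y \<le> 1 \<Longrightarrow> norm (Li3 y - y) \<le> norm y / 3"
  using suminf_minus_head(2)[of "\<lambda>n. y ^ Suc n / of_nat (Suc n) ^ 3", OF Li3_term_bound]
  by (simp add: Li3_def)

lemma norm_Li3_bounds:
  assumes "norm y \<le> 1"
  shows "2 / 3 * norm y \<le> norm (Li3 y)" "norm (Li3 y) \<le> 4 / 3 * norm y"
  using Li3_minus_id[OF assms] norm_triangle_ineq2[of y "Li3 y"] norm_triangle_ineq2[of "Li3 y" y]
  by (auto simp: norm_minus_commute)

text \<open>The factor \<open>n\<close> costs one power in the denominators of \<open>Li3\<close>,
  which leaves the inverse squares that \<open>suminf_minus_head\<close> handles.\<close>

lemma Im_power_bound: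
  assumes "norm x \<le> 1"
  shows "\<bar>Im (x ^ n)\<bar> \<le> real n * \<bar>Im x\<bar>"
proof (induction n)
  case (Suc n)
  have "\<bar>Im (x ^ Suc n)\<bar> \<le> \<bar>Re x\<bar> * \<bar>Im (x ^ n)\<bar> + \<bar>Im x\<bar> * \<bar>Re (x ^ n)\<bar>"
    by (simp add: abs_mult[symmetric] abs_triangle_ineq)
  also have "\<dots> \<le> 1 * (real n * \<bar>Im x\<bar>) + \<bar>Im x\<bar> * 1"
  proof (intro add_mono mult_mono Suc)
    show "\<bar>Re x\<bar> \<le> 1" using abs_Re_le_cmod[of x] assms by linarith
    have "norm (x ^ n) \<le> 1" using assms by (simp add: norm_power power_le_one)
    thus "\<bar>Re (x ^ n)\<bar> \<le> 1" using abs_Re_le_cmod[of "x ^ n"] by linarith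
  qed auto
  finally show ?case by (simp add: algebra_simps)
qed simp

lemma summable_Li3: "norm y \<le> 1 \<Longrightarrow> summable (\<lambda>n. y ^ Suc n / of_nat (Suc n) ^ 3)"
  for y :: "'a :: {real_normed_field, banach}"
  using suminf_minus_head(1)[OF Li3_term_bound] by blast

text \<open>The imaginary parts of all later terms sum to at most two thirds of that of the first,
  which is \<open>Im x\<close>.\<close>

lemma Im_Li3_nonzero:
  assumes "norm x \<le> 1" "Im x \<noteq> 0"
  shows "Im (Li3 x) \<noteq> 0"
proof -
  define f where "f = (\<lambda>n. Im (x ^ Suc n / of_nat (Suc n) ^ 3))"
  have f: "f n = Im (x ^ Suc n) / real (Suc n) ^ 3" for n
    using Im_divide_of_real[of "x ^ Suc n" "real (Suc n) ^ 3"] by (simp add: f_def)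
  have "suminf f = Im (Li3 x)"
    using bounded_linear.suminf[OF bounded_linear_Im summable_Li3[OF assms(1)]] by (simp add: f_def Li3_def)
  moreover have "norm (suminf f - f 0) \<le> 2 / 3 * \<bar>Im x\<bar>"
  proof (rule suminf_minus_head)
    fix n
    have "norm (f (Suc n)) \<le> real (Suc (Suc n)) * \<bar>Im x\<bar> / real (Suc (Suc n)) ^ 3"
      unfolding f real_norm_def abs_divide
      using Im_power_bound[OF assms(1), of "Suc (Suc n)"] by (simp add: divide_right_mono del: power_Suc of_nat_Suc)
    also have "\<dots> = \<bar>Im x\<bar> / real (Suc (Suc n)) ^ 2"
      by (simp add: power3_eq_cube power2_eq_square del: of_nat_Suc)
    finally show "norm (f (Suc n)) \<le> \<bar>Im x\<bar> / real (Suc (Suc n)) ^ 2" .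
  qed
  ultimately show ?thesis using assms(2) f[of 0] by auto
qed

definition li3 :: "real \<Rightarrow> real" where
  "li3 t = (\<Sum>n. t ^ Suc n / real (Suc n) ^ 3)"

lemma Li3_of_real: "\<bar>t\<bar> \<le> 1 \<Longrightarrow> Li3 (of_real t) = of_real (li3 t)"
  using suminf_of_real[OF summable_Li3[of t], where ?'a = complex] by (simp add: Li3_def li3_def)

lemma li3_minus_id: "\<bar>t\<bar> \<le> 1 \<Longrightarrow> \<bar>li3 t - t\<bar> \<le> \<bar>t\<bar> / 3"
  using suminf_minus_head(2)[of "\<lambda>n. t ^ Suc n / of_nat (Suc n) ^ 3", OF Li3_term_bound]
  by (simp add: li3_def)

lemma li3_bounds: "\<bar>t\<bar> \<le> 1 \<Longrightarrow> t - \<bar>t\<bar> / 3 \<le> li3 t" "\<bar>t\<bar> \<le> 1 \<Longrightarrow> li3 t \<le> t + \<bar>t\<bar> / 3"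
  using li3_minus_id[of t] by linarith+

lemma li3_pos:
  assumes "0 < t" "t \<le> 1"
  shows "li3 t > 0" "2 / 3 * t \<le> li3 t" "li3 t \<le> 4 / 3 * t"
  using li3_bounds[of t] assms by auto

section \<open>Principal cube roots\<close>

lemma cube_root_polar:
  fixes w :: complex
  assumes "w \<noteq> 0"
  shows "w powr (1 / 3) = of_real (norm w powr (1 / 3)) * cis (Arg w / 3)"
proof -
  have "Ln w = of_real (ln (norm w)) + \<i> * of_real (Arg w)"
    using assms by (simp add: complex_eq_iff Arg_eq_Im_Ln)
  thus ?thesis
    using assms by (simp add: powr_def exp_add cis_conv_exp exp_of_real[symmetric] add_divide_distrib algebra_simps)
qed

lemma cube_root_cubed: "((w::complex) powr (1 / 3)) ^ 3 = w"
  by (cases "w = 0") (simp_all add: powr_def exp_of_nat_mult[symmetric])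

lemma cos_third_ge: "\<bar>t\<bar> \<le> pi \<Longrightarrow> cos (t / 3) \<ge> 1 / 2"
proof -
  assume "\<bar>t\<bar> \<le> pi"
  hence "cos (pi / 3) \<le> cos \<bar>t / 3\<bar>"
    by (intro cos_monotone_0_pi_le) auto
  thus ?thesis by (simp only: cos_abs_real cos_60)
qed

lemma cos_third_gt: "\<bar>t\<bar> < pi \<Longrightarrow> cos (t / 3) > 1 / 2"
proof -
  assume "\<bar>t\<bar> < pi"
  hence "cos (pi / 3) < cos \<bar>t / 3\<bar>"
    by (intro cos_monotone_0_pi) auto
  thus ?thesis by (simp only: cos_abs_real cos_60)
qed

text \<open>The argument of a principal cube root is at most \<pi>/3 in absolute value, where the
  cosine is at least 1/2.\<close>

lemma Re_cube_root_ge: "Re ((w::complex) powr (1 / 3)) \<ge> norm w powr (1 / 3) / 2"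
proof (cases "w = 0")
  case False
  have "\<bar>Arg w\<bar> \<le> pi" using Arg_bounded[of w] by auto
  hence "norm w powr (1 / 3) * (1 / 2) \<le> norm w powr (1 / 3) * cos (Arg w / 3)"
    by (intro mult_left_mono cos_third_ge) auto
  thus ?thesis using False by (simp add: cube_root_polar)
qed simp

text \<open>This is the bound \<pi>/3 on the argument, in the form that the tangent is at most the
  square root of 3; equality at a nonzero point needs argument \<pi>, that is, the branch
  cut.\<close>

lemma cube_root_sector:
  fixes w :: complex
  shows "Im (w powr (1 / 3)) ^ 2 \<le> 3 * Re (w powr (1 / 3)) ^ 2"
    and "w \<notin> \<real>\<^sub>\<le>\<^sub>0 \<Longrightarrow> Im (w powr (1 / 3)) ^ 2 < 3 * Re (w powr (1 / 3)) ^ 2"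
proof -
  show "Im (w powr (1 / 3)) ^ 2 \<le> 3 * Re (w powr (1 / 3)) ^ 2"
  proof (cases "w = 0")
    case False
    have "\<bar>Arg w\<bar> \<le> pi" using Arg_bounded[of w] by auto
    hence "(1/2)^2 \<le> cos (Arg w / 3) ^ 2"
      by (intro power_mono cos_third_ge) auto
    hence "sin (Arg w / 3) ^ 2 \<le> 3 * cos (Arg w / 3) ^ 2"
      unfolding sin_squared_eq by (simp add: power2_eq_square)
    thus ?thesis using False
      by (simp add: cube_root_polar power_mult_distrib mult_left_mono mult.left_commute[of 3])
  qed simp
  assume "w \<notin> \<real>\<^sub>\<le>\<^sub>0"
  hence w: "w \<noteq> 0" "Arg w \<noteq> pi"
    by (auto simp: Arg_eq_pi complex_nonpos_Reals_iff)
  hence "\<bar>Arg w\<bar> < pi" using Arg_bounded[of w] by auto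
  hence "(1/2)^2 < cos (Arg w / 3) ^ 2"
    by (intro power_strict_mono cos_third_gt) auto
  hence "sin (Arg w / 3) ^ 2 < 3 * cos (Arg w / 3) ^ 2"
    unfolding sin_squared_eq by (simp add: power2_eq_square)
  thus "Im (w powr (1 / 3)) ^ 2 < 3 * Re (w powr (1 / 3)) ^ 2"
    using w by (simp add: cube_root_polar power_mult_distrib mult.left_commute[of 3])
qed

lemma Re_cube_root_negative:
  assumes "a > 0"
  shows "Re ((- complex_of_real a) powr (1 / 3)) = a powr (1 / 3) / 2"
proof -
  have "Arg (- complex_of_real a) = pi"
    using assms by (simp add: Arg_eq_pi)
  thus ?thesis using assms by (simp add: cube_root_polar cos_60)
qed

lemma L_cubed: "L k x ^ 3 = 2 * Li3 (x ^ k) / of_nat k ^ 3"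
  by (simp add: L_def power_divide cube_root_cubed)

lemma L_sector: "Re (L k x) \<ge> 0" "Im (L k x) ^ 2 \<le> 3 * Re (L k x) ^ 2"
proof -
  show "Re (L k x) \<ge> 0"
    using order_trans[OF _ Re_cube_root_ge[of "2 * Li3 (x ^ k)"], of 0] by (simp add: L_def)
  show "Im (L k x) ^ 2 \<le> 3 * Re (L k x) ^ 2"
    using cube_root_sector(1)[of "2 * Li3 (x ^ k)"]
    by (simp add: L_def power_divide divide_right_mono)
qed

lemma phaseD:
  assumes "x \<in> phase m"
  shows "0 < norm x" "norm x < 1" "k \<ge> 1 \<Longrightarrow> k \<noteq> m \<Longrightarrow> Re (L k x) < Re (L m x)"
  using assms by (auto simp: phase_def punctured_disk_def)

text \<open>Any other index serves for comparison, since no \<open>L k x\<close> has negative real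
  part.\<close>

lemma phase_Re_pos: "x \<in> phase m \<Longrightarrow> Re (L m x) > 0"
  using phaseD(3)[of x m "Suc m"] L_sector(1)[of "Suc m" x] by linarith

text \<open>\<open>crossing r = (Li3 (r\<^sup>2) + Li3 (- r)) / r\<close>, which has the sign of
  \<open>Re (L 2 (- r)) - Re (L 1 (- r))\<close>; dividing by \<open>r\<close> makes it increasing.\<close>

definition crossing :: "real \<Rightarrow> real" where
  "crossing r = (\<Sum>n. (r ^ (2 * n + 1) - (- r) ^ n) / real (Suc n) ^ 3)"

lemma summable_crossing_terms:
  assumes "0 \<le> r" "r \<le> 1"
  shows "summable (\<lambda>n. r ^ (2 * n + 1) / real (Suc n) ^ 3)" "summable (\<lambda>n. (- r) ^ n / real (Suc n) ^ 3)"
proof -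
  have b: "norm (a / real (Suc (Suc n)) ^ 3) \<le> 1 / real (Suc (Suc n)) ^ 2" if "\<bar>a\<bar> \<le> 1" for a and n
  proof -
    have "norm (a / real (Suc (Suc n)) ^ 3) \<le> 1 / real (Suc (Suc n)) ^ 3"
      unfolding real_norm_def abs_divide using that by (simp add: divide_right_mono)
    also have "\<dots> \<le> 1 / real (Suc (Suc n)) ^ 2"
      by (intro divide_left_mono power_increasing) auto
    finally show ?thesis .
  qed
  have p: "\<bar>r ^ m\<bar> \<le> 1" "\<bar>(- r) ^ m\<bar> \<le> 1" for m
    using assms by (auto simp: power_abs power_le_one)
  show "summable (\<lambda>n. r ^ (2 * n + 1) / real (Suc n) ^ 3)" "summable (\<lambda>n. (- r) ^ n / real (Suc n) ^ 3)"
    by (rule suminf_minus_head(1)[OF b[OF p(1)]], rule suminf_minus_head(1)[OF b[OF p(2)]])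
qed

lemma crossing_split:
  assumes "0 \<le> r" "r \<le> 1"
  shows "crossing r = (\<Sum>n. r ^ (2 * n + 1) / real (Suc n) ^ 3) - (\<Sum>n. (- r) ^ n / real (Suc n) ^ 3)"
  using summable_crossing_terms[OF assms] by (subst suminf_diff) (auto simp: crossing_def diff_divide_distrib)

lemma crossing_eq:
  assumes "0 < r" "r \<le> 1"
  shows "r * crossing r = li3 (r ^ 2) + li3 (- r)"
proof -
  note s = summable_crossing_terms[of r]
  have "crossing r = (\<Sum>n. r ^ (2 * n + 1) / real (Suc n) ^ 3) - (\<Sum>n. (- r) ^ n / real (Suc n) ^ 3)"
    using assms by (intro crossing_split) auto
  also have "r * \<dots> = (\<Sum>n. r * (r ^ (2 * n + 1) / real (Suc n) ^ 3)) - (\<Sum>n. r * ((- r) ^ n / real (Suc n) ^ 3))"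
    using assms s by (simp only: right_diff_distrib suminf_mult less_imp_le)
  also have "(\<lambda>n. r * (r ^ (2 * n + 1) / real (Suc n) ^ 3)) = (\<lambda>n. (r ^ 2) ^ Suc n / real (Suc n) ^ 3)"
  proof
    fix n
    have "(r ^ 2) ^ Suc n = r * r ^ (2 * n + 1)"
      by (simp only: power_mult[symmetric] power_Suc[symmetric]) simp
    thus "r * (r ^ (2 * n + 1) / real (Suc n) ^ 3) = (r ^ 2) ^ Suc n / real (Suc n) ^ 3" by (simp only: times_divide_eq_right)
  qed
  also have "(\<Sum>n. r * ((- r) ^ n / real (Suc n) ^ 3)) = - (\<Sum>n. (- r) ^ Suc n / real (Suc n) ^ 3)"
    using assms summable_Li3[of "- r"] by (subst suminf_minus[symmetric]) auto
  finally show ?thesis by (simp add: li3_def)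
qed

lemma abs_power_diff_le:
  fixes a b :: real
  assumes "\<bar>a\<bar> \<le> 1" "\<bar>b\<bar> \<le> 1"
  shows "\<bar>a ^ n - b ^ n\<bar> \<le> real n * \<bar>a - b\<bar>"
  using norm_power_diff[of a b n] assms by simp

text \<open>In the first series every term grows, and the term at \<open>n = 0\<close> is
  \<open>r\<close> itself, so it gains at least \<open>s - r\<close>. In the second series the term
  at 0 is constant and the others change by at most two thirds of \<open>s - r\<close>.\<close>

lemma crossing_increasing:
  assumes "0 < r" "r < s" "s \<le> 1"
  shows "crossing s - crossing r \<ge> (s - r) / 3"
proof -
  let ?A = "\<lambda>r. \<Sum>n. r ^ (2 * n + 1) / real (Suc n) ^ 3"
  let ?B = "\<lambda>r. \<Sum>n. (- r) ^ n / real (Suc n) ^ 3"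
  have split: "crossing t = ?A t - ?B t" if "0 < t" "t \<le> 1" for t
    using that by (intro crossing_split) auto
  have "?A s - ?A r = (\<Sum>n. s ^ (2 * n + 1) / real (Suc n) ^ 3 - r ^ (2 * n + 1) / real (Suc n) ^ 3)"
    using assms summable_crossing_terms[of s] summable_crossing_terms[of r] by (subst suminf_diff) auto
  also have "\<dots> \<ge> (\<Sum>n<1. s ^ (2 * n + 1) / real (Suc n) ^ 3 - r ^ (2 * n + 1) / real (Suc n) ^ 3)"
    using assms summable_crossing_terms[of s] summable_crossing_terms[of r]
    by (intro sum_le_suminf summable_diff) (auto intro!: divide_right_mono mult_mono power_mono)
  finally have A: "?A s - ?A r \<ge> s - r" by simp
  define f where "f = (\<lambda>n. (- s) ^ n / real (Suc n) ^ 3 - (- r) ^ n / real (Suc n) ^ 3)"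
  have "norm (suminf f - f 0) \<le> 2 / 3 * (s - r)"
  proof (rule suminf_minus_head(2))
    fix n
    have "norm (f (Suc n)) = \<bar>(- s) ^ Suc n - (- r) ^ Suc n\<bar> / real (Suc (Suc n)) ^ 3"
      by (simp add: f_def diff_divide_distrib[symmetric])
    also have "\<dots> \<le> (real (Suc n) * \<bar>(- s) - (- r)\<bar>) / real (Suc (Suc n)) ^ 3"
      using assms by (intro divide_right_mono abs_power_diff_le) auto
    also have "\<dots> \<le> (real (Suc (Suc n)) * (s - r)) / real (Suc (Suc n)) ^ 3"
      using assms by (intro divide_right_mono mult_mono) auto
    also have "\<dots> = (s - r) / real (Suc (Suc n)) ^ 2"
      by (simp add: power3_eq_cube power2_eq_square del: of_nat_Suc)
    finally show "norm (f (Suc n)) \<le> (s - r) / real (Suc (Suc n)) ^ 2" .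
  qed
  moreover have "suminf f = ?B s - ?B r"
    unfolding f_def using assms summable_crossing_terms[of s] summable_crossing_terms[of r]
    by (intro suminf_diff[symmetric]) auto
  ultimately have "\<bar>?B s - ?B r\<bar> \<le> 2 / 3 * (s - r)"
    by (simp add: f_def)
  moreover have "crossing s = ?A s - ?B s" "crossing r = ?A r - ?B r"
    using split assms by auto
  moreover have "(s - r) / 3 \<le> (a - b) - (a' - b')" if "\<bar>b - b'\<bar> \<le> 2 / 3 * (s - r)" "s - r \<le> a - a'" for a b a' b'
    using abs_le_D1[OF that(1)] that(2) by (simp add: field_simps)
  ultimately show ?thesis using A by presburger
qed

lemma continuous_on_crossing: "continuous_on {0<..1} crossing"
proof -
  have "uniform_limit {0<..1} (\<lambda>n r. \<Sum>k<n. (r ^ (2 * k + 1) - (- r) ^ k) / real (Suc k) ^ 3)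
      (\<lambda>r. \<Sum>k. (r ^ (2 * k + 1) - (- r) ^ k) / real (Suc k) ^ 3) sequentially"
  proof (rule Weierstrass_m_test)
    fix k and r :: real assume "r \<in> {0<..1}"
    hence "\<bar>r ^ (2 * k + 1)\<bar> \<le> 1" "\<bar>(- r) ^ k\<bar> \<le> 1"
      by (auto simp: power_abs power_le_one mult_le_one)
    hence "\<bar>r ^ (2 * k + 1) - (- r) ^ k\<bar> \<le> 2" by linarith
    thus "norm ((r ^ (2 * k + 1) - (- r) ^ k) / real (Suc k) ^ 3) \<le> 2 / real (Suc k) ^ 3"
      unfolding real_norm_def abs_divide by (simp add: divide_right_mono)
  next
    show "summable (\<lambda>k. 2 / real (Suc k) ^ 3)"
      using summable_mult[OF summable_Li3[of "1::real"], of 2] by simp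
  qed
  thus ?thesis
    unfolding crossing_def[abs_def]
    by (rule uniform_limit_theorem[rotated]) (auto intro!: always_eventually continuous_intros)
qed

text \<open>At \<open>r = 1/4\<close> the estimate with error one third suffices: the two values are
  at most 1/12 and -1/6.\<close>

lemma crossing_neg: "crossing (1/4) < 0"
proof -
  have "1/4 * crossing (1/4) \<le> (1/16 + 1/16/3) + (-1/4 + 1/4/3)"
    using crossing_eq[of "1/4"] li3_bounds(2)[of "1/16"] li3_bounds(2)[of "-1/4"]
    by (simp add: power2_eq_square)
  thus ?thesis by simp
qed

text \<open>The value 111/100 separates the series: two terms of the first give
  \<open>0.99 + 0.99 ^ 3 / 8\<close>, which exceeds it, and the second is at most
  \<open>1 - 99/800 + 2/9\<close>, which is below it.\<close>

lemma crossing_pos: "crossing (99/100) > 0"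
proof -
  define r :: real where "r = 99/100"
  have r: "0 < r" "r \<le> 1" by (auto simp: r_def)
  note s = summable_crossing_terms[of r]
  have "crossing r = (\<Sum>n. r ^ (2 * n + 1) / real (Suc n) ^ 3) - (\<Sum>n. (- r) ^ n / real (Suc n) ^ 3)"
    using r by (intro crossing_split) auto
  moreover have "(\<Sum>n. r ^ (2 * n + 1) / real (Suc n) ^ 3) \<ge> (\<Sum>n<2. r ^ (2 * n + 1) / real (Suc n) ^ 3)"
    using r s by (intro sum_le_suminf) auto
  hence "(\<Sum>n. r ^ (2 * n + 1) / real (Suc n) ^ 3) \<ge> 111 / 100"
    by (simp add: r_def numeral_2_eq_2 power_divide)
  moreover have "(\<Sum>n. (- r) ^ n / real (Suc n) ^ 3) < 111 / 100"
  proof -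
    let ?f = "\<lambda>n. (- r) ^ n / real (Suc n) ^ 3"
    define g where "g = (\<lambda>n. ?f (Suc n))"
    have sg: "summable g" using r s(2) unfolding g_def by (subst summable_Suc_iff) auto
    have "norm (suminf g - g 0) \<le> 2 / 3 * (1 / 3)"
    proof (rule suminf_minus_head(2))
      fix n
      have "\<bar>(- r) ^ Suc (Suc n)\<bar> \<le> 1" using r power_le_one[of r "Suc (Suc n)"] by (simp only: power_abs abs_minus_cancel abs_of_pos less_imp_le)
      hence "norm (g (Suc n)) \<le> 1 / real (Suc (Suc (Suc n))) ^ 3"
        unfolding g_def real_norm_def abs_divide by (simp add: divide_right_mono del: of_nat_Suc power_Suc)
      also have "\<dots> \<le> 1 / (3 * real (Suc (Suc n)) ^ 2)"
      proof -
        have "3 * real (Suc (Suc n)) ^ 2 \<le> real (Suc (Suc (Suc n))) * real (Suc (Suc (Suc n))) ^ 2"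
          by (intro mult_mono power_mono) auto
        thus ?thesis by (intro divide_left_mono) (auto simp: power3_eq_cube power2_eq_square mult.assoc)
      qed
      finally show "norm (g (Suc n)) \<le> 1 / 3 / real (Suc (Suc n)) ^ 2" by simp
    qed
    moreover have "suminf ?f = ?f 0 + suminf g"
      using suminf_split_head[of ?f] r s(2) unfolding g_def by simp
    moreover have "g 0 = - 99 / 800" "?f 0 = 1" by (auto simp: g_def r_def)
    ultimately have "\<bar>suminf g - (- 99 / 800)\<bar> \<le> 2 / 9" "suminf ?f = 1 + suminf g"
      by (simp_all only: real_norm_def)
    moreover have "1 + b < 111 / 100" if "\<bar>b - (- 99 / 800)\<bar> \<le> 2 / 9" for b :: real
      using that by linarith
    ultimately show ?thesis by simp
  qed
  ultimately show ?thesis by (simp add: r_def)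
qed

text \<open>Both real parts carry the factor 1/2, for different reasons: in \<open>L 1\<close> it is
  the cosine of \<pi>/3, since \<open>Li3\<close> is negative at \<open>- r\<close>; in
  \<open>L 2\<close> it is the division by \<open>k = 2\<close>. So comparing them amounts to
  comparing \<open>- li3 (- r)\<close> with \<open>li3 (r ^ 2)\<close>.\<close>

lemma Re_L_negative:
  assumes "0 < r" "r < 1"
  shows "Re (L 1 (- of_real r)) = (2 * - li3 (- r)) powr (1 / 3) / 2"
    and "Re (L 2 (- of_real r)) = (2 * li3 (r ^ 2)) powr (1 / 3) / 2" 
    and "li3 (- r) < 0" "li3 (r ^ 2) > 0"
proof -
  have r2: "r ^ 2 < 1" "r ^ 2 > 0" using assms by (auto simp: power_less_one_iff)
  show neg: "li3 (- r) < 0" using li3_bounds(2)[of "- r"] assms by simp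
  show pos: "li3 (r ^ 2) > 0" by (rule li3_pos) (use r2 in auto)
  have "2 * Li3 (- of_real r) = - complex_of_real (2 * - li3 (- r))"
    using Li3_of_real[of "- r"] assms by simp
  thus "Re (L 1 (- of_real r)) = (2 * - li3 (- r)) powr (1 / 3) / 2"
    using Re_cube_root_negative[of "2 * - li3 (- r)"] neg by (simp add: L_def)
  have "2 * Li3 ((- of_real r) ^ 2) = complex_of_real (2 * li3 (r ^ 2))"
    using Li3_of_real[of "r ^ 2"] r2 by simp
  moreover have "complex_of_real (2 * li3 (r ^ 2)) powr (1 / 3) = of_real ((2 * li3 (r ^ 2)) powr (1 / 3))"
    using pos powr_of_real[of "2 * li3 (r ^ 2)" "1 / 3"] by simp
  ultimately show "Re (L 2 (- of_real r)) = (2 * li3 (r ^ 2)) powr (1 / 3) / 2"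
    unfolding L_def by (simp del: of_real_mult)
qed

lemma Re_L_negative_less_iff:
  assumes "0 < r" "r < 1"
  shows "Re (L 1 (- of_real r)) < Re (L 2 (- of_real r)) \<longleftrightarrow> crossing r > 0"
    and "Re (L 1 (- of_real r)) = Re (L 2 (- of_real r)) \<longleftrightarrow> crossing r = 0"
proof -
  have inj: "(a powr (1/3) < b powr (1/3)) = (a < b)" "(a powr (1/3) = b powr (1/3)) = (a = b)"
    if "a > 0" "b > 0" for a b :: real
    using that powr_less_mono2[of "1/3" a b] powr_less_mono2[of "1/3" b a]
    by (cases a b rule: linorder_cases; auto)+
  have c: "crossing r > 0 \<longleftrightarrow> r * crossing r > 0" "crossing r = 0 \<longleftrightarrow> r * crossing r = 0"
    using assms by (auto simp: zero_less_mult_iff)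
  show "Re (L 1 (- of_real r)) < Re (L 2 (- of_real r)) \<longleftrightarrow> crossing r > 0"
    unfolding Re_L_negative[OF assms] c crossing_eq[OF assms(1) less_imp_le[OF assms(2)]]
    using inj[of "2 * - li3 (- r)" "2 * li3 (r ^ 2)"] Re_L_negative(3,4)[OF assms] by auto
  show "Re (L 1 (- of_real r)) = Re (L 2 (- of_real r)) \<longleftrightarrow> crossing r = 0"
    unfolding Re_L_negative[OF assms] c crossing_eq[OF assms(1) less_imp_le[OF assms(2)]]
    using inj[of "2 * - li3 (- r)" "2 * li3 (r ^ 2)"] Re_L_negative(3,4)[OF assms] by auto
qed

text \<open>Division by 2 becomes a factor 8 after cubing, and \<open>li3 (t ^ 2)\<close> is far
  below \<open>8 * li3 t\<close>. This excludes positive points from the description of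
  \<open>xstar\<close>.\<close>

lemma Re_L_positive_neq:
  assumes "0 < t" "t < 1"
  shows "Re (L 1 (of_real t)) \<noteq> Re (L 2 (of_real t))"
proof -
  have t2: "t ^ 2 < t" "t ^ 2 > 0" using assms by (auto simp: power2_eq_square)
  have pos: "li3 t \<ge> 2 / 3 * t" using li3_bounds(1)[of t] assms by simp
  have pos2: "li3 (t ^ 2) > 0" "li3 (t ^ 2) \<le> 4 / 3 * t" using li3_pos[of "t ^ 2"] t2 assms by auto
  have 1: "Re (L 1 (of_real t)) = (2 * li3 t) powr (1 / 3)"
    using Li3_of_real[of t] assms pos powr_of_real[of "2 * li3 t" "1 / 3"] unfolding L_def by simp
  have 2: "Re (L 2 (of_real t)) = (2 * li3 (t ^ 2)) powr (1 / 3) / 2"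
    using Li3_of_real[of "t ^ 2"] assms pos2 t2 powr_of_real[of "2 * li3 (t ^ 2)" "1 / 3"] unfolding L_def by simp
  have "(2 * li3 (t ^ 2)) powr (1 / 3) \<le> (8 * (2 * li3 t)) powr (1 / 3)"
    using pos pos2 assms by (intro powr_mono2) auto
  also have "\<dots> = 8 powr (1/3) * (2 * li3 t) powr (1 / 3)"
    using pos assms by (intro powr_mult) 
  also have "8 powr (1/3) = (2::real)"
    using powr_powr[of 2 3 "1/3"] by simp
  finally have "(2 * li3 (t ^ 2)) powr (1 / 3) \<le> 2 * (2 * li3 t) powr (1 / 3)" .
  moreover have "(2 * li3 (t ^ 2)) powr (1 / 3) \<noteq> 2 * (2 * li3 t) powr (1 / 3)"
  proof
    assume "(2 * li3 (t ^ 2)) powr (1 / 3) = 2 * (2 * li3 t) powr (1 / 3)"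
    hence "((2 * li3 (t ^ 2)) powr (1 / 3)) powr 3 = (2 * (2 * li3 t) powr (1 / 3)) powr 3" by simp
    hence "2 * li3 (t ^ 2) = 8 * (2 * li3 t)"
      using pos pos2 assms by (simp add: powr_powr powr_mult)
    thus False using pos pos2 assms by linarith
  qed
  ultimately show ?thesis unfolding 1 2 by linarith
qed

text \<open>To the left of the zero of \<open>crossing\<close> the real part of \<open>L 2\<close>
  exceeds that of \<open>L 1\<close>. The proof also shows that the description defining
  \<open>xstar\<close> has a unique solution.\<close>

lemma negative_real_phase1:
  assumes "complex_of_real t \<in> phase 1" "t < 0"
  shows "t \<ge> xstar"
proof -
  \<comment> \<open>Existence comes from the intermediate value theorem, uniqueness from
    monotonicity of \<open>crossing\<close>.\<close>
  obtain r0 where r0: "1/4 \<le> r0" "r0 \<le> 99/100" "crossing r0 = 0"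
    using IVT'[of crossing "1/4" 0 "99/100"] crossing_neg crossing_pos continuous_on_subset[OF continuous_on_crossing, of "{1/4..99/100}"]
    by force
  have uniq: "r = r0" if "0 < r" "r < 1" "crossing r = 0" for r
    using crossing_increasing[of r r0] crossing_increasing[of r0 r] that r0
    by (cases r r0 rule: linorder_cases) auto
  have "xstar = - r0"
    unfolding xstar_def
  proof (rule the_equality)
    show "complex_of_real (- r0) \<in> punctured_disk \<and> Re (L 1 (complex_of_real (- r0))) = Re (L 2 (complex_of_real (- r0)))"
      using r0 Re_L_negative_less_iff(2)[of r0] by (simp add: punctured_disk_def)
    fix r assume r: "complex_of_real r \<in> punctured_disk \<and> Re (L 1 (complex_of_real r)) = Re (L 2 (complex_of_real r))"
    show "r = - r0"
    proof (cases "r > 0")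
      case True
      thus ?thesis using r Re_L_positive_neq[of r] by (simp add: punctured_disk_def)
    next
      case False
      hence "0 < - r" "- r < 1" using r by (auto simp: punctured_disk_def)
      thus ?thesis using r Re_L_negative_less_iff(2)[of "- r"] uniq[of "- r"] by simp
    qed
  qed
  moreover have "t \<ge> - r0"
  proof (rule ccontr)
    assume "\<not> t \<ge> - r0"
    moreover have "- t < 1" using phaseD(2)[OF assms(1)] by simp
    ultimately have "crossing (- t) > 0"
      using crossing_increasing[of r0 "- t"] r0 by simp
    hence "Re (L 1 (of_real t)) < Re (L 2 (of_real t))"
      using Re_L_negative_less_iff(1)[of "- t"] assms \<open>- t < 1\<close> by simp
    thus False using phaseD(3)[OF assms(1), of 2] by simp
  qed
  ultimately show ?thesis by simp
qed

text \<open>A real value of \<open>Li3\<close> forces a real argument by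
  \<open>Im_Li3_nonzero\<close>, and the error of one third in \<open>Li3_minus_id\<close> leaves
  the sign intact.\<close>

lemma real_of_Li3_nonpos:
  assumes "norm y \<le> 1" "2 * Li3 y \<in> \<real>\<^sub>\<le>\<^sub>0"
  shows "y = of_real (Re y)" "Re y \<le> 0"
proof -
  have "Im (Li3 y) = 0" "Re (Li3 y) \<le> 0"
    using assms(2) by (auto simp: complex_nonpos_Reals_iff)
  thus y: "y = of_real (Re y)" using Im_Li3_nonzero[OF assms(1)] by (auto simp: complex_eq_iff)
  have "\<bar>Re (Li3 y) - Re y\<bar> \<le> norm y / 3"
    using Li3_minus_id[OF assms(1)] abs_Re_le_cmod[of "Li3 y - y"] by simp
  moreover have "norm y = \<bar>Re y\<bar>" by (metis y norm_of_real)
  ultimately show "Re y \<le> 0" using \<open>Re (Li3 y) \<le> 0\<close> by linarith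
qed

text \<open>A point of phase 1 above the branch cut is real and negative, hence at least
  \<open>xstar\<close>; exactly these points are removed.\<close>

lemma Li3_phase1:
  assumes "x \<in> phase 1" "x \<notin> complex_of_real ` {xstar..0}"
  shows "2 * Li3 x \<notin> \<real>\<^sub>\<le>\<^sub>0"
proof
  assume a: "2 * Li3 x \<in> \<real>\<^sub>\<le>\<^sub>0"
  have x: "x = of_real (Re x)" "Re x \<le> 0"
    using real_of_Li3_nonpos[OF _ a] phaseD(2)[OF assms(1)] by auto
  have "Re x \<noteq> 0" using x phaseD(1)[OF assms(1)] by auto
  hence "Re x \<ge> xstar" using negative_real_phase1[of "Re x"] x assms(1) by simp
  thus False using x assms(2) by force
qed

text \<open>On the cut the real part of \<open>L 2 x\<close> has two factors 1/2, from the cosine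
  and from \<open>k = 2\<close>. The real part of \<open>L 1 x\<close> is at least half the cube
  root of \<open>norm (2 * Li3 x)\<close>, and already the crude bounds on
  \<open>norm (Li3 x)\<close> make it the larger one, against membership in phase 2.\<close>

lemma Li3_phase2:
  assumes "x \<in> phase 2"
  shows "2 * Li3 (x ^ 2) \<notin> \<real>\<^sub>\<le>\<^sub>0"
proof
  assume a: "2 * Li3 (x ^ 2) \<in> \<real>\<^sub>\<le>\<^sub>0"
  have x: "0 < norm x" "norm x < 1" using phaseD[OF assms] by auto
  have x2: "norm (x ^ 2) \<le> norm x" using x mult_left_le[of "norm x" "norm x"] by (simp add: norm_mult power2_eq_square)
  hence b: "2 / 3 * norm x \<le> norm (Li3 x)" "norm (Li3 (x ^ 2)) \<le> 4 / 3 * norm x"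
    using norm_Li3_bounds[of x] norm_Li3_bounds[of "x ^ 2"] x by auto
  have "norm (2 * Li3 (x ^ 2)) > 0"
    using norm_Li3_bounds(1)[of "x ^ 2"] x x2 by (auto simp: norm_power)
  hence "2 * Li3 (x ^ 2) = - complex_of_real (norm (2 * Li3 (x ^ 2)))"
    using a by (auto simp: complex_eq_iff complex_nonpos_Reals_iff cmod_eq_Re)
  hence "Re ((2 * Li3 (x ^ 2)) powr (1 / 3)) = norm (2 * Li3 (x ^ 2)) powr (1 / 3) / 2"
    using Re_cube_root_negative[OF \<open>norm (2 * Li3 (x ^ 2)) > 0\<close>] by metis
  hence "Re (L 2 x) = norm (2 * Li3 (x ^ 2)) powr (1 / 3) / 4"
    by (simp add: L_def)
  also have "\<dots> \<le> (8 * norm (2 * Li3 x)) powr (1 / 3) / 4"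
  proof -
    have "norm (2 * Li3 (x ^ 2)) \<le> 8 * norm (2 * Li3 x)"
      using b norm_ge_zero[of x] unfolding norm_mult norm_numeral by linarith
    thus ?thesis by (intro divide_right_mono powr_mono2) auto
  qed
  also have "(8 * norm (2 * Li3 x)) powr (1 / 3) = 8 powr (1/3) * norm (2 * Li3 x) powr (1 / 3)"
    by (intro powr_mult)
  also have "8 powr (1/3) = (2::real)"
    using powr_powr[of 2 3 "1/3"] by simp
  also have "2 * norm (2 * Li3 x) powr (1 / 3) / 4 \<le> Re (L 1 x)"
    using Re_cube_root_ge[of "2 * Li3 x"] by (simp add: L_def)
  finally show False using phaseD(3)[OF assms, of 1] by simp
qed

lemma Li3_holomorphic: "Li3 holomorphic_on ball 0 1"
proof -
  have "(\<lambda>x. \<Sum>n. x ^ Suc n / of_nat (Suc n) ^ 3) holomorphic_on ball 0 1"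
  proof (rule holomorphic_on_suminf)
    fix r :: real assume r: "0 < r" "r < 1"
    have "norm (x ^ Suc n / of_nat (Suc n) ^ 3) \<le> r ^ Suc n / real (Suc n) ^ 3" if "norm x \<le> r" for x :: complex and n
      unfolding norm_divide norm_power norm_of_nat using that by (intro divide_right_mono power_mono) auto
    thus "\<exists>M. summable M \<and> (\<forall>n (x::complex). norm x \<le> r \<longrightarrow> norm (x ^ Suc n / of_nat (Suc n) ^ 3) \<le> M n)"
      using summable_Li3[of r] r by (intro exI[of _ "\<lambda>n. r ^ Suc n / real (Suc n) ^ 3"]) auto
  qed (auto intro!: holomorphic_intros)
  thus ?thesis by (simp add: Li3_def[abs_def])
qed

lemma continuous_on_Li3 [continuous_intros]:
  assumes "continuous_on A f" "\<And>x. x \<in> A \<Longrightarrow> norm (f x) < 1"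
  shows "continuous_on A (\<lambda>x. Li3 (f x))"
  by (rule continuous_on_compose2[OF holomorphic_on_imp_continuous_on[OF Li3_holomorphic] assms(1)]) (use assms(2) in auto)

lemma continuous_on_L:
  assumes "\<And>x. x \<in> X \<Longrightarrow> norm x < 1" "\<And>x. x \<in> X \<Longrightarrow> 2 * Li3 (x ^ q) \<notin> \<real>\<^sub>\<le>\<^sub>0" "q > 0"
  shows "continuous_on X (L q)"
  unfolding L_def[abs_def] using assms
  by (intro continuous_intros) (auto simp: complex_nonpos_Reals_iff norm_power power_less_one_iff)

section \<open>The coefficient integral and the expansions at 1 and -1\<close>

lemma has_integral_character:
  fixes k :: int and t :: real
  shows "((\<lambda>v. exp (of_int k * (of_real t + \<i> * of_real v))) has_integral (if k = 0 then 2 * of_real pi else 0)) {-pi..pi}"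
proof (cases "k = 0")
  case True
  have "((\<lambda>v. 1 :: complex) has_integral (pi - (- pi)) *\<^sub>R 1) {-pi..pi}"
    using has_integral_const_real[of "1 :: complex" "-pi" pi] by simp
  thus ?thesis using True by (simp add: scaleR_conv_of_real)
next
  case False
  define F where "F = (\<lambda>z. exp (of_int k * (of_real t + \<i> * z)) / (of_int k * \<i>))"
  have "((\<lambda>v. exp (of_int k * (of_real t + \<i> * of_real v))) has_integral (F (of_real pi) - F (of_real (- pi)))) {-pi..pi}"
  proof (rule fundamental_theorem_of_calculus)
    fix v :: real
    have "(F has_field_derivative exp (of_int k * (of_real t + \<i> * of_real v))) (at (of_real v))"
      unfolding F_def using False by (auto intro!: derivative_eq_intros)
    thus "((\<lambda>v. F (of_real v)) has_vector_derivative exp (of_int k * (of_real t + \<i> * of_real v))) (at v within {-pi..pi})"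
      by (rule has_vector_derivative_real_field)
  qed simp
  moreover have "exp (of_int k * (of_real t + \<i> * of_real pi)) = exp (of_int k * (of_real t + \<i> * of_real (- pi)))"
  proof -
    have "of_int k * (of_real t + \<i> * of_real pi) = of_int k * (of_real t + \<i> * of_real (- pi)) + (of_int (2 * k) * pi) * \<i>"
      by (simp add: algebra_simps)
    thus ?thesis by (metis exp_eq)
  qed
  ultimately show ?thesis using False by (simp add: F_def)
qed

text \<open>Cauchy's coefficient formula on the circle of radius \<open>exp (- t)\<close>. Rotation
  by \<open>\<epsilon>\<close> puts the chosen root of unity at \<open>v = 0\<close> and costs the
  factor \<open>\<epsilon> ^ n\<close>; uniform convergence on the circle allows integration term by
  term.\<close>

lemma trace_poly_integral:
  fixes x \<epsilon> :: complex
  assumes x: "norm x < 1" and t: "t > 0" and eps: "norm \<epsilon> = 1"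
  shows "((\<lambda>v. exp (log_gf x (\<epsilon> * exp (- (of_real t + \<i> * of_real v))) + of_nat n * (of_real t + \<i> * of_real v)))
     has_integral (2 * of_real pi * (\<epsilon> ^ n * trace_poly n x))) {-pi..pi}"
proof -
  define s where "s = (\<lambda>v::real. of_real t + \<i> * of_real v :: complex)"
  define u where "u = (\<lambda>v. \<epsilon> * exp (- s v))"
  define f where "f = (\<lambda>m v. trace_poly m x * \<epsilon> ^ m * exp (of_int (int n - int m) * s v))"
  define I where "I = (\<lambda>m. if m = n then 2 * of_real pi * (\<epsilon> ^ n * trace_poly n x) else 0)"
  have nu: "norm (u v) = exp (- t)" for v
    by (simp add: u_def s_def norm_mult eps)
  have f_eq: "f m v = exp (of_nat n * s v) * (trace_poly m x * u v ^ m)" for m v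
    by (simp add: f_def u_def power_mult_distrib exp_of_nat_mult[symmetric] exp_add[symmetric] exp_diff
        exp_minus field_simps flip: exp_of_nat_mult)
  have "(f m has_integral I m) {-pi..pi}" for m
    using has_integral_mult_right[OF has_integral_character[of "int n - int m" t], of "trace_poly m x * \<epsilon> ^ m"]
    by (cases "m = n") (auto simp: f_def I_def s_def mult_ac)
  hence int_sum: "((\<lambda>v. \<Sum>m<N. f m v) has_integral (\<Sum>m<N. I m)) {-pi..pi}" for N
    by (intro has_integral_sum) auto
  have unif: "uniform_limit {-pi..pi} (\<lambda>N v. \<Sum>m<N. f m v) (\<lambda>v. \<Sum>m. f m v) sequentially"
  proof (rule Weierstrass_m_test)
    fix m and v :: real
    show "norm (f m v) \<le> exp (n * t) * norm (trace_poly m x * of_real (exp (- t)) ^ m)"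
      unfolding f_eq by (simp add: norm_mult norm_power nu s_def)
  next
    show "summable (\<lambda>m. exp (n * t) * norm (trace_poly m x * of_real (exp (- t)) ^ m))"
      using x t by (intro summable_mult summable_norm_trace_gf) (auto simp del: of_real_exp)
  qed
  have cont: "continuous_on {-pi..pi} (\<lambda>v. \<Sum>m<N. f m v)" for N
    unfolding f_def s_def by (intro continuous_intros)
  obtain I' J where IJ: "\<And>N. ((\<lambda>v. \<Sum>m<N. f m v) has_integral I' N) {-pi..pi}"
      "((\<lambda>v. \<Sum>m. f m v) has_integral J) {-pi..pi}" "I' \<longlonglongrightarrow> J"
    by (rule uniform_limit_integral[OF unif cont]) auto
  have "I' = (\<lambda>N. \<Sum>m<N. I m)"
    using has_integral_unique[OF IJ(1) int_sum] by auto
  moreover have "(\<lambda>N. \<Sum>m<N. I m) \<longlonglongrightarrow> I n"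
  proof (rule tendsto_eventually)
    show "\<forall>\<^sub>F N in sequentially. (\<Sum>m<N. I m) = I n"
      using eventually_gt_at_top[of n] by eventually_elim (auto simp: I_def)
  qed
  ultimately have "J = I n" using IJ(3) LIMSEQ_unique by blast
  moreover have "(\<Sum>m. f m v) = exp (log_gf x (u v) + of_nat n * s v)" for v
  proof -
    have "norm (u v) < 1" using nu t by simp
    from sums_mult[OF trace_gf[OF x this], of "exp (of_nat n * s v)"]
    have "(\<lambda>m. f m v) sums (exp (of_nat n * s v) * exp (log_gf x (u v)))"
      by (simp add: f_eq)
    thus ?thesis by (simp add: sums_iff exp_add mult.commute)
  qed
  ultimately show ?thesis using IJ(2) by (simp add: I_def u_def s_def)
qed

section \<open>The kernel of the exponent and its behaviour at 0\<close>

text \<open>The factor \<open>u ^ k / (1 - u ^ k) ^ 2\<close> of the exponent for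
  \<open>u ^ k = \<eta> * exp (- z)\<close>. At \<open>z = 0\<close> it has a double pole if
  \<open>\<eta>\<close> is 1, and is regular otherwise.\<close>

definition kernel :: "complex \<Rightarrow> complex \<Rightarrow> complex" where
  "kernel \<eta> z = \<eta> * exp (- z) / (1 - \<eta> * exp (- z)) ^ 2"

text \<open>With \<open>e = exp (- t / 2)\<close> the numerator has norm \<open>e ^ 2\<close>, and
  the base of the denominator has norm at least \<open>1 - e ^ 2\<close>, hence at least
  \<open>e * t / 2\<close>; the powers of \<open>e\<close> cancel.\<close>

lemma kernel_bound:
  assumes "norm \<eta> = 1" "Re z > 0"
  shows "norm (kernel \<eta> z) \<le> 4 / Re z ^ 2"
proof -
  define t where "t = Re z"
  have t: "t > 0" using assms by (simp add: t_def)
  define e where "e = exp (- t / 2)"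
  have e: "0 < e" "e < 1" using t by (auto simp: e_def)
  have e2: "exp (- t) = e ^ 2" by (simp add: e_def power2_eq_square exp_add[symmetric])
  have "1 + t / 2 \<le> exp (t / 2)" by (rule exp_ge_add_one_self)
  hence "e * (1 + t / 2) \<le> e * exp (t / 2)" using e by (intro mult_left_mono) auto
  also have "e * exp (t / 2) = 1" by (simp add: e_def exp_add[symmetric])
  finally have "e * (t / 2) \<le> 1 - e" by (simp add: algebra_simps)
  also have "\<dots> \<le> 1 - e ^ 2" using e by (simp add: power2_eq_square mult_left_le)
  finally have *: "e * (t / 2) \<le> 1 - e ^ 2" .
  have "1 - e ^ 2 \<le> norm (1 - \<eta> * exp (- z))"
    using norm_triangle_ineq2[of 1 "\<eta> * exp (- z)"] assms e2 by (simp add: norm_mult t_def)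
  hence "(e * (t / 2)) ^ 2 \<le> norm (1 - \<eta> * exp (- z)) ^ 2"
    using * e t by (intro power_mono) auto
  hence "norm (kernel \<eta> z) \<le> e ^ 2 / (e * (t / 2)) ^ 2"
    unfolding kernel_def norm_divide norm_power
    using assms e e2 t by (intro frac_le) (auto simp: norm_mult t_def)
  also have "\<dots> = 4 / t ^ 2" using e t by (simp add: power_mult_distrib power_divide)
  finally show ?thesis by (simp add: t_def)
qed

text \<open>Here \<open>kernel 1 z\<close> is the reciprocal of
  \<open>exp z + exp (- z) - 2\<close>, that is of \<open>z ^ 2 + z ^ 4 / 12 + R\<close> with
  \<open>R\<close> of order six, whence the Laurent terms \<open>1 / z ^ 2\<close> and
  \<open>- 1 / 12\<close>. The error obtained is quadratic and is then weakened to a linear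
  one.\<close>

lemma kernel_1_near_0:
  assumes "norm z \<le> 1" "z \<noteq> 0"
  shows "norm (kernel 1 z - 1 / z ^ 2 + 1 / 12) \<le> norm z"
proof -
  define r where "r = norm z"
  have r: "0 < r" "r \<le> 1" using assms by (auto simp: r_def)
  define D where "D = exp z + exp (- z) - 2"
  define R where "R = D - z ^ 2 - z ^ 4 / 12"
  have T: "norm (exp w - (\<Sum>i\<le>5. w ^ i / fact i)) \<le> r ^ 6 / 40" if "norm w = r" for w :: complex
  proof -
    have "norm (exp w - (\<Sum>i\<le>5. w ^ i / fact i)) \<le> exp r * r ^ 6 / fact 5"
      using Taylor_exp_field[of w 5] that by (simp add: eval_nat_numeral)
    also have "\<dots> \<le> 3 * r ^ 6 / 120"
    proof -
      have "exp r \<le> exp 1" using r by simp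
      also have "exp 1 \<le> (3::real)" by (rule exp_le)
      finally have "exp r * r ^ 6 \<le> 3 * r ^ 6" using r by (intro mult_right_mono) auto
      thus ?thesis by (simp add: fact_numeral)
    qed
    finally show ?thesis by simp
  qed
  \<comment> \<open>In the two Taylor polynomials of degree 5 the odd powers cancel, and the even
    ones are the terms subtracted in \<open>R\<close>.\<close>
  have "R = (exp z - (\<Sum>i\<le>5. z ^ i / fact i)) + (exp (- z) - (\<Sum>i\<le>5. (- z) ^ i / fact i))"
    unfolding R_def D_def by (simp add: eval_nat_numeral fact_numeral algebra_simps)
  hence "norm R \<le> r ^ 6 / 40 + r ^ 6 / 40"
    using norm_triangle_le[OF add_mono[OF T[of z] T[of "- z"]]] by (simp add: r_def)
  hence R: "norm R \<le> r ^ 6 / 20" by simp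
  have rp: "r ^ 6 \<le> r ^ 2" "r ^ 4 \<le> r ^ 2" using r by (intro power_decreasing; simp)+
  have "norm z ^ 2 \<le> norm D + norm (z ^ 4 / 12) + norm R"
  proof -
    have "z ^ 2 = D - (z ^ 4 / 12 + R)" by (simp add: R_def)
    hence "norm (z ^ 2) \<le> norm D + norm (z ^ 4 / 12 + R)" by (metis norm_triangle_ineq4)
    thus ?thesis using norm_triangle_ineq[of "z ^ 4 / 12" R] by (simp add: norm_power)
  qed
  hence "r ^ 2 \<le> norm D + r ^ 4 / 12 + r ^ 6 / 20"
    using R by (simp add: r_def norm_divide norm_power)
  hence Dlow: "r ^ 2 / 2 \<le> norm D" using rp zero_le_power2[of r] by linarith
  have D0: "D \<noteq> 0" using Dlow r by auto
  have "kernel 1 z = 1 / D"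
  proof -
    have "(1 - exp (- z)) ^ 2 = exp (- z) * D"
      by (simp add: D_def power2_eq_square algebra_simps exp_add[symmetric])
    thus ?thesis by (simp add: kernel_def)
  qed
  hence "kernel 1 z - 1 / z ^ 2 + 1 / 12 = (z ^ 2 - D + z ^ 2 * D / 12) / (z ^ 2 * D)"
    using D0 assms by (simp add: field_simps)
  also have "z ^ 2 - D + z ^ 2 * D / 12 = - R + z ^ 6 / 144 + z ^ 2 * R / 12"
    by (simp add: R_def field_simps power_add[symmetric]) 
  finally have eq: "kernel 1 z - 1 / z ^ 2 + 1 / 12 = (- R + z ^ 6 / 144 + z ^ 2 * R / 12) / (z ^ 2 * D)" .
  have "norm (- R + z ^ 6 / 144 + z ^ 2 * R / 12) \<le> norm R + norm (z ^ 6 / 144) + norm (z ^ 2 * R / 12)"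
    by (intro norm_triangle_le[OF add_mono] norm_triangle_le[OF add_mono]) auto
  also have "\<dots> = norm R + r ^ 6 / 144 + r ^ 2 * norm R / 12"
    by (simp add: norm_mult norm_divide norm_power r_def)
  also have "\<dots> \<le> r ^ 6 / 20 + r ^ 6 / 144 + 1 * (r ^ 6 / 20) / 12"
    using R r by (intro add_mono divide_right_mono mult_mono) (auto simp: power_le_one)
  also have "\<dots> \<le> r ^ 6 / 2" using r by simp
  finally have "norm (kernel 1 z - 1 / z ^ 2 + 1 / 12) \<le> (r ^ 6 / 2) / (r ^ 2 * (r ^ 2 / 2))"
    unfolding eq norm_divide norm_mult norm_power r_def[symmetric]
    using r Dlow by (intro frac_le mult_left_mono mult_pos_pos) auto
  also have "\<dots> = r ^ 2" using r by (simp add: power_add[symmetric] field_simps)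
  also have "\<dots> \<le> r" using r by (simp add: power2_eq_square mult_left_le)
  finally show ?thesis by (simp add: r_def)
qed

text \<open>The value at 0 is -1/4. The denominator stays away from 0 because the imaginary part of
  \<open>z\<close> is below \<pi>/2 in absolute value, so \<open>exp (- z)\<close> has positive real
  part.\<close>

lemma kernel_minus_1_near_0:
  assumes "norm z \<le> 1"
  shows "norm (kernel (- 1) z + 1 / 4) \<le> 3 * norm z"
proof -
  have "Re (exp (- z)) > 0"
  proof -
    have "\<bar>Im z\<bar> \<le> 1" using assms abs_Im_le_cmod[of z] by linarith
    moreover have "1 < pi / 2" using pi_gt3 by linarith
    ultimately have "cos (Im z) > 0" by (intro cos_gt_zero_pi) auto
    thus ?thesis by (simp add: Re_exp)
  qed
  hence "1 \<le> Re (1 + exp (- z))" by simp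
  hence ge1: "1 \<le> norm (1 + exp (- z))" using complex_Re_le_cmod order_trans by blast
  hence nz: "1 + exp (- z) \<noteq> 0" by auto
  have "kernel (- 1) z + 1 / 4 = (1 - exp (- z)) ^ 2 / (4 * (1 + exp (- z)) ^ 2)"
    using nz by (simp add: kernel_def divide_simps) (simp add: power2_eq_square algebra_simps)
  hence "norm (kernel (- 1) z + 1 / 4) = norm (1 - exp (- z)) ^ 2 / (4 * norm (1 + exp (- z)) ^ 2)"
    by (simp add: norm_divide norm_mult norm_power)
  also have "\<dots> \<le> (3 * norm z) ^ 2 / (4 * 1 ^ 2)"
  proof (intro frac_le mult_left_mono power_mono ge1)
    have "norm (exp (- z) - 1) \<le> exp (norm z) * norm z"
      using Taylor_exp_field[of "- z" 0] by simp
    also have "\<dots> \<le> 3 * norm z"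
    proof (intro mult_right_mono)
      have "exp (norm z) \<le> exp 1" using assms by simp
      also have "exp 1 \<le> (3::real)" by (rule exp_le)
      finally show "exp (norm z) \<le> 3" .
    qed simp
    finally show "norm (1 - exp (- z)) \<le> 3 * norm z" by (simp add: norm_minus_commute)
  qed auto
  also have "\<dots> \<le> 3 * norm z"
    using assms mult_left_le[of "norm z" "norm z"] norm_ge_zero[of z]
    by (simp add: power2_eq_square del: norm_ge_zero)
  finally show ?thesis .
qed

text \<open>For small \<open>z\<close> these are the local expansions. For \<open>norm z > 1\<close>
  everything is bounded in terms of \<open>M\<close> by \<open>kernel_bound\<close>, and a bounded
  error is at most linear there.\<close>

lemma kernel_cone:
  assumes z: "Re z > 0" "norm z \<le> M * Re z"
  shows "norm (kernel 1 z - 1 / z ^ 2 + 1 / 12) \<le> (4 * M ^ 2 + 3) * norm z"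
    and "norm (kernel (- 1) z + 1 / 4) \<le> (4 * M ^ 2 + 3) * norm z"
proof -
  have z0: "z \<noteq> 0" using z by auto
  have far: "norm (kernel \<eta> z) \<le> 4 * M ^ 2" if "norm z > 1" "norm \<eta> = 1" for \<eta>
  proof -
    have "1 \<le> (M * Re z) ^ 2" using that z by (simp add: one_le_power)
    hence "4 / Re z ^ 2 \<le> 4 * M ^ 2" using z by (simp add: power_mult_distrib divide_simps)
    thus ?thesis using kernel_bound[OF that(2) z(1)] by linarith
  qed
  show "norm (kernel 1 z - 1 / z ^ 2 + 1 / 12) \<le> (4 * M ^ 2 + 3) * norm z"
  proof (cases "norm z \<le> 1")
    case True
    have "1 * norm z \<le> (4 * M ^ 2 + 3) * norm z" by (intro mult_right_mono) auto
    thus ?thesis using kernel_1_near_0[OF True z0] by linarith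
  next
    case False
    have "norm (kernel 1 z - 1 / z ^ 2 + 1 / 12) \<le> norm (kernel 1 z) + norm (1 / z ^ 2) + norm (1 / 12 :: complex)"
      using norm_triangle_ineq[of "kernel 1 z - 1 / z ^ 2" "1 / 12"] norm_triangle_ineq4[of "kernel 1 z" "1 / z ^ 2"] by linarith
    also have "norm (1 / z ^ 2) \<le> 1" using False one_le_power[of "norm z" 2] by (simp add: norm_divide norm_power divide_le_eq_1)
    also have "norm (kernel 1 z) \<le> 4 * M ^ 2" using far[of 1] False by simp
    finally have "norm (kernel 1 z - 1 / z ^ 2 + 1 / 12) \<le> (4 * M ^ 2 + 3) * 1" by simp
    also have "\<dots> \<le> (4 * M ^ 2 + 3) * norm z" using False by (intro mult_left_mono) auto
    finally show ?thesis .
  qed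
  show "norm (kernel (- 1) z + 1 / 4) \<le> (4 * M ^ 2 + 3) * norm z"
  proof (cases "norm z \<le> 1")
    case True
    have "3 * norm z \<le> (4 * M ^ 2 + 3) * norm z" by (intro mult_right_mono) auto
    thus ?thesis using kernel_minus_1_near_0[OF True] by linarith
  next
    case False
    have "norm (kernel (- 1) z + 1 / 4) \<le> norm (kernel (- 1) z) + norm (1 / 4 :: complex)"
      by (rule norm_triangle_ineq)
    also have "norm (kernel (- 1) z) \<le> 4 * M ^ 2" using far[of "- 1"] False by simp
    finally have "norm (kernel (- 1) z + 1 / 4) \<le> (4 * M ^ 2 + 3) * 1" by simp
    also have "\<dots> \<le> (4 * M ^ 2 + 3) * norm z" using False by (intro mult_left_mono) auto
    finally show ?thesis .
  qed
qed

section \<open>Expansions of the exponent at 1 and -1\<close>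

lemma log_gf_kernel_sums:
  assumes "norm x < 1" "Re s > 0" "norm \<epsilon> = 1"
  shows "(\<lambda>k. x ^ Suc k / of_nat (Suc k) * kernel (\<epsilon> ^ Suc k) (of_nat (Suc k) * s)) sums log_gf x (\<epsilon> * exp (- s))"
proof -
  let ?u = "\<epsilon> * exp (- s)"
  have nu: "norm ?u < 1" using assms by (simp add: norm_mult)
  have "summable (\<lambda>k. x ^ Suc k / of_nat (Suc k) * (?u ^ Suc k / (1 - ?u ^ Suc k) ^ 2))"
    by (rule summable_comparison_test'[OF summable_log_gf_bound[OF norm_ge_zero assms(1), of "norm ?u"]])
       (rule norm_log_gf_term, use nu in auto)
  hence "(\<lambda>k. x ^ Suc k / of_nat (Suc k) * (?u ^ Suc k / (1 - ?u ^ Suc k) ^ 2)) sums log_gf x ?u"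
    unfolding log_gf_def by (rule summable_sums)
  moreover have "?u ^ k = \<epsilon> ^ k * exp (- (of_nat k * s))" for k
    by (simp add: power_mult_distrib exp_of_nat_mult[symmetric])
  ultimately show ?thesis unfolding kernel_def by (simp only:)
qed

lemma Li3_sums_multiples:
  assumes "norm x < 1" "q > 0"
  shows "(\<lambda>k. if q dvd Suc k then x ^ Suc k / of_nat (Suc k) ^ 3 else 0) sums (Li3 (x ^ q) / of_nat q ^ 3)"
proof -
  have "(\<lambda>j. (x ^ q) ^ Suc j / of_nat (Suc j) ^ 3 / of_nat q ^ 3) sums (Li3 (x ^ q) / of_nat q ^ 3)"
    unfolding Li3_def using assms
    by (intro sums_divide summable_sums summable_Li3) (auto simp: norm_power power_le_one)
  \<comment> \<open>Index \<open>n\<close> of the series carries the exponent \<open>Suc n\<close>,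
    so the multiple \<open>q * Suc j\<close> sits at index \<open>q * Suc j - 1\<close>.\<close>
  moreover have "(x ^ q) ^ Suc j / of_nat (Suc j) ^ 3 / of_nat q ^ 3
     = (if q dvd Suc (q * Suc j - 1) then x ^ Suc (q * Suc j - 1) / of_nat (Suc (q * Suc j - 1)) ^ 3 else 0)" for j
  proof -
    have e: "Suc (q * Suc j - 1) = q * Suc j" using assms by simp
    show ?thesis unfolding e by (simp add: power_mult[symmetric] power_mult_distrib mult.commute del: power_Suc mult_Suc_right mult_Suc of_nat_Suc)
  qed
  ultimately have "(\<lambda>j. (if q dvd Suc (q * Suc j - 1) then x ^ Suc (q * Suc j - 1) / of_nat (Suc (q * Suc j - 1)) ^ 3 else 0))
     sums (Li3 (x ^ q) / of_nat q ^ 3)" by (simp only:)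
  thus ?thesis
  proof (rule sums_mono_reindex[THEN iffD1, rotated 2])
    show "strict_mono (\<lambda>j. q * Suc j - 1)"
      using assms by (auto simp: strict_mono_Suc_iff)
    show "(if q dvd Suc n then x ^ Suc n / of_nat (Suc n) ^ 3 else 0) = 0" if "n \<notin> range (\<lambda>j. q * Suc j - 1)" for n
    proof -
      have "\<not> q dvd Suc n"
      proof
        assume "q dvd Suc n"
        then obtain j where j: "Suc n = q * j" by blast
        then obtain j' where "j = Suc j'" by (cases j) auto
        hence "n = q * Suc j' - 1" using j by simp
        thus False using that by blast
      qed
      thus ?thesis by simp
    qed
  qed
qed

lemma Ln_one_minus_sums:
  assumes "norm x < 1"
  shows "(\<lambda>k. x ^ Suc k / of_nat (Suc k)) sums (- Ln (1 - x))"
proof -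
  have "(\<lambda>n. (- 1) ^ Suc n / of_nat n * (- x) ^ n) sums Ln (1 + (- x))"
    by (rule Ln_series) (use assms in simp)
  from sums_minus[OF this] have "(\<lambda>n. - ((- 1) ^ Suc n / of_nat n * (- x) ^ n)) sums (- Ln (1 - x))"
    by simp
  also have "(\<lambda>n. - ((- 1) ^ Suc n / of_nat n * (- x) ^ n)) = (\<lambda>n. x ^ n / of_nat n)"
    by (simp add: power_mult_distrib[symmetric])
  finally have "(\<lambda>n. x ^ n / of_nat n) sums (- Ln (1 - x))" .
  thus ?thesis by (subst sums_Suc_iff) auto
qed

lemma Ln_one_minus_sums_even:
  assumes "norm x < 1"
  shows "(\<lambda>k. if even (Suc k) then x ^ Suc k / of_nat (Suc k) else 0) sums (- Ln (1 - x ^ 2) / 2)"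
proof -
  have "(\<lambda>j. (x ^ 2) ^ Suc j / of_nat (Suc j) / 2) sums (- Ln (1 - x ^ 2) / 2)"
    using assms by (intro sums_divide Ln_one_minus_sums) (auto simp: norm_power power_less_one_iff)
  moreover have "(x ^ 2) ^ Suc j / of_nat (Suc j) / 2
     = (if even (Suc (2 * j + 1)) then x ^ Suc (2 * j + 1) / of_nat (Suc (2 * j + 1)) else 0)" for j
  proof -
    have e: "Suc (2 * j + 1) = 2 * Suc j" by simp
    show ?thesis unfolding e by (simp add: power_mult[symmetric] mult.commute del: power_Suc mult_Suc_right mult_Suc of_nat_Suc)
  qed
  ultimately have "(\<lambda>j. (if even (Suc (2 * j + 1)) then x ^ Suc (2 * j + 1) / of_nat (Suc (2 * j + 1)) else 0))
     sums (- Ln (1 - x ^ 2) / 2)" by (simp only:)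
  thus ?thesis
  proof (rule sums_mono_reindex[THEN iffD1, rotated 2])
    show "strict_mono (\<lambda>j::nat. 2 * j + 1)" by (auto simp: strict_mono_Suc_iff)
    show "(if even (Suc n) then x ^ Suc n / of_nat (Suc n) else 0) = 0" if "n \<notin> range (\<lambda>j. 2 * j + 1)" for n
    proof -
      have "even n" using that by (metis oddE rangeI)
      thus ?thesis by simp
    qed
  qed
qed

text \<open>The expansion is applied to all multiples \<open>k * s\<close> at once, which requires a
  region stable under positive scaling; a disk around 0 would not do.\<close>

definition cone :: "real \<Rightarrow> complex set" where
  "cone M = {s. Re s > 0 \<and> norm s \<le> M * Re s}"

text \<open>The error of term \<open>k\<close> is linear in \<open>k * s\<close>; the factor
  \<open>k\<close> cancels against the denominator in \<open>x ^ k / k\<close>, and a geometric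
  series remains.\<close>

lemma log_gf_expansion_error:
  assumes r: "r < 1" and x: "norm x \<le> r" and s: "s \<in> cone M" and eps: "norm \<epsilon> = 1"
    and m: "\<And>k. norm (kernel (\<epsilon> ^ Suc k) (of_nat (Suc k) * s) - m k) \<le> (4 * M ^ 2 + 3) * norm (of_nat (Suc k) * s)"
    and A: "(\<lambda>k. x ^ Suc k / of_nat (Suc k) * m k) sums A"
  shows "norm (log_gf x (\<epsilon> * exp (- s)) - A) \<le> (4 * M ^ 2 + 3) * (r / (1 - r)) * norm s"
proof -
  have r0: "0 \<le> r" using x norm_ge_zero order_trans by blast
  let ?g = "\<lambda>k. (4 * M ^ 2 + 3) * norm s * r ^ Suc k"
  have d: "(\<lambda>k. x ^ Suc k / of_nat (Suc k) * (kernel (\<epsilon> ^ Suc k) (of_nat (Suc k) * s) - m k)) sums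
        (log_gf x (\<epsilon> * exp (- s)) - A)"
    using sums_diff[OF log_gf_kernel_sums[of x s \<epsilon>] A] s x r eps
    by (simp only: right_diff_distrib cone_def mem_Collect_eq)
  have le: "norm (x ^ Suc k / of_nat (Suc k) * (kernel (\<epsilon> ^ Suc k) (of_nat (Suc k) * s) - m k)) \<le> ?g k" for k
  proof -
    have "norm (x ^ Suc k / of_nat (Suc k) * (kernel (\<epsilon> ^ Suc k) (of_nat (Suc k) * s) - m k))
        \<le> (r ^ Suc k / real (Suc k)) * ((4 * M ^ 2 + 3) * norm (of_nat (Suc k) * s))"
      unfolding norm_mult[of "x ^ Suc k / of_nat (Suc k)"] norm_divide norm_power norm_of_nat
      using m[of k] x r0 by (intro mult_mono divide_right_mono power_mono) auto
    also have "\<dots> = ?g k" unfolding norm_mult norm_of_nat by (simp del: of_nat_Suc power_Suc)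
    finally show ?thesis .
  qed
  have g: "?g sums ((4 * M ^ 2 + 3) * norm s * (r / (1 - r)))"
  proof (intro sums_mult)
    show "(\<lambda>k. r ^ Suc k) sums (r / (1 - r))"
      using sums_mult[OF geometric_sums[of r], of r] r r0 by simp
  qed
  have sn: "summable (\<lambda>k. norm (x ^ Suc k / of_nat (Suc k) * (kernel (\<epsilon> ^ Suc k) (of_nat (Suc k) * s) - m k)))"
    by (rule summable_comparison_test'[OF sums_summable[OF g]]) (use le in simp)
  have "norm (log_gf x (\<epsilon> * exp (- s)) - A)
     \<le> (\<Sum>k. norm (x ^ Suc k / of_nat (Suc k) * (kernel (\<epsilon> ^ Suc k) (of_nat (Suc k) * s) - m k)))"
    using summable_norm[OF sn] d by (simp add: sums_iff)
  also have "\<dots> \<le> suminf ?g" by (rule suminf_le[OF le sn sums_summable[OF g]])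
  finally show ?thesis using g by (simp add: sums_iff mult_ac)
qed

lemma cone_mult_nat: "s \<in> cone M \<Longrightarrow> of_nat (Suc k) * s \<in> cone M"
proof -
  assume "s \<in> cone M"
  moreover have "Re (of_nat (Suc k) * s) = real (Suc k) * Re s" "norm (of_nat (Suc k) * s) = real (Suc k) * norm s"
    by (auto simp: norm_mult simp del: of_nat_Suc)
  ultimately show ?thesis by (simp add: cone_def mult.left_commute[of M] del: of_nat_Suc)
qed

text \<open>The double poles sum to the trilogarithm, and the constants -1/12 against
  \<open>x ^ k / k\<close> to \<open>Ln (1 - x) / 12\<close>.\<close>

lemma expansion_at_1:
  assumes r: "r < 1" and x: "norm x \<le> r" and s: "s \<in> cone M"
  shows "norm (log_gf x (1 * exp (- s)) - (L 1 x ^ 3 / (2 * s ^ 2) + Ln (1 - x) / 12)) \<le> (4 * M ^ 2 + 3) * (r / (1 - r)) * norm s"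
proof (rule log_gf_expansion_error[OF r x s, where m = "\<lambda>k. 1 / (of_nat (Suc k) * s) ^ 2 - 1 / 12"])
  show "norm (kernel (1 ^ Suc k) (of_nat (Suc k) * s) - (1 / (of_nat (Suc k) * s) ^ 2 - 1 / 12))
      \<le> (4 * M ^ 2 + 3) * norm (of_nat (Suc k) * s)" for k
    using kernel_cone(1)[of "of_nat (Suc k) * s" M] cone_mult_nat[OF s, of k]
    by (simp add: cone_def algebra_simps del: of_nat_Suc)
  have x1: "norm x < 1" using x r by simp
  have s0: "s \<noteq> 0" using s by (auto simp: cone_def)
  have "(\<lambda>k. x ^ Suc k / of_nat (Suc k) ^ 3) sums Li3 x"
    unfolding Li3_def using x1 by (intro summable_sums summable_Li3) auto
  hence "(\<lambda>k. x ^ Suc k / of_nat (Suc k) ^ 3 / s ^ 2 - x ^ Suc k / of_nat (Suc k) / 12) sums (Li3 x / s ^ 2 - (- Ln (1 - x)) / 12)"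
    by (intro sums_diff sums_divide Ln_one_minus_sums[OF x1])
  moreover have "x ^ Suc k / of_nat (Suc k) ^ 3 / s ^ 2 - x ^ Suc k / of_nat (Suc k) / 12
     = x ^ Suc k / of_nat (Suc k) * (1 / (of_nat (Suc k) * s) ^ 2 - 1 / 12)" for k
    using s0 by (simp add: field_simps power2_eq_square power3_eq_cube del: of_nat_Suc power_Suc)
  moreover have "Li3 x / s ^ 2 = L 1 x ^ 3 / (2 * s ^ 2)"
    using L_cubed[of 1 x] by simp
  ultimately show "(\<lambda>k. x ^ Suc k / of_nat (Suc k) * (1 / (of_nat (Suc k) * s) ^ 2 - 1 / 12)) sums (L 1 x ^ 3 / (2 * s ^ 2) + Ln (1 - x) / 12)"
    by simp
qed simp

text \<open>For even \<open>k\<close> the power of the root is 1, which gives a double pole and the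
  constant -1/12; for odd \<open>k\<close> there is only the constant -1/4. The even part of the
  logarithm series is \<open>- Ln (1 - x ^ 2) / 2\<close>, the odd part is the rest.\<close>

lemma expansion_at_minus_1:
  assumes r: "r < 1" and x: "norm x \<le> r" and s: "s \<in> cone M"
  shows "norm (log_gf x (- 1 * exp (- s)) - (L 2 x ^ 3 / (2 * s ^ 2) + (Ln (1 - x ^ 2) / 24 + (2 * Ln (1 - x) - Ln (1 - x ^ 2)) / 8)))
    \<le> (4 * M ^ 2 + 3) * (r / (1 - r)) * norm s"
proof (rule log_gf_expansion_error[OF r x s, where m = "\<lambda>k. if even (Suc k) then 1 / (of_nat (Suc k) * s) ^ 2 - 1 / 12 else - 1 / 4"])
  show "norm (kernel ((- 1) ^ Suc k) (of_nat (Suc k) * s) - (if even (Suc k) then 1 / (of_nat (Suc k) * s) ^ 2 - 1 / 12 else - 1 / 4))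
      \<le> (4 * M ^ 2 + 3) * norm (of_nat (Suc k) * s)" for k
    using kernel_cone[of "of_nat (Suc k) * s" M] cone_mult_nat[OF s, of k]
    by (cases "even (Suc k)") (simp_all add: cone_def algebra_simps minus_one_power_iff del: of_nat_Suc power_Suc)
  have x1: "norm x < 1" using x r by simp
  have s0: "s \<noteq> 0" using s by (auto simp: cone_def)
  let ?e = "\<lambda>k. if even (Suc k) then x ^ Suc k / of_nat (Suc k) else 0"
  have "(\<lambda>k. (if 2 dvd Suc k then x ^ Suc k / of_nat (Suc k) ^ 3 else 0) / s ^ 2 - ?e k / 12 - (x ^ Suc k / of_nat (Suc k) - ?e k) / 4)
     sums ((Li3 (x ^ 2) / of_nat 2 ^ 3) / s ^ 2 - (- Ln (1 - x ^ 2) / 2) / 12 - (- Ln (1 - x) - (- Ln (1 - x ^ 2) / 2)) / 4)"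
    by (intro sums_diff sums_divide Ln_one_minus_sums[OF x1] Ln_one_minus_sums_even[OF x1] Li3_sums_multiples[OF x1]) simp
  moreover have "(if 2 dvd Suc k then x ^ Suc k / of_nat (Suc k) ^ 3 else 0) / s ^ 2 - ?e k / 12 - (x ^ Suc k / of_nat (Suc k) - ?e k) / 4
     = x ^ Suc k / of_nat (Suc k) * (if even (Suc k) then 1 / (of_nat (Suc k) * s) ^ 2 - 1 / 12 else - 1 / 4)" for k
    using s0 by (cases "even (Suc k)") (simp_all add: field_simps power2_eq_square power3_eq_cube del: of_nat_Suc power_Suc)
  moreover have "(Li3 (x ^ 2) / of_nat 2 ^ 3) / s ^ 2 - (- Ln (1 - x ^ 2) / 2) / 12 - (- Ln (1 - x) - (- Ln (1 - x ^ 2) / 2)) / 4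
     = L 2 x ^ 3 / (2 * s ^ 2) + (Ln (1 - x ^ 2) / 24 + (2 * Ln (1 - x) - Ln (1 - x ^ 2)) / 8)"
    unfolding L_cubed using s0 by (simp add: field_simps)
  ultimately show "(\<lambda>k. x ^ Suc k / of_nat (Suc k) * (if even (Suc k) then 1 / (of_nat (Suc k) * s) ^ 2 - 1 / 12 else - 1 / 4)) sums
     (L 2 x ^ 3 / (2 * s ^ 2) + (Ln (1 - x ^ 2) / 24 + (2 * Ln (1 - x) - Ln (1 - x ^ 2)) / 8))"
    by (simp only:)
qed simp

text \<open>Both \<open>1 - x\<close> and \<open>1 + x\<close> lie in the right half plane, so sums
  and differences of their logarithms stay in the principal strip.\<close>

lemma Ln_quotient:
  assumes "norm x < 1"
  shows "2 * Ln (1 - x) - Ln (1 - x ^ 2) = Ln ((1 - x) / (1 + x))"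
proof -
  have re: "Re (1 - x) > 0" "Re (1 + x) > 0"
    using assms abs_Re_le_cmod[of x] by auto
  have nz: "1 - x \<noteq> 0" "1 + x \<noteq> 0" using re by (metis less_irrefl zero_complex.sel(1))+
  have im: "\<bar>Im (Ln (1 - x))\<bar> < pi / 2" "\<bar>Im (Ln (1 + x))\<bar> < pi / 2"
    using Re_Ln_pos_lt[OF nz(1)] Re_Ln_pos_lt[OF nz(2)] re by auto
  have "Ln ((1 - x) * (1 + x)) = Ln (1 - x) + Ln (1 + x)"
    using im nz by (intro Ln_times_simple) auto
  moreover have "(1 - x) * (1 + x) = 1 - x ^ 2" by (simp add: power2_eq_square algebra_simps)
  moreover have "Ln ((1 - x) / (1 + x)) = Ln (1 - x) - Ln (1 + x)"
  proof (rule Ln_unique)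
    show "exp (Ln (1 - x) - Ln (1 + x)) = (1 - x) / (1 + x)" using nz by (simp add: exp_diff)
  qed (use im in auto)
  ultimately show ?thesis by simp
qed

section \<open>Minor arcs\<close>

text \<open>On a vertical line, \<open>Re (c\<^sup>3 / \<sigma>\<^sup>2)\<close> is maximal at height \<open>Im \<sigma> / Re \<sigma> = Im c / Re c\<close>
  as soon as \<open>\<bar>Arg c\<bar> \<le> pi / 3\<close>, which is what the principal cube root guarantees.\<close>

lemma saddle_identity:
  assumes "Re c > 0" "Re \<sigma> > 0"
  defines "p \<equiv> Im c / Re c" and "y \<equiv> Im \<sigma> / Re \<sigma>"
  shows "Re (c ^ 3 / \<sigma> ^ 2) = Re c ^ 3 / Re \<sigma> ^ 2 * (1 - (y - p) ^ 2 * (3 - p ^ 2 + (y + p) ^ 2) / (1 + y ^ 2) ^ 2)"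
proof -
  have c: "c = of_real (Re c) * Complex 1 p" using assms by (auto simp: complex_eq_iff p_def)
  have s: "\<sigma> = of_real (Re \<sigma>) * Complex 1 y" using assms by (auto simp: complex_eq_iff y_def)
  have nz: "1 + y ^ 2 \<noteq> 0" "(1 + y ^ 2) ^ 2 \<noteq> 0" by (auto simp: add_nonneg_eq_0_iff)
  have "Re (Complex 1 p ^ 3 / Complex 1 y ^ 2) = (1 - (y - p) ^ 2 * (3 - p ^ 2 + (y + p) ^ 2) / (1 + y ^ 2) ^ 2)"
  proof -
    have "Complex 1 p ^ 3 / Complex 1 y ^ 2 = Complex 1 p ^ 3 * Complex 1 (- y) ^ 2 / of_real ((1 + y ^ 2) ^ 2)"
    proof -
      have "Complex 1 y * Complex 1 (- y) = of_real (1 + y ^ 2)"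
        by (simp add: complex_eq_iff power2_eq_square)
      hence eq: "Complex 1 y ^ 2 * Complex 1 (- y) ^ 2 = of_real ((1 + y ^ 2) ^ 2)"
        by (metis of_real_power power_mult_distrib)
      have "Complex 1 y \<noteq> 0" "Complex 1 (- y) \<noteq> 0" by (auto simp: complex_eq_iff)
      thus ?thesis unfolding eq[symmetric] by simp
    qed
    also have "Re \<dots> = Re (Complex 1 p ^ 3 * Complex 1 (- y) ^ 2) / (1 + y ^ 2) ^ 2"
      by (rule Re_divide_of_real)
    also have "Re (Complex 1 p ^ 3 * Complex 1 (- y) ^ 2) = (1 + y ^ 2) ^ 2 - (y - p) ^ 2 * (3 - p ^ 2 + (y + p) ^ 2)"
      by (simp add: power2_eq_square power3_eq_cube algebra_simps)
    also have "\<dots> / (1 + y ^ 2) ^ 2 = 1 - (y - p) ^ 2 * (3 - p ^ 2 + (y + p) ^ 2) / (1 + y ^ 2) ^ 2"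
      using nz by (simp add: diff_divide_distrib)
    finally show ?thesis .
  qed
  moreover have "c ^ 3 / \<sigma> ^ 2 = of_real (Re c ^ 3 / Re \<sigma> ^ 2) * (Complex 1 p ^ 3 / Complex 1 y ^ 2)"
    by (subst c, subst s) (simp add: power_mult_distrib)
  ultimately show ?thesis
    by (simp only: times_complex.sel Re_complex_of_real Im_complex_of_real)
qed

text \<open>With \<open>p\<close> at most the square root of 3 in absolute value, the term
  subtracted in \<open>saddle_identity\<close> is nonnegative; if \<open>Re c\<close> vanishes, the
  sector condition forces \<open>c = 0\<close>.\<close>

lemma saddle_le:
  assumes "Re c \<ge> 0" "Im c ^ 2 \<le> 3 * Re c ^ 2" "Re \<sigma> > 0"
  shows "Re (c ^ 3 / \<sigma> ^ 2) \<le> Re c ^ 3 / Re \<sigma> ^ 2"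
proof (cases "Re c = 0")
  case True
  hence "c = 0" using assms by (simp add: complex_eq_iff)
  thus ?thesis by simp
next
  case False
  define p where "p = Im c / Re c"
  define y where "y = Im \<sigma> / Re \<sigma>"
  have "p ^ 2 \<le> 3" using assms False by (simp add: p_def power_divide divide_le_eq)
  hence "0 \<le> (y - p) ^ 2 * (3 - p ^ 2 + (y + p) ^ 2) / (1 + y ^ 2) ^ 2" by simp
  hence "Re c ^ 3 / Re \<sigma> ^ 2 * (1 - (y - p) ^ 2 * (3 - p ^ 2 + (y + p) ^ 2) / (1 + y ^ 2) ^ 2) \<le> Re c ^ 3 / Re \<sigma> ^ 2 * 1"
    using assms by (intro mult_left_mono) auto
  thus ?thesis using saddle_identity[of c \<sigma>] assms False by (simp add: p_def y_def)
qed

lemma saddle_gap: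
  assumes "Re c > 0" "Im c ^ 2 < 3 * Re c ^ 2" "\<eta> > 0"
  shows "\<exists>\<delta>>0. \<forall>\<sigma>. Re \<sigma> > 0 \<longrightarrow> \<bar>Im \<sigma> / Re \<sigma> - Im c / Re c\<bar> \<ge> \<eta> \<longrightarrow>
           Re (c ^ 3 / \<sigma> ^ 2) \<le> (1 - \<delta>) * (Re c ^ 3 / Re \<sigma> ^ 2)"
proof -
  define p where "p = Im c / Re c"
  have p: "p ^ 2 < 3" using assms by (simp add: p_def power_divide divide_less_eq)
  have p2: "\<bar>p\<bar> \<le> 2" using p abs_le_square_iff[of p 2] by simp
  \<comment> \<open>The denominator 289 is \<open>17 ^ 2\<close>, from \<open>y ^ 2\<close> at most
    16. For larger \<open>y\<close>, both \<open>y - p\<close> and \<open>y + p\<close> have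
    absolute value at least \<open>\<bar>y\<bar> / 2\<close> and \<open>1 + y ^ 2\<close> is at most
    \<open>2 * y ^ 2\<close>, which gives 1/64.\<close>
  define \<delta> where "\<delta> = min (\<eta> ^ 2 * (3 - p ^ 2) / 289) (1 / 64)"
  have "\<delta> > 0" using p assms by (simp add: \<delta>_def)
  moreover have "Re (c ^ 3 / \<sigma> ^ 2) \<le> (1 - \<delta>) * (Re c ^ 3 / Re \<sigma> ^ 2)"
    if \<sigma>: "Re \<sigma> > 0" "\<bar>Im \<sigma> / Re \<sigma> - Im c / Re c\<bar> \<ge> \<eta>" for \<sigma>
  proof -
    define y where "y = Im \<sigma> / Re \<sigma>"
    have y: "\<bar>y - p\<bar> \<ge> \<eta>" using \<sigma> by (simp add: y_def p_def)
    have "\<delta> \<le> (y - p) ^ 2 * (3 - p ^ 2 + (y + p) ^ 2) / (1 + y ^ 2) ^ 2"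
    proof (cases "\<bar>y\<bar> \<le> 4")
      case True
      have "\<eta> ^ 2 \<le> (y - p) ^ 2" using y assms(3) by (metis abs_le_square_iff abs_of_pos)
      moreover have "y ^ 2 \<le> 16" using True abs_le_square_iff[of y 4] by simp
      hence "(1 + y ^ 2) ^ 2 \<le> 17 ^ 2" by (intro power_mono) auto
      moreover have "0 < (1 + y ^ 2) ^ 2" by (intro zero_less_power add_pos_nonneg) auto
      ultimately have "\<eta> ^ 2 * (3 - p ^ 2) / 289 \<le> (y - p) ^ 2 * (3 - p ^ 2 + (y + p) ^ 2) / (1 + y ^ 2) ^ 2"
        using p by (intro frac_le mult_mono) auto
      thus ?thesis unfolding \<delta>_def by (rule min.coboundedI1)
    next
      case False
      have a: "\<bar>y\<bar> / 2 \<le> \<bar>y - p\<bar>" "\<bar>y\<bar> / 2 \<le> \<bar>y + p\<bar>" using False p2 by linarith+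
      have a2: "y ^ 2 / 4 \<le> (y - p) ^ 2" "y ^ 2 / 4 \<le> (y + p) ^ 2"
        using power_mono[OF a(1), of 2] power_mono[OF a(2), of 2] by (auto simp: power_divide)
      have "(y ^ 2 / 4) * (y ^ 2 / 4) \<le> (y - p) ^ 2 * (3 - p ^ 2 + (y + p) ^ 2)"
        using a2 p by (intro mult_mono) auto
      moreover have "1 \<le> y ^ 2" using False abs_le_square_iff[of 1 y] by simp
      hence "(1 + y ^ 2) ^ 2 \<le> (2 * y ^ 2) ^ 2" by (intro power_mono) auto
      moreover have "0 < (1 + y ^ 2) ^ 2" by (intro zero_less_power add_pos_nonneg) auto
      ultimately have "(y ^ 2 / 4) * (y ^ 2 / 4) / (2 * y ^ 2) ^ 2 \<le> (y - p) ^ 2 * (3 - p ^ 2 + (y + p) ^ 2) / (1 + y ^ 2) ^ 2"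
        using p by (intro frac_le) auto
      moreover have "(y ^ 2 / 4) * (y ^ 2 / 4) / (2 * y ^ 2) ^ 2 = 1 / 64"
        using False by (simp add: power2_eq_square)
      ultimately show ?thesis unfolding \<delta>_def by (intro min.coboundedI2) (simp only:)
    qed
    hence "Re c ^ 3 / Re \<sigma> ^ 2 * (1 - (y - p) ^ 2 * (3 - p ^ 2 + (y + p) ^ 2) / (1 + y ^ 2) ^ 2) \<le> Re c ^ 3 / Re \<sigma> ^ 2 * (1 - \<delta>)"
      using assms by (intro mult_left_mono) auto
    thus ?thesis using saddle_identity[of c \<sigma>] assms \<sigma> by (simp add: p_def y_def mult.commute)
  qed
  ultimately show ?thesis by blast
qed

section \<open>Limits of the exponent and the minor arc bound\<close>

text \<open>Recentres a term at the limiting angle \<open>v\<close>: a multiple of the base point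
  turns into a small argument whenever the rotated root has \<open>K\<close>-th power 1.\<close>

lemma kernel_rotate: "kernel (\<epsilon> ^ K) (of_nat K * s) = kernel ((\<epsilon> * exp (- (\<i> * v))) ^ K) (of_nat K * (s - \<i> * v))"
proof -
  have "(\<epsilon> * exp (- (\<i> * v))) ^ K * exp (- (of_nat K * (s - \<i> * v))) = \<epsilon> ^ K * exp (- (of_nat K * s))"
    by (simp add: power_mult_distrib exp_of_nat_mult[symmetric] mult.assoc exp_add[symmetric] algebra_simps)
  thus ?thesis by (simp add: kernel_def)
qed

text \<open>Without its pole the kernel stays bounded near 0, so the growing normalisation removes
  it.\<close>

lemma kernel_1_scaled_tendsto:
  assumes z: "(z \<longlongrightarrow> 0) F" "eventually (\<lambda>j. z j \<noteq> 0) F" and N: "filterlim N at_top F"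
  shows "((\<lambda>j. (kernel 1 (z j) - 1 / z j ^ 2) / of_real (N j ^ 2 :: real)) \<longlongrightarrow> 0) F"
proof (rule Lim_null_comparison)
  have "eventually (\<lambda>j. norm (z j) < 1) F"
    using tendstoD[OF z(1), of 1] by simp
  thus "eventually (\<lambda>j. norm ((kernel 1 (z j) - 1 / z j ^ 2) / of_real (N j ^ 2)) \<le> 2 / N j ^ 2) F"
    using z(2)
  proof eventually_elim
    case (elim j)
    have "norm (kernel 1 (z j) - 1 / z j ^ 2) \<le> norm (kernel 1 (z j) - 1 / z j ^ 2 + 1 / 12) + norm (1 / 12 :: complex)"
      using norm_triangle_ineq4[of "kernel 1 (z j) - 1 / z j ^ 2 + 1 / 12" "1 / 12"] by simp
    also have "\<dots> \<le> 1 + 1 / 12" using kernel_1_near_0[of "z j"] elim by simp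
    finally have "norm (kernel 1 (z j) - 1 / z j ^ 2) \<le> 2" by simp
    thus ?case by (simp add: norm_divide norm_power divide_right_mono)
  qed
  have "filterlim (\<lambda>j. N j ^ 2) at_top F"
    by (rule filterlim_pow_at_top[OF _ N]) simp
  thus "((\<lambda>j. 2 / N j ^ 2) \<longlongrightarrow> 0) F"
    by (intro tendsto_divide_0[OF tendsto_const] filterlim_at_top_imp_at_infinity)
qed

lemma power_eq_1_iff_dvd:
  fixes w :: complex
  assumes "m > 0" "w ^ m = 1"
  shows "\<exists>q>0. w ^ q = 1 \<and> (\<forall>j. 0 < j \<longrightarrow> j < q \<longrightarrow> w ^ j \<noteq> 1) \<and> (\<forall>k. w ^ k = 1 \<longleftrightarrow> q dvd k)"
proof -
  define q where "q = (LEAST q. q > 0 \<and> w ^ q = 1)"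
  have q: "q > 0 \<and> w ^ q = 1" unfolding q_def by (rule LeastI[of _ m]) (use assms in auto)
  have min: "w ^ j \<noteq> 1" if "0 < j" "j < q" for j
    using not_less_Least[of j "\<lambda>q. q > 0 \<and> w ^ q = 1"] that by (auto simp: q_def)
  have "w ^ k = 1 \<longleftrightarrow> q dvd k" for k
  proof
    assume "w ^ k = 1"
    moreover have "w ^ k = (w ^ q) ^ (k div q) * w ^ (k mod q)"
      by (simp add: power_mult[symmetric] power_add[symmetric])
    ultimately have "w ^ (k mod q) = 1" using q by simp
    moreover have "k mod q < q" using q by simp
    ultimately have "k mod q = 0" using min[of "k mod q"] by blast
    thus "q dvd k" by auto
  next
    assume "q dvd k"
    thus "w ^ k = 1" using q by (auto simp: power_mult)
  qed
  thus ?thesis using q min by blast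
qed

lemma major_terms_sum:
  fixes w \<sigma> :: complex
  assumes "norm x < 1"
  defines "A \<equiv> (\<lambda>k. if w ^ Suc k = 1 then x ^ Suc k / of_nat (Suc k) ^ 3 / \<sigma> ^ 2 else 0)"
  shows "(\<And>k. k > 0 \<Longrightarrow> w ^ k \<noteq> 1) \<Longrightarrow> (\<Sum>k. A k) = 0"
    and "q > 0 \<Longrightarrow> (\<And>k. w ^ k = 1 \<longleftrightarrow> q dvd k) \<Longrightarrow> (\<Sum>k. A k) = L q x ^ 3 / (2 * \<sigma> ^ 2)"
proof -
  assume "\<And>k. k > 0 \<Longrightarrow> w ^ k \<noteq> 1"
  hence "A = (\<lambda>_. 0)" unfolding A_def using zero_less_Suc by presburger
  thus "(\<Sum>k. A k) = 0" by simp
next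
  assume q: "q > 0" "\<And>k. w ^ k = 1 \<longleftrightarrow> q dvd k"
  have "A = (\<lambda>k. (if q dvd Suc k then x ^ Suc k / of_nat (Suc k) ^ 3 else 0) / \<sigma> ^ 2)"
    unfolding A_def q(2) by auto
  hence "A sums (Li3 (x ^ q) / of_nat q ^ 3 / \<sigma> ^ 2)"
    using sums_divide[OF Li3_sums_multiples[OF assms(1) q(1)]] by simp
  thus "(\<Sum>k. A k) = L q x ^ 3 / (2 * \<sigma> ^ 2)"
    by (simp add: sums_iff L_cubed)
qed

text \<open>Along a sequence of points approaching the root of unity (or the irrational angle) \<open>w\<close>,
  only the terms with \<open>w ^ k = 1\<close> survive, and they add up to the polar part of order two.\<close>

lemma log_gf_limit:
  fixes xs :: "nat \<Rightarrow> complex" and vs as Ns :: "nat \<Rightarrow> real"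
  assumes r1: "r < 1" and xs: "\<And>j. norm (xs j) \<le> r"
    and as: "as \<longlonglongrightarrow> a" "a > 0" and vs: "vs \<longlonglongrightarrow> v" and Ns: "filterlim Ns at_top sequentially"
    and eps: "norm \<epsilon> = 1"
  defines "w \<equiv> \<epsilon> * exp (- (\<i> * of_real v))"
  defines "\<sigma> \<equiv> (\<lambda>j. of_real (as j) + \<i> * of_real (Ns j * (vs j - v)))"
  shows "(\<lambda>j. log_gf (xs j) (\<epsilon> * exp (- (of_real (as j / Ns j) + \<i> * of_real (vs j)))) / of_real (Ns j ^ 2)
     - (\<Sum>k. if w ^ Suc k = 1 then xs j ^ Suc k / of_nat (Suc k) ^ 3 / \<sigma> j ^ 2 else 0)) \<longlonglongrightarrow> 0"
proof -
  note r = order_trans[OF norm_ge_zero xs[of 0]] r1 xs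
  define s where "s = (\<lambda>j. of_real (as j / Ns j) + \<i> * of_real (vs j) :: complex)"
  define s' where "s' = (\<lambda>j. s j - \<i> * of_real v)"
  define T where "T = (\<lambda>k j. xs j ^ Suc k / of_nat (Suc k) * kernel (\<epsilon> ^ Suc k) (of_nat (Suc k) * s j) / of_real (Ns j ^ 2))"
  define A where "A = (\<lambda>k j. if w ^ Suc k = 1 then xs j ^ Suc k / of_nat (Suc k) ^ 3 / \<sigma> j ^ 2 else 0)"
  have ev: "eventually (\<lambda>j. as j > a / 2) sequentially" "eventually (\<lambda>j. Ns j > 0) sequentially"
    using order_tendstoD(1)[OF as(1), of "a / 2"] as(2) Ns by (auto simp: filterlim_at_top_dense)
  have \<sigma>_eq: "\<sigma> j = of_real (Ns j) * s' j" if "Ns j > 0" for j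
    using that by (simp add: \<sigma>_def s'_def s_def algebra_simps)
  have Re_s: "Re (s j) = as j / Ns j" "Re (s' j) = as j / Ns j" for j
    by (auto simp: s_def s'_def)
  have tau0: "(\<lambda>j. as j / Ns j) \<longlonglongrightarrow> 0"
    by (rule tendsto_divide_0[OF as(1)]) (use Ns filterlim_at_top_imp_at_infinity in blast)
  have s_lim: "s \<longlonglongrightarrow> \<i> * of_real v"
  proof -
    have "s \<longlonglongrightarrow> of_real 0 + \<i> * of_real v"
      unfolding s_def by (intro tendsto_intros tau0 vs)
    thus ?thesis by simp
  qed
  have s'_lim: "s' \<longlonglongrightarrow> 0"
    unfolding s'_def using tendsto_diff[OF s_lim tendsto_const[of "\<i> * of_real v"]] by simp
  have xr: "norm (xs j ^ Suc k / of_nat (Suc k)) \<le> r ^ Suc k" for j k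
  proof -
    have "norm (xs j ^ Suc k / of_nat (Suc k)) \<le> r ^ Suc k / 1"
      unfolding norm_divide norm_power norm_of_nat using r by (intro frac_le power_mono) auto
    thus ?thesis by simp
  qed
  have "(\<lambda>j. T k j - A k j) \<longlonglongrightarrow> 0" for k
  proof (cases "w ^ Suc k = 1")
    \<comment> \<open>For these indices the argument shrinks to 0, and only the double pole survives
      division by \<open>Ns j ^ 2\<close>.\<close>
    case True
    have "(\<lambda>j. r ^ Suc k * norm ((kernel 1 (of_nat (Suc k) * s' j) - 1 / (of_nat (Suc k) * s' j) ^ 2) / of_real (Ns j ^ 2))) \<longlonglongrightarrow> 0"
    proof (rule tendsto_mult_right_zero, rule tendsto_norm_zero, rule kernel_1_scaled_tendsto[OF _ _ Ns])
      show "(\<lambda>j. of_nat (Suc k) * s' j) \<longlonglongrightarrow> 0" by (intro tendsto_mult_right_zero s'_lim)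
      show "eventually (\<lambda>j. of_nat (Suc k) * s' j \<noteq> 0) sequentially"
        using ev
      proof eventually_elim
        case (elim j)
        hence "Re (s' j) > 0" using as(2) Re_s by simp
        hence "s' j \<noteq> 0" by auto
        thus ?case by (simp del: of_nat_Suc)
      qed
    qed
    thus ?thesis
    proof (rule Lim_null_comparison[rotated])
      show "eventually (\<lambda>j. norm (T k j - A k j) \<le> r ^ Suc k * norm ((kernel 1 (of_nat (Suc k) * s' j) - 1 / (of_nat (Suc k) * s' j) ^ 2) / of_real (Ns j ^ 2))) sequentially"
        using ev
      proof eventually_elim
        case (elim j)
        have "kernel (\<epsilon> ^ Suc k) (of_nat (Suc k) * s j) = kernel 1 (of_nat (Suc k) * s' j)"
          using kernel_rotate[of \<epsilon> "Suc k" "s j" "of_real v"] True by (simp only: w_def s'_def)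
        moreover have "A k j = xs j ^ Suc k / of_nat (Suc k) * (1 / (of_nat (Suc k) * s' j) ^ 2 / of_real (Ns j ^ 2))"
          using True \<sigma>_eq[OF elim(2)] by (simp add: A_def power_mult_distrib power2_eq_square power3_eq_cube mult_ac del: of_nat_Suc power_Suc)
        ultimately have "T k j - A k j = xs j ^ Suc k / of_nat (Suc k) *
            ((kernel 1 (of_nat (Suc k) * s' j) - 1 / (of_nat (Suc k) * s' j) ^ 2) / of_real (Ns j ^ 2))"
          by (simp add: T_def diff_divide_distrib right_diff_distrib del: of_nat_Suc power_Suc of_real_power)
        thus ?case by (simp only: norm_mult) (intro mult_right_mono xr, simp)
      qed
    qed
  next
    \<comment> \<open>Here the kernel converges to a finite value, so the normalised term vanishes
      in the limit.\<close>
    case False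
    have "(\<lambda>j. \<epsilon> ^ Suc k * exp (- (of_nat (Suc k) * s j))) \<longlonglongrightarrow> \<epsilon> ^ Suc k * exp (- (of_nat (Suc k) * (\<i> * of_real v)))"
      by (intro tendsto_intros s_lim)
    also have "\<epsilon> ^ Suc k * exp (- (of_nat (Suc k) * (\<i> * of_real v))) = w ^ Suc k"
      unfolding w_def power_mult_distrib exp_of_nat_mult[symmetric] by (simp only: mult_minus_right)
    finally have y: "(\<lambda>j. \<epsilon> ^ Suc k * exp (- (of_nat (Suc k) * s j))) \<longlonglongrightarrow> w ^ Suc k" .
    have ker: "(\<lambda>j. kernel (\<epsilon> ^ Suc k) (of_nat (Suc k) * s j)) \<longlonglongrightarrow> w ^ Suc k / (1 - w ^ Suc k) ^ 2"
      unfolding kernel_def using False by (intro tendsto_divide tendsto_power tendsto_diff tendsto_const y) simp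
    have "filterlim (\<lambda>j. Ns j ^ 2) at_top sequentially"
      by (rule filterlim_pow_at_top[OF _ Ns]) simp
    hence "filterlim (\<lambda>j. complex_of_real (Ns j ^ 2)) at_infinity sequentially"
      using filterlim_at_top_imp_at_infinity tendsto_of_real_iff by (metis filterlim_compose filterlim_of_real_at_infinity)
    hence "(\<lambda>j. kernel (\<epsilon> ^ Suc k) (of_nat (Suc k) * s j) / of_real (Ns j ^ 2)) \<longlonglongrightarrow> 0"
      by (rule tendsto_divide_0[OF ker])
    hence "(\<lambda>j. r ^ Suc k * norm (kernel (\<epsilon> ^ Suc k) (of_nat (Suc k) * s j) / of_real (Ns j ^ 2))) \<longlonglongrightarrow> 0"
      by (intro tendsto_mult_right_zero tendsto_norm_zero)
    thus ?thesis
    proof (rule Lim_null_comparison[rotated], intro always_eventually allI)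
      fix j
      have "T k j - A k j = xs j ^ Suc k / of_nat (Suc k) * (kernel (\<epsilon> ^ Suc k) (of_nat (Suc k) * s j) / of_real (Ns j ^ 2))"
        unfolding T_def A_def using False by (simp only: if_False times_divide_eq_right diff_0_right)
      thus "norm (T k j - A k j) \<le> r ^ Suc k * norm (kernel (\<epsilon> ^ Suc k) (of_nat (Suc k) * s j) / of_real (Ns j ^ 2))"
        by (simp only: norm_mult) (intro mult_right_mono xr, simp)
    qed
  qed
  note lim = this
  \<comment> \<open>The majorant for Tannery's theorem: once \<open>as j\<close> exceeds
    \<open>a / 2\<close>, the real part of \<open>s j\<close> exceeds \<open>a / (2 * Ns j)\<close>,
    and \<open>kernel_bound\<close> gives 16 over \<open>a ^ 2\<close> after normalisation.\<close>
  have bnd: "norm (T k j) \<le> r ^ Suc k * (16 / a ^ 2)" "norm (A k j) \<le> r ^ Suc k * (16 / a ^ 2)"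
    if j: "as j > a / 2" "Ns j > 0" for k j
  proof -
    have aj: "as j > 0" using j as by simp
    have K: "Re (of_nat (Suc k) * s j) = real (Suc k) * (as j / Ns j)"
      by (simp add: Re_s del: of_nat_Suc)
    have "norm (kernel (\<epsilon> ^ Suc k) (of_nat (Suc k) * s j)) \<le> 4 / (real (Suc k) * (as j / Ns j)) ^ 2"
      using kernel_bound[of "\<epsilon> ^ Suc k" "of_nat (Suc k) * s j"] K aj j eps
      by (simp add: norm_mult norm_power del: of_nat_Suc)
    also have "\<dots> \<le> 4 / (1 * ((a / 2) / Ns j)) ^ 2"
      using j as by (intro divide_left_mono power_mono mult_mono divide_right_mono mult_pos_pos zero_less_power divide_pos_pos) auto
    also have "\<dots> = 16 / a ^ 2 * Ns j ^ 2" using as j by (simp add: power_divide)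
    finally have "norm (kernel (\<epsilon> ^ Suc k) (of_nat (Suc k) * s j)) / Ns j ^ 2 \<le> 16 / a ^ 2"
      using j by (simp add: divide_le_eq)
    hence "norm (xs j ^ Suc k / of_nat (Suc k)) * (norm (kernel (\<epsilon> ^ Suc k) (of_nat (Suc k) * s j)) / Ns j ^ 2) \<le> r ^ Suc k * (16 / a ^ 2)"
      using r by (intro mult_mono xr) auto
    thus "norm (T k j) \<le> r ^ Suc k * (16 / a ^ 2)"
      unfolding T_def norm_mult norm_divide[of _ "of_real (Ns j ^ 2)"] by (simp add: norm_power del: power_Suc of_nat_Suc)
    have "a / 2 \<le> norm (\<sigma> j)"
      using j complex_Re_le_cmod[of "\<sigma> j"] by (simp add: \<sigma>_def)
    hence "(a / 2) ^ 2 \<le> norm (\<sigma> j) ^ 2" using as by (intro power_mono) auto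
    hence "1 / norm (\<sigma> j) ^ 2 \<le> 1 / (a / 2) ^ 2" using as by (intro divide_left_mono mult_pos_pos) (auto intro!: zero_less_power order_less_le_trans[of 0 "(a/2)^2"])
    also have "\<dots> \<le> 16 / a ^ 2" using as by (simp add: power_divide divide_right_mono)
    finally have *: "1 / norm (\<sigma> j) ^ 2 \<le> 16 / a ^ 2" .
    have "norm (xs j ^ Suc k / of_nat (Suc k) ^ 3) \<le> r ^ Suc k"
    proof -
      have "norm (xs j ^ Suc k / of_nat (Suc k) ^ 3) \<le> r ^ Suc k / 1"
        unfolding norm_divide norm_power norm_of_nat using r by (intro frac_le power_mono) (auto simp: one_le_power)
      thus ?thesis by simp
    qed
    hence "norm (xs j ^ Suc k / of_nat (Suc k) ^ 3) * (1 / norm (\<sigma> j) ^ 2) \<le> r ^ Suc k * (16 / a ^ 2)"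
      using * r by (intro mult_mono) auto
    moreover have "norm (A k j) \<le> norm (xs j ^ Suc k / of_nat (Suc k) ^ 3) * (1 / norm (\<sigma> j) ^ 2)"
      by (simp add: A_def norm_divide norm_mult norm_power del: power_Suc of_nat_Suc)
    ultimately show "norm (A k j) \<le> r ^ Suc k * (16 / a ^ 2)" by linarith
  qed
  have sm: "summable (\<lambda>k. r ^ Suc k * c)" for c
    using r by (intro summable_mult2 summable_Suc_iff[THEN iffD2] summable_geometric) auto
  have "(\<lambda>j. \<Sum>k. T k j - A k j) \<longlonglongrightarrow> (\<Sum>k. 0)"
  proof (rule tannerys_theorem[THEN conjunct2, THEN conjunct2])
    show "(\<lambda>j. T k j - A k j) \<longlonglongrightarrow> 0" for k by (rule lim)
    show "summable (\<lambda>k. r ^ Suc k * (32 / a ^ 2))" by (rule sm)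
    have "eventually (\<lambda>j. as j > a / 2 \<and> Ns j > 0) sequentially" using ev by (rule eventually_conj)
    hence "eventually (\<lambda>(k, j). as j > a / 2 \<and> Ns j > 0) (sequentially \<times>\<^sub>F sequentially)"
      by (rule eventually_prod2[THEN iffD2, rotated]) simp
    thus "eventually (\<lambda>(k, j). norm (T k j - A k j) \<le> r ^ Suc k * (32 / a ^ 2)) (sequentially \<times>\<^sub>F sequentially)"
    proof (rule eventually_mono, clarify)
      fix k j assume "as j > a / 2" "Ns j > 0"
      thus "norm (T k j - A k j) \<le> r ^ Suc k * (32 / a ^ 2)"
        using bnd(1)[of j k] bnd(2)[of j k] norm_triangle_ineq4[of "T k j" "A k j"] by (simp add: mult.commute[of "r ^ Suc k"] del: power_Suc)
    qed
  qed simp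
  hence "(\<lambda>j. \<Sum>k. T k j - A k j) \<longlonglongrightarrow> 0" by simp
  moreover have "eventually (\<lambda>j. (\<Sum>k. T k j - A k j) = log_gf (xs j) (\<epsilon> * exp (- s j)) / of_real (Ns j ^ 2) - (\<Sum>k. A k j)) sequentially"
    using ev
  proof eventually_elim
    case (elim j)
    have "norm (xs j) < 1" using r(2) r(3)[of j] by linarith
    moreover have "Re (s j) > 0" using elim as Re_s by simp
    ultimately have "(\<lambda>k. T k j) sums (log_gf (xs j) (\<epsilon> * exp (- s j)) / of_real (Ns j ^ 2))"
      unfolding T_def using eps by (intro sums_divide log_gf_kernel_sums)
    moreover have "summable (\<lambda>k. A k j)"
      by (rule summable_comparison_test'[OF sm[of "16 / a ^ 2"]]) (use bnd(2)[OF elim] in auto)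
    ultimately show ?case by (simp add: suminf_diff[symmetric] sums_iff)
  qed
  ultimately show ?thesis
    unfolding s_def A_def using Lim_transform_eventually by fast
qed

lemma compact_norm_bound:
  assumes "compact X" "X \<noteq> {}" "\<And>x. x \<in> X \<Longrightarrow> norm x < (1::real)"
  obtains r where "r < 1" "\<And>x. x \<in> X \<Longrightarrow> norm x \<le> r"
proof -
  obtain y where "y \<in> X" "\<And>z. z \<in> X \<Longrightarrow> norm z \<le> norm y"
    using continuous_attains_sup[OF assms(1,2) continuous_on_norm_id] by auto
  thus ?thesis using that assms(3) by blast
qed

text \<open>By contradiction: violations with \<delta> tending to 0 and \<open>N\<close> to infinity
  have a subsequence whose points and angles converge. At the limiting angle either no term
  survives, or the polar part has an order \<open>q'\<close> other than \<open>q\<close> and is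
  dominated, or the angle is 0 and \<open>saddle_gap\<close> applies. Each case contradicts the
  limit \<open>Re (L q x) / 2\<close>.\<close>

lemma minor_arcs:
  assumes X: "compact X" "X \<noteq> {}" "\<And>x. x \<in> X \<Longrightarrow> norm x < 1"
    and cont: "continuous_on X (L q)" and q: "q > 0"
    and pos: "\<And>x. x \<in> X \<Longrightarrow> Re (L q x) > 0"
    and sector: "\<And>x. x \<in> X \<Longrightarrow> Im (L q x) ^ 2 < 3 * Re (L q x) ^ 2"
    and dom: "\<And>x k. x \<in> X \<Longrightarrow> k \<ge> 1 \<Longrightarrow> k \<noteq> q \<Longrightarrow> Re (L k x) < Re (L q x)"
    and eps: "norm \<epsilon> = 1"
    and root: "\<And>u. u ^ q = 1 \<Longrightarrow> (\<And>j. 0 < j \<Longrightarrow> j < q \<Longrightarrow> u ^ j \<noteq> 1) \<Longrightarrow> u = \<epsilon>"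
    and \<eta>: "\<eta> > 0"
  shows "\<exists>\<delta>>0. \<exists>N0. \<forall>N\<ge>N0. \<forall>x\<in>X. \<forall>v\<in>{-pi..pi}. \<bar>N * v - Im (L q x)\<bar> \<ge> \<eta> \<longrightarrow>
     Re (log_gf x (\<epsilon> * exp (- (of_real (Re (L q x) / N) + \<i> * of_real v)))) \<le> (Re (L q x) / 2 - \<delta>) * N ^ 2"
proof (rule ccontr)
  assume neg: "\<not> ?thesis"
  define bad where "bad = (\<lambda>\<delta> N x v. x \<in> X \<and> v \<in> {-pi..pi} \<and> \<bar>N * v - Im (L q x)\<bar> \<ge> \<eta> \<and>
     Re (log_gf x (\<epsilon> * exp (- (of_real (Re (L q x) / N) + \<i> * of_real v)))) > (Re (L q x) / 2 - \<delta>) * N ^ 2)"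
  have "\<exists>N x v. N \<ge> real (Suc j) \<and> bad (1 / real (Suc j)) N x v" for j
  proof -
    have "1 / real (Suc j) > 0" by simp
    hence "\<not> (\<exists>N0. \<forall>N\<ge>N0. \<forall>x\<in>X. \<forall>v\<in>{-pi..pi}. \<bar>N * v - Im (L q x)\<bar> \<ge> \<eta> \<longrightarrow>
     Re (log_gf x (\<epsilon> * exp (- (of_real (Re (L q x) / N) + \<i> * of_real v)))) \<le> (Re (L q x) / 2 - 1 / real (Suc j)) * N ^ 2)"
      using neg by blast
    thus ?thesis unfolding bad_def not_ex not_all not_le[symmetric] by (metis not_le)
  qed
  then obtain Ns0 xs0 vs0 where bad0: "\<And>j. Ns0 j \<ge> real (Suc j)" "\<And>j. bad (1 / real (Suc j)) (Ns0 j) (xs0 j) (vs0 j)"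
    by metis
  have "seq_compact (X \<times> {-pi..pi})"
    using X(1) by (intro compact_imp_seq_compact compact_Times) auto
  moreover have "\<forall>j. (xs0 j, vs0 j) \<in> X \<times> {-pi..pi}" using bad0(2) by (auto simp: bad_def)
  ultimately obtain l \<phi> where l: "l \<in> X \<times> {-pi..pi}" "strict_mono \<phi>" "((\<lambda>j. (xs0 j, vs0 j)) \<circ> \<phi>) \<longlonglongrightarrow> l"
    by (rule seq_compactE)
  obtain x v where xv: "l = (x, v)" by (cases l)
  have x: "x \<in> X" and v: "v \<in> {-pi..pi}" using l xv by auto
  define xs where "xs = xs0 \<circ> \<phi>"
  define vs where "vs = vs0 \<circ> \<phi>"
  define Ns where "Ns = Ns0 \<circ> \<phi>"
  define d where "d = (\<lambda>j. 1 / real (Suc (\<phi> j)))"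
  define cs where "cs = (\<lambda>j. L q (xs j))"
  define as where "as = (\<lambda>j. Re (cs j))"
  define c where "c = L q x"
  define a where "a = Re c"
  have xs: "xs \<longlonglongrightarrow> x" and vs: "vs \<longlonglongrightarrow> v"
    using tendsto_fst[OF l(3)] tendsto_snd[OF l(3)] by (auto simp: xs_def vs_def o_def xv)
  have xsX: "xs j \<in> X" for j using bad0(2) by (simp add: xs_def bad_def)
  have Ns_ge: "Ns j \<ge> real (Suc j)" for j
    using bad0(1)[of "\<phi> j"] seq_suble[OF l(2), of j] unfolding Ns_def o_def by linarith
  have Ns: "filterlim Ns at_top sequentially"
    by (rule filterlim_at_top_mono[of real]) (use Ns_ge in \<open>auto intro!: always_eventually filterlim_real_sequentially simp: order_trans[OF _ Ns_ge]\<close>)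
  have d: "d \<longlonglongrightarrow> 0"
  proof -
    have "((\<lambda>j. 1 / real (Suc j)) \<circ> \<phi>) \<longlonglongrightarrow> 0"
      by (rule LIMSEQ_subseq_LIMSEQ[OF _ l(2)]) real_asymp
    thus ?thesis by (simp add: d_def o_def)
  qed
  have cs: "cs \<longlonglongrightarrow> c"
    unfolding cs_def c_def using x xsX
    by (intro continuous_on_tendsto_compose[OF cont xs]) auto
  have as: "as \<longlonglongrightarrow> a" unfolding as_def a_def by (intro tendsto_intros cs)
  have a: "a > 0" using pos[OF x] by (simp add: a_def c_def)
  have as_pos: "as j > 0" for j using pos[OF xsX[of j]] by (simp add: as_def cs_def)
  define G where "G = (\<lambda>j. log_gf (xs j) (\<epsilon> * exp (- (of_real (as j / Ns j) + \<i> * of_real (vs j)))))"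
  have bad: "\<bar>Ns j * vs j - Im (cs j)\<bar> \<ge> \<eta>" "Re (G j) > (as j / 2 - d j) * Ns j ^ 2" for j
    using bad0(2)[of "\<phi> j"] by (auto simp: bad_def Ns_def vs_def xs_def cs_def as_def G_def d_def)
  have Npos: "Ns j > 0" for j using Ns_ge[of j] by simp
  have Gge: "Re (G j / of_real (Ns j ^ 2)) \<ge> as j / 2 - d j" for j
    using bad(2)[of j] Npos[of j] by (simp add: Re_divide_of_real pos_le_divide_eq del: of_real_power)
  define \<sigma> where "\<sigma> = (\<lambda>j. of_real (as j) + \<i> * of_real (Ns j * (vs j - v)) :: complex)"
  define w where "w = \<epsilon> * exp (- (\<i> * of_real v))"
  define S where "S = (\<lambda>j. \<Sum>k. if w ^ Suc k = 1 then xs j ^ Suc k / of_nat (Suc k) ^ 3 / \<sigma> j ^ 2 else 0)"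
  obtain r where r: "r < 1" "\<And>y. y \<in> X \<Longrightarrow> norm y \<le> r"
    using compact_norm_bound[OF X] by blast
  have xlt: "norm (xs j) < 1" for j using X(3)[OF xsX] .
  have diff: "(\<lambda>j. G j / of_real (Ns j ^ 2) - S j) \<longlonglongrightarrow> 0"
    unfolding G_def S_def \<sigma>_def w_def
    by (rule log_gf_limit[OF r(1) _ as a vs Ns eps]) (use r xsX in auto)
  define e where "e = (\<lambda>j. norm (G j / of_real (Ns j ^ 2) - S j))"
  have e: "e \<longlonglongrightarrow> 0" unfolding e_def by (rule tendsto_norm_zero[OF diff])
  have Sge: "Re (S j) \<ge> as j / 2 - d j - e j" for j
    using Gge[of j] abs_Re_le_cmod[of "G j / of_real (Ns j ^ 2) - S j"] unfolding e_def by simp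
  \<comment> \<open>Any violating sequence forces the normalised polar part to have real part at
    least \<open>a / 2\<close> in the limit.\<close>
  have lhs_lim: "(\<lambda>j. as j / 2 - d j - e j) \<longlonglongrightarrow> a / 2"
    using tendsto_diff[OF tendsto_diff[OF tendsto_divide[OF as tendsto_const[of 2]] d] e] by simp
  have Re\<sigma>: "Re (\<sigma> j) = as j" "Im (\<sigma> j) = Ns j * (vs j - v)" for j by (auto simp: \<sigma>_def)
  show False
  proof (cases "\<exists>m>0. w ^ m = 1")
    case False
    have "S j = 0" for j
      unfolding S_def by (rule major_terms_sum(1)[OF xlt]) (use False in blast)
    hence "as j / 2 - d j - e j \<le> 0" for j using Sge[of j] by simp
    hence "a / 2 \<le> 0" by (intro LIMSEQ_le_const2[OF lhs_lim]) auto
    thus False using a by simp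
  next
    case True
    then obtain m where m: "m > 0" "w ^ m = 1" by blast
    obtain q' where q': "q' > 0" "w ^ q' = 1" "\<And>j. 0 < j \<Longrightarrow> j < q' \<Longrightarrow> w ^ j \<noteq> 1" "\<And>k. w ^ k = 1 \<longleftrightarrow> q' dvd k"
      using power_eq_1_iff_dvd[OF m] by blast
    define c' where "c' = L q' x"
    have S_eq: "S j = L q' (xs j) ^ 3 / (2 * \<sigma> j ^ 2)" for j
      unfolding S_def by (rule major_terms_sum(2)[OF xlt q'(1) q'(4)])
    \<comment> \<open>Cubes are compared, not the roots: \<open>L q'\<close> may jump at
      \<open>x\<close> when \<open>2 * Li3 (x ^ q')\<close> lies on the branch cut, but its cube is
      continuous. The denominators need not converge, so they are kept and only bounded below by
      \<open>as j\<close>.\<close>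
    define f where "f = (\<lambda>j. norm (L q' (xs j) ^ 3 - c' ^ 3) / (2 * as j ^ 2))"
    have f: "f \<longlonglongrightarrow> 0"
    proof -
      have "(\<lambda>j. Li3 (xs j ^ q')) \<longlonglongrightarrow> Li3 (x ^ q')"
      proof -
        have "continuous_on (ball 0 1) (\<lambda>x. Li3 (x ^ q'))"
          using q'(1) by (intro continuous_intros) (auto simp: norm_power power_less_one_iff)
        thus ?thesis
          using xs xlt X(3)[OF x] continuous_on_tendsto_compose[of "ball 0 1" "\<lambda>x. Li3 (x ^ q')" xs x sequentially] by auto
      qed
      hence "(\<lambda>j. norm (2 * Li3 (xs j ^ q') / of_nat q' ^ 3 - 2 * Li3 (x ^ q') / of_nat q' ^ 3) / (2 * as j ^ 2)) \<longlonglongrightarrow>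
         norm (2 * Li3 (x ^ q') / of_nat q' ^ 3 - 2 * Li3 (x ^ q') / of_nat q' ^ 3) / (2 * a ^ 2)"
        using a q'(1) by (intro tendsto_intros as) auto
      thus ?thesis by (simp add: f_def c'_def L_cubed)
    qed
    have Sle: "Re (S j) \<le> Re (c' ^ 3 / \<sigma> j ^ 2) / 2 + f j" for j
    proof -
      have "S j = c' ^ 3 / \<sigma> j ^ 2 / 2 + (L q' (xs j) ^ 3 - c' ^ 3) / (2 * \<sigma> j ^ 2)"
        by (simp add: S_eq diff_divide_distrib)
      moreover have "Re ((L q' (xs j) ^ 3 - c' ^ 3) / (2 * \<sigma> j ^ 2)) \<le> f j"
      proof -
        have "as j ^ 2 \<le> norm (\<sigma> j) ^ 2"
          using complex_Re_le_cmod[of "\<sigma> j"] Re\<sigma> as_pos[of j] by (intro power_mono) auto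
        hence "norm (L q' (xs j) ^ 3 - c' ^ 3) / (2 * norm (\<sigma> j) ^ 2) \<le> f j"
          unfolding f_def using as_pos[of j] by (intro divide_left_mono mult_pos_pos) (auto intro: order_less_le_trans[of 0 "as j ^ 2"])
        thus ?thesis
          using complex_Re_le_cmod[of "(L q' (xs j) ^ 3 - c' ^ 3) / (2 * \<sigma> j ^ 2)"] by (simp add: norm_divide norm_mult norm_power)
      qed
      moreover have "Re (c' ^ 3 / \<sigma> j ^ 2 / 2) = Re (c' ^ 3 / \<sigma> j ^ 2) / 2"
        using Re_divide_of_real[of "c' ^ 3 / \<sigma> j ^ 2" 2] by simp
      ultimately show ?thesis by (simp only: plus_complex.sel add_le_cancel_left)
    qed
    have half: "l \<le> Y / 2 + t" if "X \<le> Y" "l \<le> b" "b \<le> X / 2 + t" for l X Y b t :: real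
      using that by linarith
    show False
    proof (cases "q' = q")
      case False
      have "as j / 2 - d j - e j \<le> Re c' ^ 3 / as j ^ 2 / 2 + f j" for j
      proof -
        have "Re (c' ^ 3 / \<sigma> j ^ 2) \<le> Re c' ^ 3 / as j ^ 2"
          using saddle_le[of c' "\<sigma> j"] L_sector[of q' x] as_pos[of j] Re\<sigma> by (simp add: c'_def)
        from half[OF this Sge Sle] show ?thesis .
      qed
      moreover have "(\<lambda>j. Re c' ^ 3 / as j ^ 2 / 2 + f j) \<longlonglongrightarrow> Re c' ^ 3 / a ^ 2 / 2 + 0"
        using a by (intro tendsto_intros as f) auto
      ultimately have "a / 2 \<le> Re c' ^ 3 / a ^ 2 / 2 + 0" by (intro LIMSEQ_le[OF lhs_lim]) auto
      hence "a ^ 3 \<le> Re c' ^ 3" using a by (simp add: field_simps power2_eq_square power3_eq_cube)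
      moreover have "Re c' < a" using dom[OF x, of q'] q'(1) False by (simp add: c'_def a_def c_def)
      hence "Re c' ^ 3 < a ^ 3" using L_sector(1)[of q' x] by (intro power_strict_mono) (auto simp: c'_def)
      ultimately show False by simp
    next
      case True
      \<comment> \<open>By uniqueness of the primitive root the limiting angle is the centre; the
        points then avoid the saddle only on the scale \<open>1 / Ns j\<close>.\<close>
      have "w = \<epsilon>" using root[of w] q' True by blast
      hence "exp (- (\<i> * of_real v)) = 1" using eps by (auto simp: w_def)
      hence "v = 0"
      proof -
        assume "exp (- (\<i> * complex_of_real v)) = 1"
        then obtain n :: int where "- v = of_int (2 * n) * pi" by (auto simp: exp_eq_1)
        moreover have "\<bar>v\<bar> \<le> pi" using v by auto
        moreover have "\<bar>of_int (2 * n)\<bar> * pi = \<bar>- v\<bar>"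
          unfolding \<open>- v = _\<close> abs_mult by simp
        ultimately have "\<bar>of_int (2 * n)\<bar> * pi \<le> 1 * pi" by simp
        hence "\<bar>of_int (2 * n) :: real\<bar> \<le> 1" using pi_gt_zero by (simp only: mult_le_cancel_right_pos)
        hence "n = 0" by linarith
        thus ?thesis using \<open>- v = _\<close> by simp
      qed
      have c': "c' = c" by (simp add: c'_def c_def True)
      \<comment> \<open>Since \<open>as j\<close> is eventually below \<open>2 * a\<close>, the
        rescaled distance to the moving saddle is at least \<open>\<eta> / (2 * a)\<close>; half of
        this is spent on replacing \<open>cs j\<close> by its limit.\<close>
      obtain \<delta> where \<delta>: "\<delta> > 0" "\<And>\<sigma>. Re \<sigma> > 0 \<Longrightarrow> \<bar>Im \<sigma> / Re \<sigma> - Im c / Re c\<bar> \<ge> \<eta> / (4 * a) \<Longrightarrow>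
           Re (c ^ 3 / \<sigma> ^ 2) \<le> (1 - \<delta>) * (Re c ^ 3 / Re \<sigma> ^ 2)"
        using saddle_gap[of c "\<eta> / (4 * a)"] pos[OF x] sector[OF x] \<eta> a by (auto simp: c_def)
      have "(\<lambda>j. Im (cs j) / as j) \<longlonglongrightarrow> Im c / a"
        using a by (intro tendsto_intros cs as) auto
      hence "eventually (\<lambda>j. dist (Im (cs j) / as j) (Im c / a) < \<eta> / (4 * a)) sequentially"
        using \<eta> a by (intro tendstoD) auto
      moreover have "eventually (\<lambda>j. as j < 2 * a) sequentially"
        using order_tendstoD(2)[OF as, of "2 * a"] a by simp
      ultimately have "eventually (\<lambda>j. as j / 2 - d j - e j \<le> (1 - \<delta>) * (a ^ 3 / as j ^ 2) / 2 + f j) sequentially"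
      proof eventually_elim
        case (elim j)
        have "\<eta> / (2 * a) \<le> \<eta> / as j" using elim as_pos[of j] \<eta> by (intro divide_left_mono) (auto simp: a)
        also have "\<dots> \<le> \<bar>Ns j * vs j - Im (cs j)\<bar> / as j"
          using bad(1)[of j] as_pos[of j] by (intro divide_right_mono) auto
        also have "\<dots> = \<bar>Ns j * vs j / as j - Im (cs j) / as j\<bar>"
          using as_pos[of j] by (simp add: diff_divide_distrib[symmetric])
        finally have "\<eta> / (2 * a) \<le> \<bar>Ns j * vs j / as j - Im (cs j) / as j\<bar>" .
        moreover have "\<eta> / (2 * a) = \<eta> / (4 * a) + \<eta> / (4 * a)" by simp
        ultimately have "\<eta> / (4 * a) \<le> \<bar>Ns j * vs j / as j - Im c / a\<bar>"
          using elim(1) unfolding dist_real_def by linarith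
        hence "\<bar>Im (\<sigma> j) / Re (\<sigma> j) - Im c / Re c\<bar> \<ge> \<eta> / (4 * a)"
          by (simp add: Re\<sigma> \<open>v = 0\<close> a_def)
        hence "Re (c ^ 3 / \<sigma> j ^ 2) \<le> (1 - \<delta>) * (a ^ 3 / as j ^ 2)"
          using \<delta>(2)[of "\<sigma> j"] as_pos[of j] by (simp add: Re\<sigma> a_def)
        from half[OF this Sge Sle[unfolded c']] show ?case .
      qed
      moreover have "(\<lambda>j. (1 - \<delta>) * (a ^ 3 / as j ^ 2) / 2 + f j) \<longlonglongrightarrow> (1 - \<delta>) * (a ^ 3 / a ^ 2) / 2 + 0"
        using a by (intro tendsto_intros as f) auto
      ultimately have "a / 2 \<le> (1 - \<delta>) * (a ^ 3 / a ^ 2) / 2 + 0"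
        by (intro tendsto_le[OF _ _ lhs_lim]) auto
      also have "a ^ 3 / a ^ 2 = a" using a by (simp add: power2_eq_square power3_eq_cube)
      finally have "\<delta> * a \<le> 0" by (simp add: algebra_simps)
      thus False using \<delta>(1) a by (simp add: mult_le_0_iff)
    qed
  qed
qed

section \<open>The saddle point\<close>

text \<open>Up to scaling this is the error function. An entire primitive normalised to vanish at 0
  is odd, and its limit on the real axis is the half-line Gaussian integral.\<close>

lemma gaussian_primitive:
  obtains P :: "complex \<Rightarrow> complex" where
    "\<And>z. (P has_field_derivative exp (- (z ^ 2))) (at z)" "\<And>z. P (- z) = - P z"
    "((\<lambda>t. P (of_real t)) \<longlongrightarrow> of_real (sqrt pi / 2)) at_top"
proof -
  have "(\<lambda>z::complex. exp (- (z ^ 2))) holomorphic_on UNIV" by (intro holomorphic_intros)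
  then obtain P0 :: "complex \<Rightarrow> complex" where P0: "\<And>z. (P0 has_field_derivative exp (- (z ^ 2))) (at z)"
    using holomorphic_convex_primitive'[of UNIV "\<lambda>z. exp (- (z ^ 2))"] by auto
  define P where "P = (\<lambda>z. P0 z - P0 0)"
  have P: "(P has_field_derivative exp (- (z ^ 2))) (at z)" for z
    unfolding P_def by (auto intro!: derivative_eq_intros P0)
  have odd: "P (- z) = - P z" for z
  proof -
    have "((\<lambda>z. P z + P (- z)) has_field_derivative 0) (at z within UNIV)" for z
    proof -
      have "((\<lambda>z. P (- z)) has_field_derivative exp (- ((- z) ^ 2)) * (- 1)) (at z)"
        by (rule DERIV_chain2[OF P]) (auto intro!: derivative_eq_intros)
      from DERIV_add[OF P this] show ?thesis by simp
    qed
    from has_field_derivative_zero_constant[OF convex_UNIV this]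
    obtain C where C: "\<And>z. P z + P (- z) = C" by blast
    have "C = 0" using C[of 0] by (simp add: P_def)
    thus ?thesis using C[of z] by (simp add: eq_neg_iff_add_eq_0 add.commute)
  qed
  have real: "P (of_real T) = of_real (\<integral>x. indicator {..T} x *\<^sub>R (indicator {0..} x *\<^sub>R exp (- x\<^sup>2)) \<partial>lborel)"
    if "T \<ge> 0" for T
  proof -
    have "((\<lambda>t. exp (- (of_real t ^ 2))) has_integral (P (of_real T) - P (of_real 0))) {0..T}"
      by (rule fundamental_theorem_of_calculus[OF that has_vector_derivative_real_field[OF P]])
    hence 1: "((\<lambda>t. complex_of_real (exp (- (t ^ 2)))) has_integral P (of_real T)) {0..T}"
      by (simp add: P_def exp_of_real[symmetric])
    have "continuous_on {0..T} (\<lambda>t::real. exp (- (t ^ 2)))" by (intro continuous_intros)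
    hence "set_integrable lborel {0..T} (\<lambda>t::real. exp (- (t ^ 2)))"
      unfolding set_integrable_def by (intro borel_integrable_compact) auto
    from set_borel_integral_eq_integral[OF this]
    have "((\<lambda>t::real. exp (- (t ^ 2))) has_integral (LINT t:{0..T}|lborel. exp (- (t ^ 2)))) {0..T}"
      by (simp add: has_integral_iff)
    hence "((\<lambda>t. complex_of_real (exp (- (t ^ 2)))) has_integral of_real (LINT t:{0..T}|lborel. exp (- (t ^ 2)))) {0..T}"
      by (rule has_integral_of_real)
    from has_integral_unique[OF 1 this]
    have "P (of_real T) = of_real (LINT t:{0..T}|lborel. exp (- (t ^ 2)))" .
    also have "(LINT t:{0..T}|lborel. exp (- (t ^ 2))) = (\<integral>x. indicator {..T} x *\<^sub>R (indicator {0..} x *\<^sub>R exp (- x\<^sup>2)) \<partial>lborel)"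
      unfolding set_lebesgue_integral_def by (intro Bochner_Integration.integral_cong refl) (auto simp: indicator_def)
    finally show ?thesis .
  qed
  have g: "has_bochner_integral lborel (\<lambda>x::real. indicator {0..} x *\<^sub>R exp (- x\<^sup>2)) (sqrt pi / 2)"
    by (rule gaussian_moment_0)
  have "((\<lambda>T. \<integral>x. indicator {..T} x *\<^sub>R (indicator {0..} x *\<^sub>R exp (- x\<^sup>2)) \<partial>lborel) \<longlongrightarrow> sqrt pi / 2) at_top"
    using tendsto_integral_at_top[OF sets_lborel conjunct1[OF g[unfolded has_bochner_integral_iff]]]
    unfolding conjunct2[OF g[unfolded has_bochner_integral_iff]] .
  hence "((\<lambda>T. complex_of_real (\<integral>x. indicator {..T} x *\<^sub>R (indicator {0..} x *\<^sub>R exp (- x\<^sup>2)) \<partial>lborel)) \<longlongrightarrow> of_real (sqrt pi / 2)) at_top"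
    by (rule tendsto_of_real)
  hence "((\<lambda>t. P (of_real t)) \<longlongrightarrow> of_real (sqrt pi / 2)) at_top"
  proof (rule Lim_transform_eventually)
    show "eventually (\<lambda>T. complex_of_real (\<integral>x. indicator {..T} x *\<^sub>R (indicator {0..} x *\<^sub>R exp (- x\<^sup>2)) \<partial>lborel) = P (of_real T)) at_top"
      using eventually_ge_at_top[of 0] by eventually_elim (use real in simp)
  qed
  with P odd show ?thesis using that by blast
qed

text \<open>The crude bound \<open>exp (- y) \<le> 1 / y\<close> turns the integrand into an inverse
  square with an elementary primitive.\<close>

lemma norm_integral_gaussian_tail:
  fixes b :: complex
  assumes P: "\<And>z. (P has_field_derivative exp (- (z ^ 2))) (at z)"
    and b: "Re (b ^ 2) > 0" and T: "0 < T" "T \<le> S"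
  shows "norm (P (b * of_real S) - P (b * of_real T)) \<le> norm b / (Re (b ^ 2) * T)"
proof -
  have 1: "((\<lambda>t. exp (- ((b * of_real t) ^ 2)) * b) has_integral (P (b * of_real S) - P (b * of_real T))) {T..S}"
  proof (rule fundamental_theorem_of_calculus[OF T(2)])
    fix t
    have "((\<lambda>z. P (b * z)) has_field_derivative exp (- ((b * of_real t) ^ 2)) * b) (at (of_real t))"
      by (rule DERIV_chain2[OF P]) (auto intro!: derivative_eq_intros)
    thus "((\<lambda>t. P (b * of_real t)) has_vector_derivative exp (- ((b * of_real t) ^ 2)) * b) (at t within {T..S})"
      by (rule has_vector_derivative_real_field)
  qed
  have 2: "((\<lambda>t. norm b / Re (b ^ 2) * (1 / t ^ 2)) has_integral (norm b / Re (b ^ 2) * (- 1 / S - (- 1 / T)))) {T..S}"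
    using T by (intro has_integral_mult_right fundamental_theorem_of_calculus)
       (auto simp: has_real_derivative_iff_has_vector_derivative[symmetric] power2_eq_square intro!: derivative_eq_intros)
  have "norm (exp (- ((b * of_real t) ^ 2)) * b) \<le> norm b / Re (b ^ 2) * (1 / t ^ 2)" if "t \<in> {T..S}" for t
  proof -
    have t: "t > 0" using that T by simp
    define y where "y = Re (b ^ 2) * t ^ 2"
    have y: "y > 0" using b t by (simp add: y_def)
    have "Re ((b * of_real t) ^ 2) = y"
      unfolding y_def power_mult_distrib of_real_power[symmetric] by simp
    hence "norm (exp (- ((b * of_real t) ^ 2)) * b) = exp (- y) * norm b"
      by (simp add: norm_mult)
    also have "\<dots> \<le> (1 / y) * norm b"
    proof (intro mult_right_mono)
      have "y \<le> exp y" using exp_ge_add_one_self[of y] by linarith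
      thus "exp (- y) \<le> 1 / y" using y by (simp add: exp_minus field_simps)
    qed simp
    also have "\<dots> = norm b / Re (b ^ 2) * (1 / t ^ 2)" by (simp add: y_def)
    finally show ?thesis .
  qed
  hence "norm (P (b * of_real S) - P (b * of_real T)) \<le> norm b / Re (b ^ 2) * (- 1 / S - (- 1 / T))"
    using integral_norm_bound_integral[OF has_integral_integrable[OF 1] has_integral_integrable[OF 2]]
      integral_unique[OF 1] integral_unique[OF 2] by simp
  also have "\<dots> \<le> norm b / Re (b ^ 2) * (1 / T)"
    using b T by (intro mult_left_mono) auto
  finally show ?thesis by simp
qed

text \<open>The end point on the ray through \<open>b\<close> is joined by a segment to the real
  point of the same modulus. On the segment the real part of \<open>z ^ 2\<close> is at least
  \<open>\<kappa> * S ^ 2\<close>, and this decay beats the length, which is linear in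
  \<open>S\<close>.\<close>

lemma gaussian_primitive_tendsto:
  fixes b :: complex
  assumes P: "\<And>z. (P has_field_derivative exp (- (z ^ 2))) (at z)"
    and lim: "((\<lambda>t. P (of_real t)) \<longlongrightarrow> l) at_top"
    and b: "Re (b ^ 2) > 0" "Re b > 0"
  shows "((\<lambda>S. P (b * of_real S)) \<longlongrightarrow> l) at_top"
proof -
  define \<kappa> where "\<kappa> = Re (b ^ 2)"
  have k: "\<kappa> > 0" using b by (simp add: \<kappa>_def)
  define \<beta> where "\<beta> = norm b"
  have \<beta>: "\<beta> > 0" using b by (auto simp: \<beta>_def)
  have bound: "norm (P (b * of_real S) - P (of_real (\<beta> * S))) \<le> exp (- \<kappa> * S ^ 2) * (norm (b - of_real \<beta>) * S)" if "S > 0" for S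
  proof -
    have "norm (P (b * of_real S) - P (of_real (\<beta> * S))) \<le> exp (- \<kappa> * S ^ 2) * norm (b * of_real S - of_real (\<beta> * S))"
    proof (rule field_differentiable_bound[OF convex_closed_segment])
      show "(P has_field_derivative exp (- (z ^ 2))) (at z within closed_segment (b * of_real S) (of_real (\<beta> * S)))" for z
        using P[of z] by (rule has_field_derivative_at_within)
      fix z assume "z \<in> closed_segment (b * of_real S) (of_real (\<beta> * S))"
      then obtain u where u: "0 \<le> u" "u \<le> 1" and z: "z = (1 - u) *\<^sub>R (b * of_real S) + u *\<^sub>R (of_real (\<beta> * S))"
        by (auto simp: closed_segment_def)
      have "z = of_real S * (of_real (1 - u) * b + of_real (u * \<beta>))"
        unfolding z by (simp add: scaleR_conv_of_real algebra_simps)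
      hence Rez: "Re (z ^ 2) = S ^ 2 * Re ((of_real (1 - u) * b + of_real (u * \<beta>)) ^ 2)"
        by (simp add: power_mult_distrib flip: of_real_power)
      have "Re ((of_real (1 - u) * b + of_real (u * \<beta>)) ^ 2) = (1 - u) ^ 2 * \<kappa> + 2 * ((1 - u) * u) * (\<beta> * Re b) + u ^ 2 * \<beta> ^ 2"
        by (simp add: \<kappa>_def power2_eq_square algebra_simps)
      also have "\<dots> \<ge> (1 - u) ^ 2 * \<kappa> + 2 * ((1 - u) * u) * \<kappa> + u ^ 2 * \<kappa>"
      \<comment> \<open>All three coefficients are at least \<kappa>: the square of the modulus
        bounds \<open>Re (b ^ 2)\<close>, and so does \<open>\<beta> * Re b\<close>, since
        \<open>Re b ^ 2\<close> already does.\<close>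
      proof -
        have "Re b \<le> \<beta>" by (simp add: \<beta>_def complex_Re_le_cmod)
        hence "Re b * Re b \<le> \<beta> * Re b" using b by (intro mult_right_mono) auto
        hence "\<kappa> \<le> \<beta> * Re b" unfolding \<kappa>_def by (simp add: power2_eq_square) (smt (verit) zero_le_square)
        moreover have "\<kappa> \<le> \<beta> ^ 2" using complex_Re_le_cmod[of "b ^ 2"] by (simp add: \<kappa>_def \<beta>_def norm_power)
        ultimately show ?thesis using u by (intro add_mono mult_left_mono) auto
      qed
      also have "(1 - u) ^ 2 * \<kappa> + 2 * ((1 - u) * u) * \<kappa> + u ^ 2 * \<kappa> = \<kappa>"
        by (simp add: power2_eq_square algebra_simps)
      finally have "S ^ 2 * \<kappa> \<le> Re (z ^ 2)" unfolding Rez by (intro mult_left_mono) auto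
      thus "norm (exp (- (z ^ 2))) \<le> exp (- \<kappa> * S ^ 2)" by (simp add: mult.commute)
    qed auto
    also have "b * of_real S - of_real (\<beta> * S) = (b - of_real \<beta>) * of_real S" by (simp add: algebra_simps)
    finally show ?thesis using that by (simp add: norm_mult)
  qed
  have "((\<lambda>S. exp (- \<kappa> * S ^ 2) * (norm (b - of_real \<beta>) * S)) \<longlongrightarrow> 0) at_top"
    using k by real_asymp
  hence "((\<lambda>S. P (b * of_real S) - P (of_real (\<beta> * S))) \<longlongrightarrow> 0) at_top"
    by (rule Lim_null_comparison[rotated]) (rule eventually_mono[OF eventually_gt_at_top[of 0] bound])
  moreover have "((\<lambda>S. P (of_real (\<beta> * S))) \<longlongrightarrow> l) at_top"
    by (rule filterlim_compose[OF lim]) (use \<beta> in real_asymp)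
  ultimately show ?thesis using tendsto_add by fastforce
qed

lemma Re_csqrt_pos:
  assumes "Re w > 0"
  shows "Re (csqrt w) > 0"
proof -
  have "Re (csqrt w) \<noteq> 0"
  proof
    assume "Re (csqrt w) = 0"
    hence "Re (csqrt w ^ 2) \<le> 0" by (simp add: power2_eq_square)
    thus False using assms by simp
  qed
  thus ?thesis using csqrt_principal[of w] by auto
qed

text \<open>After scaling by the principal root \<open>b\<close> of \<open>w\<close>, whose real
  part is positive, oddness of the primitive makes both end points contribute equally; the error is
  the tail beyond \<open>K * h\<close>.\<close>

lemma gaussian_integral:
  fixes w :: complex
  assumes w: "Re w > 0" and K: "K > 0" and h: "h > 0"
  obtains J where "((\<lambda>v. exp (- (w * of_real ((K * (v - v0)) ^ 2)))) has_integral J) {v0 - h..v0 + h}"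
    "norm (J - of_real (sqrt pi) / (csqrt w * of_real K)) \<le> 2 / (Re w * h * K ^ 2)"
proof -
  obtain P :: "complex \<Rightarrow> complex" where P: "\<And>z. (P has_field_derivative exp (- (z ^ 2))) (at z)" "\<And>z. P (- z) = - P z"
    "((\<lambda>t. P (of_real t)) \<longlongrightarrow> of_real (sqrt pi / 2)) at_top"
    by (rule gaussian_primitive) blast
  define b where "b = csqrt w"
  have b2: "b ^ 2 = w" by (simp add: b_def)
  have b: "Re b > 0" using Re_csqrt_pos[OF w] by (simp only: b_def)
  have b0: "b \<noteq> 0" using b by auto
  define J where "J = 2 * P (b * of_real (K * h)) / (b * of_real K)"
  have int: "((\<lambda>v. exp (- (w * of_real ((K * (v - v0)) ^ 2)))) has_integral J) {v0 - h..v0 + h}"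
  proof -
    define F where "F = (\<lambda>z. P (b * (of_real K * (z - of_real v0))) / (b * of_real K))"
    have "((\<lambda>v. exp (- (w * of_real ((K * (v - v0)) ^ 2)))) has_integral F (of_real (v0 + h)) - F (of_real (v0 - h))) {v0 - h..v0 + h}"
    proof (rule fundamental_theorem_of_calculus)
      fix v
      have "((\<lambda>z. P (b * (of_real K * (z - of_real v0)))) has_field_derivative
          exp (- ((b * (of_real K * (of_real v - of_real v0))) ^ 2)) * (b * of_real K)) (at (of_real v))"
        by (rule DERIV_chain2[OF P(1)]) (auto intro!: derivative_eq_intros)
      from DERIV_cdivide[OF this, of "b * of_real K"]
      have "(F has_field_derivative exp (- ((b * (of_real K * (of_real v - of_real v0))) ^ 2))) (at (of_real v))"
        unfolding F_def using b0 K by simp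
      moreover have "(b * (of_real K * (of_real v - of_real v0))) ^ 2 = w * of_real ((K * (v - v0)) ^ 2)"
        by (simp add: power_mult_distrib b2)
      ultimately have "(F has_field_derivative exp (- (w * of_real ((K * (v - v0)) ^ 2)))) (at (of_real v))" by (simp only:)
      thus "((\<lambda>v. F (of_real v)) has_vector_derivative exp (- (w * of_real ((K * (v - v0)) ^ 2)))) (at v within {v0 - h..v0 + h})"
        by (rule has_vector_derivative_real_field)
    qed (use h in simp)
    moreover have "F (of_real (v0 + h)) - F (of_real (v0 - h)) = J"
      using P(2)[of "b * (of_real K * of_real h)"]
      by (simp add: F_def J_def diff_divide_distrib[symmetric])
    ultimately show ?thesis by simp
  qed
  have "((\<lambda>S. norm (P (b * of_real S) - P (b * of_real (K * h)))) \<longlongrightarrow> norm (of_real (sqrt pi / 2) - P (b * of_real (K * h)))) at_top"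
    by (intro tendsto_intros gaussian_primitive_tendsto[OF P(1,3)]) (use b b2 w in auto)
  hence "norm (of_real (sqrt pi / 2) - P (b * of_real (K * h))) \<le> norm b / (Re (b ^ 2) * (K * h))"
  proof (rule tendsto_upperbound)
    show "eventually (\<lambda>S. norm (P (b * of_real S) - P (b * of_real (K * h))) \<le> norm b / (Re (b ^ 2) * (K * h))) at_top"
      using eventually_ge_at_top[of "K * h"]
      by eventually_elim (rule norm_integral_gaussian_tail[OF P(1)], use b2 w K h in auto)
  qed simp
  hence *: "norm (P (b * of_real (K * h)) - of_real (sqrt pi / 2)) \<le> norm b / (Re w * (K * h))"
    by (simp add: b2 norm_minus_commute)
  have "J - of_real (sqrt pi) / (b * of_real K) = (P (b * of_real (K * h)) - of_real (sqrt pi / 2)) * (2 / (b * of_real K))"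
    using b0 K by (simp add: J_def field_simps)
  hence "norm (J - of_real (sqrt pi) / (b * of_real K)) = norm (P (b * of_real (K * h)) - of_real (sqrt pi / 2)) * (2 / (norm b * K))"
    using K by (simp only: norm_mult norm_divide norm_of_real norm_numeral abs_of_pos)
  also have "\<dots> \<le> norm b / (Re w * (K * h)) * (2 / (norm b * K))"
    using * K by (intro mult_right_mono) auto
  also have "\<dots> = 2 / (Re w * h * K ^ 2)" using b0 by (simp add: power2_eq_square)
  finally show ?thesis using that[OF int] by (simp add: b_def)
qed

text \<open>Relative to the main term, of size \<open>norm E0 / N ^ 2\<close>, every error is
  smaller by a factor \<open>N\<close>: the weight \<open>1 / (1 + t ^ 2)\<close> integrates to at
  most \<pi> after the change of scale \<open>N ^ 2\<close>, and the outer parts and the Gaussian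
  tail are of order \<open>N ^ (- 3)\<close>.\<close>

lemma saddle_integral:
  fixes f :: "real \<Rightarrow> complex" and w E0 I :: complex
  assumes f: "(f has_integral I) {-pi..pi}" and w: "Re w > 0" and N: "N > 0" and \<eta>: "\<eta> > 0"
    and v0: "-pi \<le> v0 - \<eta> / N" "v0 + \<eta> / N \<le> pi"
    and major: "\<And>v. \<bar>v - v0\<bar> \<le> \<eta> / N \<Longrightarrow>
       norm (f v - E0 * exp (- (w * of_real ((N ^ 2 * (v - v0)) ^ 2)))) \<le> norm E0 * (K2 / N) * (1 / (1 + (N ^ 2 * (v - v0)) ^ 2))"
    and minor: "\<And>v. v \<in> {-pi..pi} \<Longrightarrow> \<bar>v - v0\<bar> \<ge> \<eta> / N \<Longrightarrow> norm (f v) \<le> norm E0 * (K3 / N ^ 3)"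
    and K: "K2 \<ge> 0" "K3 \<ge> 0"
  shows "norm (I - E0 * (of_real (sqrt pi) / (csqrt w * of_real (N ^ 2)))) \<le> norm E0 / N ^ 3 * (K2 * pi + 4 * pi * K3 + 2 / (Re w * \<eta>))"
proof -
  define l where "l = v0 - \<eta> / N"
  define u where "u = v0 + \<eta> / N"
  have lu: "-pi \<le> l" "l \<le> u" "u \<le> pi" using v0 \<eta> N by (auto simp: l_def u_def)
  have int: "f integrable_on {-pi..pi}" using f by (rule has_integral_integrable)
  have ints: "f integrable_on {-pi..l}" "f integrable_on {l..u}" "f integrable_on {u..pi}" "f integrable_on {l..pi}"
    by (rule integrable_on_subinterval[OF int]; use lu in auto)+
  have I: "I = integral {-pi..l} f + (integral {l..u} f + integral {u..pi} f)"
    using Henstock_Kurzweil_Integration.integral_combine[OF _ _ int, of l]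
      Henstock_Kurzweil_Integration.integral_combine[OF _ _ ints(4), of u] lu integral_unique[OF f] by simp
  obtain J where J: "((\<lambda>v. exp (- (w * of_real ((N ^ 2 * (v - v0)) ^ 2)))) has_integral J) {l..u}"
     "norm (J - of_real (sqrt pi) / (csqrt w * of_real (N ^ 2))) \<le> 2 / (Re w * (\<eta> / N) * (N ^ 2) ^ 2)"
  proof -
    have "N ^ 2 > 0" "\<eta> / N > 0" using \<eta> N by auto
    from gaussian_integral[OF w this, of v0] that show ?thesis unfolding l_def u_def by blast
  qed
  have part: "norm (integral {p..p'} f) \<le> norm E0 * (K3 / N ^ 3) * (2 * pi)"
    if p: "p \<le> p'" "-pi \<le> p" "p' \<le> pi" "f integrable_on {p..p'}" "\<And>v. v \<in> {p..p'} \<Longrightarrow> \<bar>v - v0\<bar> \<ge> \<eta> / N" for p p'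
  proof -
    have B: "0 \<le> norm E0 * (K3 / N ^ 3)" using K N by simp
    have "norm (integral {p..p'} f) \<le> norm E0 * (K3 / N ^ 3) * Henstock_Kurzweil_Integration.content (cbox p p')"
      by (rule has_integral_bound[OF B]) (use p minor in \<open>auto simp: integrable_integral\<close>)
    also have "\<dots> \<le> norm E0 * (K3 / N ^ 3) * (2 * pi)"
      using p by (intro mult_left_mono B) auto
    finally show ?thesis .
  qed
  have left: "norm (integral {-pi..l} f) \<le> norm E0 * (K3 / N ^ 3) * (2 * pi)"
    by (rule part) (use lu ints \<eta> N in \<open>auto simp: l_def\<close>)
  have right: "norm (integral {u..pi} f) \<le> norm E0 * (K3 / N ^ 3) * (2 * pi)"
    by (rule part) (use lu ints \<eta> N in \<open>auto simp: u_def\<close>)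
  have mid: "norm (integral {l..u} f - E0 * J) \<le> norm E0 * (K2 / N) * (pi / N ^ 2)"
  proof -
    define A where "A = (\<lambda>v. arctan (N ^ 2 * (v - v0)) / N ^ 2)"
    have 1: "((\<lambda>v. f v - E0 * exp (- (w * of_real ((N ^ 2 * (v - v0)) ^ 2)))) has_integral (integral {l..u} f - E0 * J)) {l..u}"
      by (intro has_integral_diff has_integral_mult_right J integrable_integral ints)
    have "((\<lambda>v. 1 / (1 + (N ^ 2 * (v - v0)) ^ 2)) has_integral (A u - A l)) {l..u}"
    proof (rule fundamental_theorem_of_calculus[OF lu(2)])
      fix v
      have "(A has_real_derivative (inverse (1 + (N ^ 2 * (v - v0)) ^ 2) * N ^ 2) / N ^ 2) (at v within {l..u})"
        unfolding A_def by (rule DERIV_cdivide) (auto intro!: derivative_eq_intros)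
      thus "(A has_vector_derivative 1 / (1 + (N ^ 2 * (v - v0)) ^ 2)) (at v within {l..u})"
        unfolding has_real_derivative_iff_has_vector_derivative[symmetric]
        using N by (simp only: nonzero_mult_div_cancel_right power_not_zero less_imp_neq[symmetric] inverse_eq_divide not_False_eq_True)
    qed
    hence 2: "((\<lambda>v. norm E0 * (K2 / N) * (1 / (1 + (N ^ 2 * (v - v0)) ^ 2))) has_integral (norm E0 * (K2 / N) * (A u - A l))) {l..u}"
      by (rule has_integral_mult_right)
    have "norm (integral {l..u} f - E0 * J) \<le> norm E0 * (K2 / N) * (A u - A l)"
      using integral_norm_bound_integral[OF has_integral_integrable[OF 1] has_integral_integrable[OF 2] major]
        integral_unique[OF 1] integral_unique[OF 2] by (auto simp: l_def u_def abs_le_iff)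
    also have "\<dots> \<le> norm E0 * (K2 / N) * (pi / N ^ 2)"
    proof (intro mult_left_mono)
      have "arctan (N ^ 2 * (u - v0)) - arctan (N ^ 2 * (l - v0)) \<le> pi"
        using arctan_ubound[of "N ^ 2 * (u - v0)"] arctan_lbound[of "N ^ 2 * (l - v0)"] by linarith
      thus "A u - A l \<le> pi / N ^ 2"
        unfolding A_def diff_divide_distrib[symmetric] by (rule divide_right_mono) simp
    qed (use K N in auto)
    finally show ?thesis .
  qed
  have g: "norm (E0 * J - E0 * (of_real (sqrt pi) / (csqrt w * of_real (N ^ 2)))) \<le> norm E0 * (2 / (Re w * (\<eta> / N) * (N ^ 2) ^ 2))"
    unfolding right_diff_distrib[symmetric] norm_mult by (intro mult_left_mono J(2)) simp
  let ?G = "E0 * (of_real (sqrt pi) / (csqrt w * of_real (N ^ 2)))"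
  have split: "I - ?G = integral {-pi..l} f + ((integral {l..u} f - E0 * J) + ((E0 * J - ?G) + integral {u..pi} f))"
    by (simp add: I)
  have "norm (I - ?G) \<le> norm (integral {-pi..l} f) + (norm (integral {l..u} f - E0 * J) + (norm (E0 * J - ?G) + norm (integral {u..pi} f)))"
    unfolding split
    using norm_triangle_ineq[of "integral {-pi..l} f" "(integral {l..u} f - E0 * J) + ((E0 * J - ?G) + integral {u..pi} f)"]
      norm_triangle_ineq[of "integral {l..u} f - E0 * J" "(E0 * J - ?G) + integral {u..pi} f"]
      norm_triangle_ineq[of "E0 * J - ?G" "integral {u..pi} f"] by linarith
  also have "\<dots> \<le> norm E0 * (K3 / N ^ 3) * (2 * pi) + (norm E0 * (K2 / N) * (pi / N ^ 2) + (norm E0 * (2 / (Re w * (\<eta> / N) * (N ^ 2) ^ 2)) + norm E0 * (K3 / N ^ 3) * (2 * pi)))"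
    by (intro add_mono left right mid g)
  also have "\<dots> = norm E0 / N ^ 3 * (K2 * pi + 4 * pi * K3 + 2 / (Re w * \<eta>))"
  proof -
    have "Re w * (\<eta> / N) * (N ^ 2) ^ 2 = N ^ 3 * (Re w * \<eta>)"
      using N by (simp add: power2_eq_square power3_eq_cube)
    hence e1: "2 / (Re w * (\<eta> / N) * (N ^ 2) ^ 2) = 1 / N ^ 3 * (2 / (Re w * \<eta>))"
      by simp
    have e2: "norm E0 * (K2 / N) * (pi / N ^ 2) = norm E0 / N ^ 3 * (K2 * pi)"
      by (simp add: power2_eq_square power3_eq_cube)
    show ?thesis unfolding e1 e2 by (simp add: ring_distribs)
  qed
  finally show ?thesis .
qed

section \<open>Pointwise comparison near the saddle\<close>

lemma cube_le_exp: "0 \<le> y \<Longrightarrow> y ^ 3 \<le> 27 * exp (y::real)"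
proof -
  assume y: "0 \<le> y"
  have "y / 3 \<le> exp (y / 3)" using exp_ge_add_one_self[of "y / 3"] by linarith
  hence "(y / 3) ^ 3 \<le> exp (y / 3) ^ 3" using y by (intro power_mono) auto
  also have "exp (y / 3) ^ 3 = exp y" by (simp add: exp_of_nat_mult[symmetric])
  finally show ?thesis by (simp add: power_divide)
qed

text \<open>Trades a Gaussian for \<open>1 / (1 + t ^ 2)\<close>, whose primitive is the arctangent.
  A cubic times a quadratic is dominated by the sixth power, the third power of
  \<open>t ^ 2\<close>, so \<open>cube_le_exp\<close> applies.\<close>

lemma gaussian_decay:
  fixes t \<kappa> K1 C1 :: real
  assumes "\<kappa> > 0" "K1 \<ge> 0" "C1 \<ge> 0"
  shows "(K1 * \<bar>t\<bar> ^ 3 + C1) * exp (- \<kappa> * t ^ 2) \<le> (K1 + C1) * (4 * (1 + 27 / \<kappa> ^ 3)) * (1 / (1 + t ^ 2))"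
proof -
  define s where "s = \<bar>t\<bar>"
  have s: "s \<ge> 0" "t ^ 2 = s ^ 2" by (auto simp: s_def)
  have poly: "(1 + s ^ 3) * (1 + s ^ 2) \<le> 4 * (1 + s ^ 6)"
  proof (cases "s \<le> 1")
    case True
    hence "(1 + s ^ 3) * (1 + s ^ 2) \<le> 2 * 2"
      using s by (intro mult_mono add_mono) (auto simp: power_le_one)
    also have "\<dots> \<le> 4 * (1 + s ^ 6)" using s by simp
    finally show ?thesis .
  next
    case False
    have "(1 + s ^ 3) * (1 + s ^ 2) \<le> (2 * s ^ 3) * (2 * s ^ 3)"
    proof (intro mult_mono)
      show "1 + s ^ 3 \<le> 2 * s ^ 3" using False one_le_power[of s 3] by simp
      have "s ^ 2 \<le> s ^ 3" using False by (intro power_increasing) auto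
      thus "1 + s ^ 2 \<le> 2 * s ^ 3" using False one_le_power[of s 3] by linarith
    qed (use s in auto)
    also have "\<dots> = 4 * s ^ 6" by (simp add: power_add[symmetric])
    finally show ?thesis by simp
  qed
  have ex: "(1 + s ^ 6) * exp (- \<kappa> * s ^ 2) \<le> 1 + 27 / \<kappa> ^ 3"
  proof -
    have "(\<kappa> * s ^ 2) ^ 3 \<le> 27 * exp (\<kappa> * s ^ 2)" using assms by (intro cube_le_exp) auto
    hence "\<kappa> ^ 3 * s ^ 6 \<le> 27 * exp (\<kappa> * s ^ 2)" by (simp add: power_mult_distrib power_mult[symmetric])
    hence "s ^ 6 \<le> 27 / \<kappa> ^ 3 * exp (\<kappa> * s ^ 2)" using assms by (simp add: field_simps)
    hence "s ^ 6 * exp (- \<kappa> * s ^ 2) \<le> 27 / \<kappa> ^ 3 * exp (\<kappa> * s ^ 2) * exp (- \<kappa> * s ^ 2)"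
      by (intro mult_right_mono) auto
    also have "\<dots> = 27 / \<kappa> ^ 3" by (simp add: mult.assoc exp_add[symmetric])
    finally have "s ^ 6 * exp (- \<kappa> * s ^ 2) \<le> 27 / \<kappa> ^ 3" .
    moreover have "exp (- \<kappa> * s ^ 2) \<le> 1" using assms by simp
    ultimately show ?thesis unfolding distrib_right by linarith
  qed
  have "(K1 * s ^ 3 + C1) * exp (- \<kappa> * s ^ 2) * (1 + s ^ 2) \<le> ((K1 + C1) * (1 + s ^ 3)) * exp (- \<kappa> * s ^ 2) * (1 + s ^ 2)"
    using assms s by (intro mult_right_mono) (auto simp: algebra_simps)
  also have "\<dots> = (K1 + C1) * exp (- \<kappa> * s ^ 2) * ((1 + s ^ 3) * (1 + s ^ 2))" by (simp only: mult_ac)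
  also have "\<dots> \<le> (K1 + C1) * exp (- \<kappa> * s ^ 2) * (4 * (1 + s ^ 6))"
    using assms by (intro mult_left_mono poly) auto
  also have "\<dots> = (K1 + C1) * 4 * ((1 + s ^ 6) * exp (- \<kappa> * s ^ 2))" by (simp only: mult_ac)
  also have "\<dots> \<le> (K1 + C1) * 4 * (1 + 27 / \<kappa> ^ 3)"
    using assms by (intro mult_left_mono ex) auto
  finally have "(K1 * s ^ 3 + C1) * exp (- \<kappa> * s ^ 2) \<le> (K1 + C1) * 4 * (1 + 27 / \<kappa> ^ 3) / (1 + s ^ 2)"
    by (subst pos_le_divide_eq) (auto simp: add_pos_nonneg)
  also have "\<dots> = (K1 + C1) * (4 * (1 + 27 / \<kappa> ^ 3)) * (1 / (1 + s ^ 2))"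
    by (simp only: mult.assoc times_divide_eq_right mult_1_right)
  finally show ?thesis unfolding s(2) s_def[symmetric] .
qed

text \<open>The second order Taylor expansion at the saddle \<open>\<sigma> = c\<close> with exact
  remainder: the linear term vanishes, the value is \<open>3 / 2 * c\<close>, and the second
  derivative in \<sigma> is \<open>3 / c\<close>.\<close>

lemma phase_expansion:
  fixes c \<sigma> :: complex
  assumes "c \<noteq> 0" "\<sigma> \<noteq> 0" "\<sigma> = c + \<i> * b"
  shows "c ^ 3 / (2 * \<sigma> ^ 2) + \<sigma> = 3 / 2 * c - 3 / (2 * c) * b ^ 2 + \<i> * b ^ 3 * (c + 3 * \<sigma>) / (2 * \<sigma> ^ 2 * c)"
proof -
  have b: "b = - \<i> * (\<sigma> - c)" using assms by simp
  have i: "\<i> * (- \<i> * (\<sigma> - c)) ^ 3 = - ((\<sigma> - c) ^ 3)" "(- \<i> * (\<sigma> - c)) ^ 2 = - ((\<sigma> - c) ^ 2)"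
    by (simp_all only: power_mult_distrib) (simp_all add: power3_eq_cube power2_eq_square)
  show ?thesis
    unfolding b i using assms(1,2)
    by (simp add: divide_simps) (simp add: power2_eq_square power3_eq_cube algebra_simps)
qed

lemma norm_exp_minus_1_le: "norm (exp z - 1) \<le> norm z * exp (norm z)" for z :: complex
  using Taylor_exp_field[of z 0] by (simp add: mult.commute)

lemma Re_inverse_lower_bound:
  assumes "a0 > 0" "a0 \<le> Re c" "norm c \<le> C0"
  shows "Re (3 / (2 * c)) \<ge> 3 * a0 / (2 * C0 ^ 2)"
proof -
  have "c \<noteq> 0" using assms by auto
  have "3 / (2 * c) = of_real (3 / 2) * inverse c" by (simp add: field_simps)
  hence "Re (3 / (2 * c)) = 3 / 2 * (Re c / norm c ^ 2)"
    by (simp only: times_complex.sel Re_complex_of_real Im_complex_of_real inverse_complex.sel cmod_power2)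
  also have "\<dots> \<ge> 3 / 2 * (a0 / C0 ^ 2)"
    using assms \<open>c \<noteq> 0\<close> by (intro mult_left_mono frac_le power_mono) auto
  finally show ?thesis by simp
qed

text \<open>In the scale \<open>t = N * b\<close> the cubic remainder is at most
  \<open>K1 * \<bar>t\<bar> ^ 3 / N\<close>; \<open>K1\<close> comes from \<open>\<sigma>\<close>
  having norm at most \<open>C0 + 1\<close>. The real part of the Gaussian coefficient is at least
  \<open>2 * \<kappa>\<close>, and the choice of \<eta> lets the remainder use up at most half of
  that decay.\<close>

lemma major_pointwise:
  fixes c R :: complex and b N :: real
  assumes a0: "a0 > 0" "a0 \<le> Re c" and C0: "norm c \<le> C0" and N: "N \<ge> 1"
    and \<eta>: "\<bar>b\<bar> \<le> \<eta>" "\<eta> \<le> 1" and R: "norm R \<le> C1 / N"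
  defines "K1 \<equiv> (4 * C0 + 3) / (2 * a0 ^ 3)" and "\<kappa> \<equiv> 3 * a0 / (4 * C0 ^ 2)" and "\<sigma> \<equiv> c + \<i> * of_real b"
  assumes \<eta>K: "K1 * \<eta> \<le> \<kappa>"
  shows "norm (exp (of_real (N ^ 2) * (c ^ 3 / (2 * \<sigma> ^ 2) + \<sigma>) + R)
       - exp (of_real (N ^ 2) * (3 / 2 * c)) * exp (- (3 / (2 * c) * of_real ((N * b) ^ 2))))
    \<le> norm (exp (of_real (N ^ 2) * (3 / 2 * c))) * ((exp C1 * ((K1 + C1) * (4 * (1 + 27 / \<kappa> ^ 3)))) / N) * (1 / (1 + (N * b) ^ 2))"
proof -
  define t where "t = N * b"
  have c0: "c \<noteq> 0" using a0 by auto
  have Re\<sigma>: "Re \<sigma> = Re c" by (simp add: \<sigma>_def)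
  have \<sigma>0: "\<sigma> \<noteq> 0" using a0 Re\<sigma> by auto
  have na: "a0 \<le> norm c" "a0 \<le> norm \<sigma>"
    using a0 complex_Re_le_cmod[of c] complex_Re_le_cmod[of \<sigma>] Re\<sigma> by auto
  have C0pos: "C0 > 0" using na C0 a0 by linarith
  have C1: "C1 \<ge> 0" using order_trans[OF norm_ge_zero R] N by (simp add: zero_le_divide_iff)
  have K1: "K1 \<ge> 0" using C0pos a0 by (simp add: K1_def)
  have \<kappa>: "\<kappa> > 0" using C0pos a0 by (simp add: \<kappa>_def)
  define Y where "Y = \<i> * of_real b ^ 3 * (c + 3 * \<sigma>) / (2 * \<sigma> ^ 2 * c)"
  define D where "D = of_real (N ^ 2) * Y + R"
  have Y: "norm Y \<le> K1 * \<bar>b\<bar> ^ 3"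
  proof -
    have "norm \<sigma> \<le> norm c + 1" unfolding \<sigma>_def using \<eta> norm_triangle_ineq[of c "\<i> * of_real b"] by (simp add: norm_mult)
    hence 1: "norm (c + 3 * \<sigma>) \<le> 4 * C0 + 3"
      using norm_triangle_ineq[of c "3 * \<sigma>"] C0 by (simp add: norm_mult)
    have "norm Y = \<bar>b\<bar> ^ 3 * norm (c + 3 * \<sigma>) / (2 * norm \<sigma> ^ 2 * norm c)"
      by (simp add: Y_def norm_mult norm_divide norm_power)
    also have "\<dots> \<le> \<bar>b\<bar> ^ 3 * (4 * C0 + 3) / (2 * a0 ^ 2 * a0)"
      using na a0 1 C0pos by (intro frac_le mult_mono power_mono mult_pos_pos) auto
    also have "\<dots> = K1 * \<bar>b\<bar> ^ 3" by (simp add: K1_def power2_eq_square power3_eq_cube mult_ac)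
    finally show ?thesis .
  qed
  have NY: "norm (of_real (N ^ 2) * Y) \<le> K1 * \<bar>t\<bar> ^ 3 / N"
  proof -
    have "norm (of_real (N ^ 2) * Y) \<le> N ^ 2 * (K1 * \<bar>b\<bar> ^ 3)"
      unfolding norm_mult norm_of_real using Y by (simp add: mult_left_mono)
    also have "\<dots> = K1 * \<bar>t\<bar> ^ 3 / N"
      using N by (simp add: t_def abs_mult power_mult_distrib power2_eq_square power3_eq_cube)
    finally show ?thesis .
  qed
  have NY2: "K1 * \<bar>t\<bar> ^ 3 / N \<le> \<kappa> * t ^ 2"
  proof -
    have "K1 * \<bar>t\<bar> ^ 3 / N = K1 * \<bar>b\<bar> * t ^ 2"
      using N by (simp add: t_def abs_mult power_mult_distrib power2_eq_square power3_eq_cube)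
    also have "\<dots> \<le> K1 * \<eta> * t ^ 2" using K1 \<eta> by (intro mult_right_mono mult_left_mono) auto
    also have "\<dots> \<le> \<kappa> * t ^ 2" using \<eta>K by (intro mult_right_mono) auto
    finally show ?thesis .
  qed
  have RC: "norm R \<le> C1" using R N C1 by (smt (verit) divide_le_eq mult_left_le mult_le_cancel_left1)
  have D1: "norm D \<le> (K1 * \<bar>t\<bar> ^ 3 + C1) / N"
    using norm_triangle_ineq[of "of_real (N ^ 2) * Y" R] NY R unfolding D_def add_divide_distrib by linarith
  have D2: "norm D \<le> \<kappa> * t ^ 2 + C1"
    using norm_triangle_ineq[of "of_real (N ^ 2) * Y" R] NY NY2 RC unfolding D_def by linarith
  have Rew: "Re (3 / (2 * c)) \<ge> 2 * \<kappa>"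
    using Re_inverse_lower_bound[OF a0 C0] by (simp add: \<kappa>_def)
  define G where "G = exp (- (3 / (2 * c) * of_real (t ^ 2)))"
  have nG: "norm G \<le> exp (- (2 * \<kappa> * t ^ 2))"
  proof -
    have "Re (3 / (2 * c) * of_real (t ^ 2)) = Re (3 / (2 * c)) * t ^ 2"
      by (simp only: times_complex.sel Re_complex_of_real Im_complex_of_real mult_zero_right diff_zero)
    thus ?thesis
      using mult_right_mono[OF Rew, of "t ^ 2"]
      by (simp only: G_def norm_exp_eq_Re uminus_complex.sel exp_le_cancel_iff neg_le_iff_le zero_le_power2)
  qed
  have "of_real (N ^ 2) * (c ^ 3 / (2 * \<sigma> ^ 2) + \<sigma>) + R = of_real (N ^ 2) * (3 / 2 * c) + (- (3 / (2 * c) * of_real (t ^ 2))) + D"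
    unfolding phase_expansion[OF c0 \<sigma>0 \<sigma>_def[THEN meta_eq_to_obj_eq]] D_def Y_def t_def power_mult_distrib of_real_mult of_real_power
    by (simp add: algebra_simps)
  hence "exp (of_real (N ^ 2) * (c ^ 3 / (2 * \<sigma> ^ 2) + \<sigma>) + R) = exp (of_real (N ^ 2) * (3 / 2 * c)) * G * exp D"
    by (simp only: exp_add G_def)
  hence "exp (of_real (N ^ 2) * (c ^ 3 / (2 * \<sigma> ^ 2) + \<sigma>) + R) - exp (of_real (N ^ 2) * (3 / 2 * c)) * G
      = exp (of_real (N ^ 2) * (3 / 2 * c)) * (G * (exp D - 1))"
    by (simp add: algebra_simps)
  hence "norm (exp (of_real (N ^ 2) * (c ^ 3 / (2 * \<sigma> ^ 2) + \<sigma>) + R) - exp (of_real (N ^ 2) * (3 / 2 * c)) * G)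
      = norm (exp (of_real (N ^ 2) * (3 / 2 * c))) * norm (G * (exp D - 1))"
    by (simp only: norm_mult)
  also have "norm (G * (exp D - 1)) \<le> (exp C1 * ((K1 + C1) * (4 * (1 + 27 / \<kappa> ^ 3)))) / N * (1 / (1 + t ^ 2))"
  proof -
    have "norm (G * (exp D - 1)) \<le> exp (- (2 * \<kappa> * t ^ 2)) * (norm D * exp (norm D))"
      unfolding norm_mult by (intro mult_mono nG norm_exp_minus_1_le) auto
    also have "\<dots> \<le> exp (- (2 * \<kappa> * t ^ 2)) * ((K1 * \<bar>t\<bar> ^ 3 + C1) / N * exp (\<kappa> * t ^ 2 + C1))"
      using D1 D2 K1 C1 N by (intro mult_left_mono mult_mono) auto
    also have "\<dots> = exp C1 / N * ((K1 * \<bar>t\<bar> ^ 3 + C1) * exp (- \<kappa> * t ^ 2))"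
    proof -
      have "exp (- (2 * \<kappa> * t ^ 2)) * exp (\<kappa> * t ^ 2 + C1) = exp C1 * exp (- \<kappa> * t ^ 2)"
        by (simp add: exp_add[symmetric])
      thus ?thesis by (simp add: mult_ac)
    qed
    also have "\<dots> \<le> exp C1 / N * ((K1 + C1) * (4 * (1 + 27 / \<kappa> ^ 3)) * (1 / (1 + t ^ 2)))"
      using N by (intro mult_left_mono gaussian_decay \<kappa> K1 C1) auto
    finally show ?thesis by (simp add: mult_ac)
  qed
  finally show ?thesis unfolding G_def t_def by (simp add: mult.assoc mult_left_mono)
qed

section \<open>Uniform asymptotics\<close>

text \<open>Common to both phases. The hypothesis on roots allows no primitive \<open>q\<close>-th
  root other than \<open>\<epsilon>\<close>; it serves \<open>q = 1\<close> with 1 and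
  \<open>q = 2\<close> with -1. \<open>B\<close> is the part of the exponent that does not depend on
  \<open>s\<close>.\<close>

lemma saddle_asymptotics:
  fixes X :: "complex set" and B :: "complex \<Rightarrow> complex"
  assumes X: "compact X" "X \<noteq> {}" "\<And>x. x \<in> X \<Longrightarrow> norm x < 1"
    and cont: "continuous_on X (L q)" and q: "q > 0"
    and pos: "\<And>x. x \<in> X \<Longrightarrow> Re (L q x) > 0"
    and sector: "\<And>x. x \<in> X \<Longrightarrow> Im (L q x) ^ 2 < 3 * Re (L q x) ^ 2"
    and dom: "\<And>x k. x \<in> X \<Longrightarrow> k \<ge> 1 \<Longrightarrow> k \<noteq> q \<Longrightarrow> Re (L k x) < Re (L q x)"
    and eps: "norm \<epsilon> = 1"
    and root: "\<And>u. u ^ q = 1 \<Longrightarrow> (\<And>j. 0 < j \<Longrightarrow> j < q \<Longrightarrow> u ^ j \<noteq> 1) \<Longrightarrow> u = \<epsilon>"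
    and expansion: "\<And>M. \<exists>C. \<forall>x\<in>X. \<forall>s\<in>cone M. norm (log_gf x (\<epsilon> * exp (- s)) - (L q x ^ 3 / (2 * s ^ 2) + B x)) \<le> C * norm s"
    and B: "continuous_on X B"
  defines "Mn \<equiv> (\<lambda>n x. exp (B x) * csqrt (L q x / of_real (6 * pi * real n powr (4 / 3)))
                        * exp (3 / 2 * of_real (real n powr (2 / 3)) * L q x))"
  shows "\<exists>K N0. \<forall>n>0. real n powr (1 / 3) \<ge> N0 \<longrightarrow>
           (\<forall>x\<in>X. norm (\<epsilon> ^ n * Q n x - Mn n x) \<le> norm (Mn n x) * (K / real n powr (1 / 3)))"
proof -
  obtain a0 where a0: "a0 > 0" "\<And>x. x \<in> X \<Longrightarrow> a0 \<le> Re (L q x)"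
    using continuous_attains_inf[OF X(1,2), of "\<lambda>x. Re (L q x)"] pos cont by (metis continuous_on_Re)
  obtain C0 where C0: "\<And>x. x \<in> X \<Longrightarrow> norm (L q x) \<le> C0"
    using continuous_attains_sup[OF X(1,2), of "\<lambda>x. norm (L q x)"] cont by (metis continuous_on_norm)
  obtain B0 where B0: "\<And>x. x \<in> X \<Longrightarrow> norm (B x) \<le> B0"
    using continuous_attains_sup[OF X(1,2), of "\<lambda>x. norm (B x)"] B by (metis continuous_on_norm)
  have C0pos: "C0 > 0"
  proof -
    obtain x where "x \<in> X" using X(2) by blast
    thus ?thesis using a0 C0[of x] complex_Re_le_cmod[of "L q x"] by force
  qed
  define K1 where "K1 = (4 * C0 + 3) / (2 * a0 ^ 3)"
  define \<kappa> where "\<kappa> = 3 * a0 / (4 * C0 ^ 2)"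
  have K1: "K1 > 0" and \<kappa>: "\<kappa> > 0" using C0pos a0 by (auto simp: K1_def \<kappa>_def)
  define \<eta> where "\<eta> = min 1 (\<kappa> / K1)"
  have \<eta>: "\<eta> > 0" "\<eta> \<le> 1" using K1 \<kappa> by (auto simp: \<eta>_def)
  have \<eta>K: "K1 * \<eta> \<le> \<kappa>"
  proof -
    have "K1 * \<eta> \<le> K1 * (\<kappa> / K1)" using K1 by (intro mult_left_mono) (auto simp: \<eta>_def)
    thus ?thesis using K1 by simp
  qed
  \<comment> \<open>On the major arc \<open>norm s\<close> is at most \<open>(C0 + 1) / N\<close>,
    while \<open>Re s\<close> is at least \<open>a0 / N\<close>.\<close>
  define M where "M = (C0 + 1) / a0"
  obtain C where C: "\<And>x s. x \<in> X \<Longrightarrow> s \<in> cone M \<Longrightarrow> norm (log_gf x (\<epsilon> * exp (- s)) - (L q x ^ 3 / (2 * s ^ 2) + B x)) \<le> C * norm s"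
    using expansion[of M] by blast
  define C1 where "C1 = \<bar>C\<bar> * (C0 + 1)"
  have C1: "C1 \<ge> 0" using C0pos by (simp add: C1_def)
  obtain \<delta> N1 where \<delta>: "\<delta> > 0" and minor: "\<And>N x v. N \<ge> N1 \<Longrightarrow> x \<in> X \<Longrightarrow> v \<in> {-pi..pi} \<Longrightarrow> \<bar>N * v - Im (L q x)\<bar> \<ge> \<eta> \<Longrightarrow>
     Re (log_gf x (\<epsilon> * exp (- (of_real (Re (L q x) / N) + \<i> * of_real v)))) \<le> (Re (L q x) / 2 - \<delta>) * N ^ 2"
    using minor_arcs[OF X cont q pos sector dom eps root \<eta>(1)] by blast
  define K2 where "K2 = exp C1 * ((K1 + C1) * (4 * (1 + 27 / \<kappa> ^ 3)))"
  \<comment> \<open>The minor arc bound lacks the factor \<open>exp (B x)\<close> of the main term;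
    \<open>exp B0\<close> compensates for it. The rest is \<open>cube_le_exp\<close> applied to
    \<open>\<delta> * N ^ 2\<close>.\<close>
  define K3 where "K3 = exp B0 * (27 / \<delta> ^ 3)"
  have K23: "K2 \<ge> 0" "K3 \<ge> 0" using K1 C1 \<kappa> \<delta> by (auto simp: K2_def K3_def)
  define K4 where "K4 = K2 * pi + 4 * pi * K3 + 2 / (2 * \<kappa> * \<eta>)"
  have K4: "K4 \<ge> 0" using K23 \<kappa> \<eta> by (simp add: K4_def)
  \<comment> \<open>The square root of \<open>3 / (2 * a0)\<close> bounds \<open>csqrt w\<close>,
    which appears when the error is divided by the Gaussian main term.\<close>
  define K where "K = sqrt (3 / (2 * a0)) / sqrt pi * K4"
  \<comment> \<open>The last entry keeps the window around the saddle inside the interval from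
    -\<pi> to \<pi>.\<close>
  define N0 where "N0 = max N1 (max 1 ((C0 + 1) / pi))"
  have "norm (\<epsilon> ^ n * Q n x - Mn n x) \<le> norm (Mn n x) * (K / real n powr (1 / 3))"
    if n: "n > 0" and nN: "real n powr (1 / 3) \<ge> N0" and x: "x \<in> X" for n x
  proof -
    define N where "N = real n powr (1 / 3)"
    have N: "N \<ge> N1" "N \<ge> 1" "(C0 + 1) / pi \<le> N" using nN by (auto simp: N_def N0_def)
    have Npos: "N > 0" using N by simp
    have Npow: "N ^ k = real n powr (real k / 3)" for k
      using powr_realpow[OF Npos, of k] by (simp add: N_def powr_powr)
    have N3: "N ^ 3 = real n" using Npow[of 3] n by simp
    define c where "c = L q x"
    define a where "a = Re c"
    have a: "a > 0" "a0 \<le> a" "a0 \<le> Re c" and nc: "norm c \<le> C0"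
      using pos[OF x] a0(2)[OF x] C0[OF x] by (auto simp: a_def c_def)
    have c0: "c \<noteq> 0" using a by (auto simp: a_def)
    define w where "w = 3 / (2 * c)"
    have Rew: "Re w \<ge> 2 * \<kappa>"
      using Re_inverse_lower_bound[OF a0(1) a(3) nc] by (simp add: w_def \<kappa>_def)
    hence Rew0: "Re w > 0" using \<kappa> by linarith
    define v0 where "v0 = Im c / N"
    define E0 where "E0 = exp (B x) * exp (of_real (N ^ 2) * (3 / 2 * c))"
    define f where "f = (\<lambda>v::real. exp (log_gf x (\<epsilon> * exp (- (of_real (a / N) + \<i> * of_real v))) + of_nat n * (of_real (a / N) + \<i> * of_real v)))"
    define I where "I = 2 * of_real pi * (\<epsilon> ^ n * Q n x)"
    have f: "(f has_integral I) {-pi..pi}"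
      unfolding f_def I_def trace_poly_eq_Q[OF n, symmetric]
      by (rule trace_poly_integral[OF X(3)[OF x] _ eps]) (use a Npos in simp)
    have v0: "-pi \<le> v0 - \<eta> / N" "v0 + \<eta> / N \<le> pi"
    proof -
      have "\<bar>v0\<bar> + \<eta> / N = (\<bar>Im c\<bar> + \<eta>) / N" using Npos by (simp add: v0_def add_divide_distrib)
      also have "\<dots> \<le> (C0 + 1) / N"
        using Npos nc abs_Im_le_cmod[of c] \<eta> by (intro divide_right_mono) auto
      also have "\<dots> \<le> pi" using N(3) Npos by (simp add: field_simps)
      finally show "-pi \<le> v0 - \<eta> / N" "v0 + \<eta> / N \<le> pi" by linarith+
    qed
    have major: "norm (f v - E0 * exp (- (w * of_real ((N ^ 2 * (v - v0)) ^ 2)))) \<le> norm E0 * (K2 / N) * (1 / (1 + (N ^ 2 * (v - v0)) ^ 2))"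
      if v: "\<bar>v - v0\<bar> \<le> \<eta> / N" for v
    proof -
      define b where "b = N * (v - v0)"
      have "\<bar>b\<bar> = N * \<bar>v - v0\<bar>" using Npos by (simp add: b_def abs_mult)
      hence b: "\<bar>b\<bar> \<le> \<eta>" using v Npos by (simp add: pos_le_divide_eq mult.commute)
      have Nb: "N ^ 2 * (v - v0) = N * b" by (simp add: b_def power2_eq_square)
      define s where "s = of_real (a / N) + \<i> * of_real v"
      define \<sigma> where "\<sigma> = c + \<i> * of_real b"
      \<comment> \<open>In the scaled variable the saddle sits at \<open>c\<close>, independently of
        \<open>n\<close>.\<close>
      have \<sigma>s: "\<sigma> = of_real N * s"
        using Npos by (simp add: complex_eq_iff \<sigma>_def s_def b_def v0_def a_def field_simps)
      have "norm \<sigma> \<le> C0 + 1"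
        unfolding \<sigma>_def using norm_triangle_ineq[of c "\<i> * of_real b"] nc b \<eta> by (simp add: norm_mult)
      hence ns: "norm s \<le> (C0 + 1) / N"
        using Npos by (simp add: \<sigma>s norm_mult field_simps)
      have "s \<in> cone M"
      proof -
        have "(C0 + 1) / N = M * (a0 / N)" using a0 by (simp add: M_def)
        also have "\<dots> \<le> M * (a / N)"
          using a0 C0pos a Npos by (intro mult_left_mono divide_right_mono) (auto simp: M_def)
        finally show ?thesis using ns a Npos by (simp add: cone_def s_def)
      qed
      define R where "R = log_gf x (\<epsilon> * exp (- s)) - (c ^ 3 / (2 * s ^ 2) + B x)"
      have R: "norm R \<le> C1 / N"
      proof -
        have "norm R \<le> C * norm s" using C[OF x \<open>s \<in> cone M\<close>] by (simp add: R_def c_def)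
        also have "\<dots> \<le> \<bar>C\<bar> * ((C0 + 1) / N)" using ns by (intro mult_mono) auto
        finally show ?thesis by (simp add: C1_def)
      qed
      have s0: "s \<noteq> 0" using a Npos by (auto simp: s_def complex_eq_iff)
      \<comment> \<open>With \<open>n = N ^ 3\<close> the polar part and the linear term both scale
        with \<open>N ^ 2\<close>.\<close>
      have "log_gf x (\<epsilon> * exp (- s)) + of_nat n * s = B x + (of_real (N ^ 2) * (c ^ 3 / (2 * \<sigma> ^ 2) + \<sigma>) + R)"
      proof -
        have "of_nat n = (of_real (N ^ 3) :: complex)" by (simp add: N3)
        hence "of_nat n * s = of_real (N ^ 2) * \<sigma>" by (simp add: \<sigma>s power2_eq_square power3_eq_cube)
        moreover have "of_real (N ^ 2) * (c ^ 3 / (2 * \<sigma> ^ 2)) = c ^ 3 / (2 * s ^ 2)"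
          using Npos s0 by (simp add: \<sigma>s power_mult_distrib)
        ultimately show ?thesis by (simp add: R_def distrib_left)
      qed
      hence fv: "f v = exp (B x) * exp (of_real (N ^ 2) * (c ^ 3 / (2 * \<sigma> ^ 2) + \<sigma>) + R)"
        unfolding f_def s_def[symmetric] by (simp only: exp_add)
      have "norm (f v - E0 * exp (- (w * of_real ((N * b) ^ 2))))
          = norm (exp (B x)) * norm (exp (of_real (N ^ 2) * (c ^ 3 / (2 * \<sigma> ^ 2) + \<sigma>) + R)
              - exp (of_real (N ^ 2) * (3 / 2 * c)) * exp (- (w * of_real ((N * b) ^ 2))))"
        unfolding fv E0_def norm_mult[symmetric] right_diff_distrib mult.assoc ..
      also have "\<dots> \<le> norm (exp (B x)) * (norm (exp (of_real (N ^ 2) * (3 / 2 * c))) * (K2 / N) * (1 / (1 + (N * b) ^ 2)))"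
        unfolding w_def \<sigma>_def K2_def K1_def \<kappa>_def
        by (intro mult_left_mono major_pointwise[OF a0(1) a(3) nc N(2) b \<eta>(2) R \<eta>K[unfolded K1_def \<kappa>_def]]) simp
      also have "\<dots> = norm E0 * (K2 / N) * (1 / (1 + (N * b) ^ 2))"
        unfolding E0_def norm_mult by (simp only: mult.assoc)
      finally show ?thesis unfolding Nb .
    qed
    have minor': "norm (f v) \<le> norm E0 * (K3 / N ^ 3)" if v: "v \<in> {-pi..pi}" "\<bar>v - v0\<bar> \<ge> \<eta> / N" for v
    proof -
      have "\<bar>N * v - Im c\<bar> = N * \<bar>v - v0\<bar>"
      proof -
        have "N * v - Im c = N * (v - v0)" using Npos by (simp add: v0_def right_diff_distrib)
        thus ?thesis using Npos by (simp add: abs_mult)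
      qed
      also have "\<dots> \<ge> \<eta>" using v(2) Npos by (simp add: field_simps)
      finally have "Re (log_gf x (\<epsilon> * exp (- (of_real (a / N) + \<i> * of_real v)))) \<le> (a / 2 - \<delta>) * N ^ 2"
        using minor[OF N(1) x v(1)] by (simp add: c_def a_def)
      moreover have "Re (of_nat n * (of_real (a / N) + \<i> * of_real v)) = a * N ^ 2"
      proof -
        have "Re (of_nat n * (of_real (a / N) + \<i> * of_real v)) = N ^ 3 * (a / N)" by (simp add: N3)
        thus ?thesis using Npos by (simp add: power2_eq_square power3_eq_cube)
      qed
      ultimately have "norm (f v) \<le> exp ((a / 2 - \<delta>) * N ^ 2 + a * N ^ 2)"
        unfolding f_def norm_exp_eq_Re plus_complex.sel(1) by simp
      also have "\<dots> = exp (N ^ 2 * (3 / 2 * a)) * exp (- (\<delta> * N ^ 2))"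
        by (simp add: exp_add[symmetric] algebra_simps)
      also have "\<dots> \<le> exp (N ^ 2 * (3 / 2 * a)) * ((exp B0 * norm (exp (B x))) * (27 / \<delta> ^ 3 / N ^ 3))"
      proof (intro mult_left_mono)
        \<comment> \<open>The exponential gain is weakened to the power of \<open>N\<close> that
          matches the error of the major arc.\<close>
        have "exp (- (\<delta> * N ^ 2)) \<le> 27 / (\<delta> * N ^ 2) ^ 3"
          using cube_le_exp[of "\<delta> * N ^ 2"] \<delta> Npos by (simp add: exp_minus field_simps)
        also have "\<dots> = 27 / \<delta> ^ 3 / N ^ 6" by (simp add: power_mult_distrib power_mult[symmetric])
        also have "\<dots> \<le> 27 / \<delta> ^ 3 / N ^ 3"
          using \<delta> N by (intro divide_left_mono power_increasing mult_pos_pos) auto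
        finally have 1: "exp (- (\<delta> * N ^ 2)) \<le> 27 / \<delta> ^ 3 / N ^ 3" .
        have "0 \<le> B0 + Re (B x)" using B0[OF x] abs_Re_le_cmod[of "B x"] by linarith
        hence "1 \<le> exp B0 * norm (exp (B x))" by (simp add: exp_add[symmetric])
        hence "1 * (27 / \<delta> ^ 3 / N ^ 3) \<le> (exp B0 * norm (exp (B x))) * (27 / \<delta> ^ 3 / N ^ 3)"
          using \<delta> Npos by (intro mult_right_mono) auto
        thus "exp (- (\<delta> * N ^ 2)) \<le> (exp B0 * norm (exp (B x))) * (27 / \<delta> ^ 3 / N ^ 3)" using 1 by linarith
      qed simp
      also have "\<dots> = norm E0 * (K3 / N ^ 3)"
      proof -
        have "norm (exp (of_real (N ^ 2) * (3 / 2 * c))) = exp (N ^ 2 * (3 / 2 * a))"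
          unfolding norm_exp_eq_Re a_def by (simp add: power2_eq_square)
        thus ?thesis by (simp add: E0_def norm_mult K3_def mult_ac a_def)
      qed
      finally show ?thesis .
    qed
    define G where "G = E0 * (of_real (sqrt pi) / (csqrt w * of_real (N ^ 2)))"
    have "norm (I - G) \<le> norm E0 / N ^ 3 * (K2 * pi + 4 * pi * K3 + 2 / (Re w * \<eta>))"
      unfolding G_def by (rule saddle_integral[OF f Rew0 Npos \<eta>(1) v0 major minor' K23])
    also have "\<dots> \<le> norm E0 / N ^ 3 * K4"
    proof -
      have "2 / (Re w * \<eta>) \<le> 2 / (2 * \<kappa> * \<eta>)"
        using Rew \<kappa> \<eta> by (intro divide_left_mono mult_right_mono mult_pos_pos) auto
      thus ?thesis using Npos by (intro mult_left_mono) (auto simp: K4_def)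
    qed
    also have "\<dots> \<le> norm G * (K / N)"
    proof -
      have "norm w = 3 / (2 * norm c)" by (simp add: w_def norm_divide norm_mult)
      also have "\<dots> \<le> 3 / (2 * a0)"
        using a0 a complex_Re_le_cmod[of c] c0 by (intro divide_left_mono) auto
      finally have "norm w \<le> 3 / (2 * a0)" .
      hence nb: "norm (csqrt w) \<le> sqrt (3 / (2 * a0))" by (simp add: norm_csqrt)
      have w0: "csqrt w \<noteq> 0" using Rew0 by auto
      have "norm E0 / N ^ 3 * K4 = norm E0 * (sqrt pi / (norm (csqrt w) * N ^ 2)) * (norm (csqrt w) / sqrt pi * K4 / N)"
        using w0 Npos by (simp add: power2_eq_square power3_eq_cube)
      also have "\<dots> \<le> norm E0 * (sqrt pi / (norm (csqrt w) * N ^ 2)) * (sqrt (3 / (2 * a0)) / sqrt pi * K4 / N)"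
        using nb K4 Npos by (intro mult_left_mono divide_right_mono mult_right_mono) auto
      also have "\<dots> = norm G * (K / N)"
        using Npos by (simp add: G_def K_def norm_mult norm_divide norm_power)
      finally show ?thesis .
    qed
    finally have IG: "norm (I - G) \<le> norm G * (K / N)" .
    have Mn_eq: "Mn n x = G / (2 * of_real pi)"
    proof -
      have Reb: "Re (csqrt w) > 0" by (rule Re_csqrt_pos[OF Rew0])
      define z where "z = of_real (1 / (2 * sqrt pi * N ^ 2)) * inverse (csqrt w)"
      \<comment> \<open>The Gaussian yields the reciprocal of the root of
        \<open>3 / (2 * c)\<close>, the theorem the root of a multiple of \<open>c\<close>. Their
        squares agree, and the positive real part identifies the principal branch.\<close>
      have "csqrt (c / of_real (6 * pi * N ^ 4)) = z"
      proof (rule csqrt_unique)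
        have "z ^ 2 = of_real (1 / (2 * sqrt pi * N ^ 2)) ^ 2 * inverse w"
          by (simp only: z_def power_mult_distrib power_inverse power2_csqrt)
        also have "of_real (1 / (2 * sqrt pi * N ^ 2)) ^ 2 = (of_real (1 / (4 * pi * N ^ 4)) :: complex)"
          unfolding of_real_power[symmetric] by (simp add: power_divide power_mult_distrib power_mult[symmetric])
        also have "\<dots> * inverse w = c / of_real (6 * pi * N ^ 4)"
          using c0 Npos by (simp add: w_def field_simps)
        finally show "z ^ 2 = c / of_real (6 * pi * N ^ 4)" .
        have "Re z = 1 / (2 * sqrt pi * N ^ 2) * Re (inverse (csqrt w))"
          by (simp only: z_def times_complex.sel Re_complex_of_real Im_complex_of_real mult_zero_left diff_zero)
        also have "Re (inverse (csqrt w)) = Re (csqrt w) / (Re (csqrt w) ^ 2 + Im (csqrt w) ^ 2)"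
          by (rule inverse_complex.sel)
        finally show "0 < Re z \<or> Re z = 0 \<and> 0 \<le> Im z"
          using Reb Npos by (simp add: add_pos_nonneg del: csqrt.simps)
      qed
      moreover have "real n powr (4 / 3) = N ^ 4" "real n powr (2 / 3) = N ^ 2"
        using Npow[of 4] Npow[of 2] by auto
      moreover have "sqrt pi / (2 * pi) = 1 / (2 * sqrt pi)"
        by (simp add: field_simps)
      hence "1 / (2 * sqrt pi * N ^ 2) = sqrt pi / (2 * pi) / N ^ 2"
        by (simp only: divide_divide_eq_left)
      hence z_eq: "z = of_real (sqrt pi / (2 * pi) / N ^ 2) * inverse (csqrt w)"
        by (simp only: z_def)
      have X: "of_real (sqrt pi) / (csqrt w * of_real (N ^ 2)) / (2 * of_real pi) = z"
      proof -
        have "p / (b * m) / (2 * r) = p / (2 * r) / m * inverse b" for p b m r :: complex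
          by (simp only: divide_inverse inverse_mult_distrib mult_ac)
        thus ?thesis unfolding z_eq by (simp only: of_real_divide of_real_mult of_real_numeral)
      qed
      have "G / (2 * of_real pi) = E0 * z" unfolding G_def X[symmetric] by (rule times_divide_eq_right[symmetric])
      ultimately show ?thesis by (simp only: Mn_def E0_def c_def[symmetric] mult_ac)
    qed
    have "\<epsilon> ^ n * Q n x - Mn n x = (I - G) / (2 * of_real pi)"
      by (simp add: Mn_eq I_def diff_divide_distrib)
    hence "norm (\<epsilon> ^ n * Q n x - Mn n x) = norm (I - G) / (2 * pi)"
      by (simp add: norm_divide norm_mult)
    also have "\<dots> \<le> norm G * (K / N) / (2 * pi)"
      using IG by (intro divide_right_mono) auto
    also have "\<dots> = norm (Mn n x) * (K / N)"
      by (simp add: Mn_eq norm_divide norm_mult)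
    finally show ?thesis by (simp add: N_def)
  qed
  thus ?thesis by blast
qed

text \<open>Since \<open>\<epsilon>\<close> is its own inverse, \<open>\<epsilon> ^ n\<close> can be
  moved to the other side; \<open>E\<close> is a quotient, so the main term must not vanish on
  \<open>X\<close>.\<close>

lemma relative_error:
  fixes Mn :: "nat \<Rightarrow> complex \<Rightarrow> complex" and \<epsilon> :: complex
  assumes "\<exists>K N0. \<forall>n>0. real n powr (1 / 3) \<ge> N0 \<longrightarrow>
      (\<forall>x\<in>X. norm (\<epsilon> ^ n * Q n x - Mn n x) \<le> norm (Mn n x) * (K / real n powr (1 / 3)))"
    and nz: "\<And>n x. n > 0 \<Longrightarrow> x \<in> X \<Longrightarrow> Mn n x \<noteq> 0" and eps: "\<epsilon> * \<epsilon> = 1"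
  shows "\<exists>(C :: real) E. \<forall>\<^sub>F n in sequentially. \<forall>x\<in>X.
      Q n x = \<epsilon> ^ n * Mn n x * (1 + E n x) \<and> norm (E n x) \<le> C * real n powr (- 1 / 3)"
proof -
  obtain K N0 where KN: "\<And>n x. n > 0 \<Longrightarrow> real n powr (1 / 3) \<ge> N0 \<Longrightarrow> x \<in> X \<Longrightarrow>
      norm (\<epsilon> ^ n * Q n x - Mn n x) \<le> norm (Mn n x) * (K / real n powr (1 / 3))"
    using assms(1) by blast
  define E where "E = (\<lambda>n x. \<epsilon> ^ n * Q n x / Mn n x - 1)"
  have "filterlim (\<lambda>n. real n powr (1 / 3)) at_top sequentially" by real_asymp
  hence "\<forall>\<^sub>F n in sequentially. real n powr (1 / 3) \<ge> N0" by (simp add: filterlim_at_top)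
  hence "\<forall>\<^sub>F n in sequentially. \<forall>x\<in>X. Q n x = \<epsilon> ^ n * Mn n x * (1 + E n x) \<and> norm (E n x) \<le> K * real n powr (- 1 / 3)"
    using eventually_gt_at_top[of 0]
  proof eventually_elim
    case (elim n)
    show ?case
    proof
      fix x assume x: "x \<in> X"
      have M: "Mn n x \<noteq> 0" using nz elim x by blast
      have "\<epsilon> ^ n * \<epsilon> ^ n = 1" using eps by (simp add: power_mult_distrib[symmetric])
      hence "Q n x = \<epsilon> ^ n * Mn n x * (1 + E n x)"
        using M by (simp add: E_def mult.assoc[symmetric])
      moreover have "norm (E n x) = norm (\<epsilon> ^ n * Q n x - Mn n x) / norm (Mn n x)"
        using M by (simp add: E_def norm_divide[symmetric] diff_divide_distrib)
      hence "norm (E n x) \<le> K / real n powr (1 / 3)"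
        using KN[OF elim(2,1) x] M by (simp add: divide_le_eq mult.commute)
      hence "norm (E n x) \<le> K * real n powr (- 1 / 3)"
        by (simp add: powr_minus_divide)
      ultimately show "Q n x = \<epsilon> ^ n * Mn n x * (1 + E n x) \<and> norm (E n x) \<le> K * real n powr (- 1 / 3)" by blast
    qed
  qed
  thus ?thesis by blast
qed

lemma L_sector_strict:
  assumes "2 * Li3 (x ^ q) \<notin> \<real>\<^sub>\<le>\<^sub>0" "q > 0"
  shows "Im (L q x) ^ 2 < 3 * Re (L q x) ^ 2"
  using cube_root_sector(2)[OF assms(1)] assms(2) by (simp add: L_def power_divide divide_strict_right_mono)

lemma one_minus_not_nonpos: "norm (z::complex) < 1 \<Longrightarrow> 1 - z \<notin> \<real>\<^sub>\<le>\<^sub>0"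
  using abs_Re_le_cmod[of z] by (auto simp: complex_nonpos_Reals_iff)

theorem asymptotics_phase1:
  assumes X: "compact X" "X \<subseteq> phase 1 - complex_of_real ` {xstar..0}"
  shows "\<exists>(C :: real) (E :: nat \<Rightarrow> complex \<Rightarrow> complex).
              \<forall>\<^sub>F n in sequentially. \<forall>x \<in> X.
                Q n x = (1 - x) powr (1 / 12)
                        * csqrt (L 1 x / of_real (6 * pi * real n powr (4 / 3)))
                        * exp (3 / 2 * of_real (real n powr (2 / 3)) * L 1 x)
                        * (1 + E n x) \<and>
                norm (E n x) \<le> C * real n powr (- 1 / 3)"
proof (cases "X = {}")
  case False
  have ph: "x \<in> phase 1" "x \<notin> complex_of_real ` {xstar..0}" if "x \<in> X" for x using X that by auto
  have lt: "norm x < 1" if "x \<in> X" for x using phaseD(2)[OF ph(1)[OF that]] .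
  have pos: "Re (L 1 x) > 0" if "x \<in> X" for x using phase_Re_pos[OF ph(1)[OF that]] .
  have nonpos: "2 * Li3 (x ^ 1) \<notin> \<real>\<^sub>\<le>\<^sub>0" if "x \<in> X" for x using Li3_phase1[OF ph[OF that]] by simp
  obtain r where r: "r < 1" "\<And>x. x \<in> X \<Longrightarrow> norm x \<le> r" using compact_norm_bound[OF X(1) False lt] by blast
  define B where "B = (\<lambda>x. Ln (1 - x) / 12)"
  define Mn where "Mn = (\<lambda>n x. exp (B x) * csqrt (L 1 x / of_real (6 * pi * real n powr (4 / 3)))
                        * exp (3 / 2 * of_real (real n powr (2 / 3)) * L 1 x))"
  have "\<exists>K N0. \<forall>n>0. real n powr (1 / 3) \<ge> N0 \<longrightarrow>
      (\<forall>x\<in>X. norm (1 ^ n * Q n x - Mn n x) \<le> norm (Mn n x) * (K / real n powr (1 / 3)))"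
    unfolding Mn_def
  proof (rule saddle_asymptotics[OF X(1) False lt])
    show "continuous_on X (L 1)" by (rule continuous_on_L[OF lt nonpos]) auto
    show "Re (L 1 x) > 0" if "x \<in> X" for x by (rule pos[OF that])
    show "Im (L 1 x) ^ 2 < 3 * Re (L 1 x) ^ 2" if "x \<in> X" for x by (rule L_sector_strict[OF nonpos[OF that]]) simp
    show "Re (L k x) < Re (L 1 x)" if "x \<in> X" "k \<ge> 1" "k \<noteq> 1" for x k by (rule phaseD(3)[OF ph(1)[OF that(1)] that(2,3)])
    show "\<exists>C. \<forall>x\<in>X. \<forall>s\<in>cone M. norm (log_gf x (1 * exp (- s)) - (L 1 x ^ 3 / (2 * s ^ 2) + B x)) \<le> C * norm s" for M
      unfolding B_def using expansion_at_1[OF r(1) r(2)] by blast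
    show "continuous_on X B"
      unfolding B_def using lt one_minus_not_nonpos by (intro continuous_intros) auto
  qed auto
  hence "\<exists>(C :: real) E. \<forall>\<^sub>F n in sequentially. \<forall>x\<in>X.
      Q n x = 1 ^ n * Mn n x * (1 + E n x) \<and> norm (E n x) \<le> C * real n powr (- 1 / 3)"
    by (rule relative_error) (use pos in \<open>force simp: Mn_def\<close>)+
  moreover have "exp (B x) = (1 - x) powr (1 / 12)" if "x \<in> X" for x
    using one_minus_not_nonpos[OF lt[OF that]] by (auto simp: B_def powr_def)
  ultimately show ?thesis by (simp add: Mn_def cong: ball_cong)
qed auto

theorem asymptotics_phase2:
  assumes X: "compact X" "X \<subseteq> phase 2"
  shows "\<exists>(C :: real) (E :: nat \<Rightarrow> complex \<Rightarrow> complex).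
              \<forall>\<^sub>F n in sequentially. \<forall>x \<in> X.
                Q n x = (- 1) ^ n
                        * (1 - x ^ 2) powr (1 / 24)
                        * ((1 - x) / (1 + x)) powr (1 / 8)
                        * csqrt (L 2 x / of_real (6 * pi * real n powr (4 / 3)))
                        * exp (3 / 2 * of_real (real n powr (2 / 3)) * L 2 x)
                        * (1 + E n x) \<and>
                norm (E n x) \<le> C * real n powr (- 1 / 3)"
proof (cases "X = {}")
  case False
  have ph: "x \<in> phase 2" if "x \<in> X" for x using X that by auto
  have lt: "norm x < 1" if "x \<in> X" for x using phaseD(2)[OF ph[OF that]] .
  have lt2: "norm (x ^ 2) < 1" if "x \<in> X" for x using lt[OF that] by (simp add: norm_power power_less_one_iff)
  have pos: "Re (L 2 x) > 0" if "x \<in> X" for x using phase_Re_pos[OF ph[OF that]] .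
  have nonpos: "2 * Li3 (x ^ 2) \<notin> \<real>\<^sub>\<le>\<^sub>0" if "x \<in> X" for x using Li3_phase2[OF ph[OF that]] .
  obtain r where r: "r < 1" "\<And>x. x \<in> X \<Longrightarrow> norm x \<le> r" using compact_norm_bound[OF X(1) False lt] by blast
  define B where "B = (\<lambda>x. Ln (1 - x ^ 2) / 24 + (2 * Ln (1 - x) - Ln (1 - x ^ 2)) / 8)"
  define Mn where "Mn = (\<lambda>n x. exp (B x) * csqrt (L 2 x / of_real (6 * pi * real n powr (4 / 3)))
                        * exp (3 / 2 * of_real (real n powr (2 / 3)) * L 2 x))"
  have "\<exists>K N0. \<forall>n>0. real n powr (1 / 3) \<ge> N0 \<longrightarrow>
      (\<forall>x\<in>X. norm ((- 1) ^ n * Q n x - Mn n x) \<le> norm (Mn n x) * (K / real n powr (1 / 3)))"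
    unfolding Mn_def
  proof (rule saddle_asymptotics[OF X(1) False lt])
    show "continuous_on X (L 2)" by (rule continuous_on_L[OF lt nonpos]) auto
    show "Re (L 2 x) > 0" if "x \<in> X" for x by (rule pos[OF that])
    show "Im (L 2 x) ^ 2 < 3 * Re (L 2 x) ^ 2" if "x \<in> X" for x by (rule L_sector_strict[OF nonpos[OF that]]) simp
    show "Re (L k x) < Re (L 2 x)" if "x \<in> X" "k \<ge> 1" "k \<noteq> 2" for x k by (rule phaseD(3)[OF ph[OF that(1)] that(2,3)])
    show "u = - 1" if "u ^ 2 = 1" "\<And>j. 0 < j \<Longrightarrow> j < 2 \<Longrightarrow> u ^ j \<noteq> 1" for u :: complex
      using that(1) that(2)[of 1] by (auto simp: power2_eq_1_iff)
    show "\<exists>C. \<forall>x\<in>X. \<forall>s\<in>cone M. norm (log_gf x (- 1 * exp (- s)) - (L 2 x ^ 3 / (2 * s ^ 2) + B x)) \<le> C * norm s" for M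
      unfolding B_def using expansion_at_minus_1[OF r(1) r(2)] by blast
    show "continuous_on X B"
      unfolding B_def using one_minus_not_nonpos[OF lt] one_minus_not_nonpos[OF lt2] by (intro continuous_intros) auto
  qed auto
  hence "\<exists>(C :: real) E. \<forall>\<^sub>F n in sequentially. \<forall>x\<in>X.
      Q n x = (- 1) ^ n * Mn n x * (1 + E n x) \<and> norm (E n x) \<le> C * real n powr (- 1 / 3)"
    by (rule relative_error) (use pos in \<open>force simp: Mn_def\<close>)+
  \<comment> \<open>The logarithms in \<open>B\<close> combine to the principal logarithm of
    \<open>(1 - x) / (1 + x)\<close>, so the two principal powers appear without a branch
    correction.\<close>
  moreover have "exp (B x) = (1 - x ^ 2) powr (1 / 24) * ((1 - x) / (1 + x)) powr (1 / 8)" if "x \<in> X" for x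
  proof -
    have "1 - x ^ 2 \<noteq> 0" "1 - x \<noteq> 0" "1 - (- x) \<noteq> 0"
      using one_minus_not_nonpos[OF lt2[OF that]] one_minus_not_nonpos[OF lt[OF that]]
        one_minus_not_nonpos[of "- x"] lt[OF that] by fastforce+
    thus ?thesis by (simp add: B_def Ln_quotient[OF lt[OF that]] powr_def exp_add)
  qed
  ultimately show ?thesis by (simp add: Mn_def mult.assoc cong: ball_cong)
qed auto

theorem theorem2:
  shows "(\<forall>X :: complex set. compact X \<and> X \<subseteq> phase 1 - complex_of_real ` {xstar..0} \<longrightarrow>
           (\<exists>(C :: real) (E :: nat \<Rightarrow> complex \<Rightarrow> complex).
              \<forall>\<^sub>F n in sequentially. \<forall>x \<in> X.
                Q n x = (1 - x) powr (1 / 12)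
                        * csqrt (L 1 x / of_real (6 * pi * real n powr (4 / 3)))
                        * exp (3 / 2 * of_real (real n powr (2 / 3)) * L 1 x)
                        * (1 + E n x) \<and>
                norm (E n x) \<le> C * real n powr (- 1 / 3)))
       \<and> (\<forall>X :: complex set. compact X \<and> X \<subseteq> phase 2 \<longrightarrow>
           (\<exists>(C :: real) (E :: nat \<Rightarrow> complex \<Rightarrow> complex).
              \<forall>\<^sub>F n in sequentially. \<forall>x \<in> X.
                Q n x = (- 1) ^ n
                        * (1 - x ^ 2) powr (1 / 24)
                        * ((1 - x) / (1 + x)) powr (1 / 8)
                        * csqrt (L 2 x / of_real (6 * pi * real n powr (4 / 3)))
                        * exp (3 / 2 * of_real (real n powr (2 / 3)) * L 2 x)
                        * (1 + E n x) \<and>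
                norm (E n x) \<le> C * real n powr (- 1 / 3)))"
  using asymptotics_phase1 asymptotics_phase2 by blast

end
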